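(* For $\theta\in(0,2\pi)$ let $\Theta$ denote counter-clockwise rotation of $\mathbb{R}^2$ by the angle $\theta$ and let $$B_{\theta}(f,g)(x)=\int_{S^1} f(x-y)\,g(x-\Theta y)\,d\sigma(y),\qquad x\in\mathbb{R}^2 .$$ (i) Suppose $\theta\neq\pi$. Then the type set $Q(B_\theta)$, i.e. the set of those $\left(\frac1p,\frac1q,\frac1r\right)\in[0,1]^3$ such that $B_\theta:L^p(\mathbb{R}^2)\times L^q(\mathbb{R}^2)\to L^r(\mathbb{R}^2)$ is bounded, is the closed polyhedron with vertices $$(0,0,0),\ \left(\tfrac23,\tfrac23,1\right),\ \left(0,\tfrac23,\tfrac13\right),\ \left(\tfrac23,0,\tfrac13\right),\ (1,0,1),\ (0,1,1),\ \left(\tfrac12,\tfrac12,\tfrac12\right),$$ except for the point $\left(\frac12,\frac12,\frac12\right)$, where a restricted strong type bound holds: $B_\theta:L^{2,1}(\mathbb{R}^2)\times L^{2,1}(\mathbb{R}^2)\to L^2(\mathbb{R}^2)$ is bounded. (Whether the strong type bound holds at $\left(\frac12,\frac12,\frac12\right)$ is not asserted either way.) (ii) If $\theta=\pi$, then $B_\pi:L^p(\mathbb{R}^2)\times L^q(\mathbb{R}^2)\to L^r(\mathbb{R}^2)$ is bounded whenever $\left(\frac1p,\frac1q,\frac1r\right)$ belongs to the closed polyhedron with vertices $$(0,0,0),\ \left(\tfrac23,\tfrac23,1\right),\ \left(0,\tfrac23,\tfrac13\right),\ \left(\tfrac23,0,\tfrac13\right),\ (0,1,1),\ (1,0,1).$$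 (iii) Moreover, in the Banach cube $p,q,r\ge1$ (i.e. $\left(\frac1p,\frac1q,\frac1r\right)\in[0,1]^3$), the exponents in both (i) and (ii) are best possible: for $\theta\ne\pi$ (respectively $\theta=\pi$), if $\left(\frac1p,\frac1q,\frac1r\right)\in[0,1]^3$ lies outside the closed polyhedron in (i) (respectively in (ii)), then $B_\theta$ is not bounded from $L^p(\mathbb{R}^2)\times L^q(\mathbb{R}^2)$ to $L^r(\mathbb{R}^2)$; the only question left open is whether in case (i) there is a strong type estimate at $\left(\frac12,\frac12,\frac12\right)$.
   Context: $\sigma$ is arc-length measure on the unit circle $S^1\subset\mathbb{R}^2$. $L^p(\mathbb{R}^2)$ is taken with respect to Lebesgue measure, with $\frac1p=0$ meaning $p=\infty$. Boundedness $B:L^p\times L^q\to L^r$ means that there is a constant $C$ with $\|B(f,g)\|_{L^r}\le C\|f\|_{L^p}\|g\|_{L^q}$ for all $f,g$. $L^{2,1}$ denotes the Lorentz space. "The closed polyhedron with vertices $v_1,\dots,v_k$" means the convex hull of $v_1,\dots,v_k$ in $\mathbb{R}^3$. *)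

theory Defs
  imports "HOL-Analysis.Analysis" "HOL-Probability.Essential_Supremum"
begin

text \<open>The exponent \<open>a\<close> is meant to be positive, so that \<open>\<infinity>\<close> is sent to \<open>\<infinity>\<close>.\<close>

definition ennpowr :: "ennreal \<Rightarrow> real \<Rightarrow> ennreal" where
  "ennpowr u a = (if u = \<infinity> then \<infinity> else ennreal (enn2real u powr a))"

text \<open>The norm of \<open>L\<^sup>p(\<real>\<^sup>2)\<close>, as a function of the reciprocal exponent \<open>a = 1/p\<close>;
  \<open>a = 0\<close> stands for \<open>p = \<infinity>\<close>.\<close>

definition Lnorm :: "real \<Rightarrow> (real^2 \<Rightarrow> complex) \<Rightarrow> ennreal" where
  "Lnorm a f =
    (if a = 0 then esssup lborel (\<lambda>x. ennreal (norm (f x)))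
     else ennpowr (\<integral>\<^sup>+ x. ennreal (norm (f x) powr (1 / a)) \<partial>lborel) a)"

definition decreasing_rearrangement :: "(real^2 \<Rightarrow> complex) \<Rightarrow> real \<Rightarrow> ennreal" where
  "decreasing_rearrangement f t =
    Inf {s. emeasure lborel {x. s < ennreal (norm (f x))} \<le> ennreal t}"

text \<open>The Lorentz quasi-norm of \<open>L\<^sup>p\<^sup>,\<^sup>q(\<real>\<^sup>2)\<close> for finite \<open>p\<close> and \<open>q\<close>. It is not
  normalised by the factor \<open>(q/p)\<^sup>1\<^sup>/\<^sup>q\<close> used by some authors.\<close>

definition lorentz_norm :: "real \<Rightarrow> real \<Rightarrow> (real^2 \<Rightarrow> complex) \<Rightarrow> ennreal" where
  "lorentz_norm p q f =
    ennpowr (\<integral>\<^sup>+ t\<in>{0<..}. ennpowr (ennreal (t powr (1 / p)) * decreasing_rearrangement f t) q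
                          * ennreal (1 / t) \<partial>lborel) (1 / q)"

text \<open>Arc length on the unit circle, as a Borel measure on the plane concentrated on the circle.\<close>

definition arc_length :: "(real^2) measure" where
  "arc_length =
    distr (restrict_space lborel {0..<2 * pi}) borel (\<lambda>t. vector [cos t, sin t])"

definition rotation :: "real \<Rightarrow> real^2 \<Rightarrow> real^2" where
  "rotation \<theta> y =
    vector [cos \<theta> * y $ 1 - sin \<theta> * y $ 2, sin \<theta> * y $ 1 + cos \<theta> * y $ 2]"

definition bilinear_avg :: "real \<Rightarrow> (real^2 \<Rightarrow> complex) \<Rightarrow> (real^2 \<Rightarrow> complex) \<Rightarrow> real^2 \<Rightarrow> complex" where
  "bilinear_avg \<theta> f g x = (\<integral>y. f (x - y) * g (x - rotation \<theta> y) \<partial>arc_length)"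

text \<open>Elements of the spaces are represented by Borel functions: every class of Lebesgue measurable
  functions modulo null sets contains one, and \<open>bilinear_avg \<theta> f g\<close> changes only on a null set with the choice
  of representatives. A Bochner integral that does not converge has value \<open>0\<close>, so almost everywhere
  convergence of the integral defining \<open>bilinear_avg \<theta> f g\<close> is required explicitly.\<close>

definition avg_bounded ::
  "real \<Rightarrow> ((real^2 \<Rightarrow> complex) \<Rightarrow> ennreal) \<Rightarrow> ((real^2 \<Rightarrow> complex) \<Rightarrow> ennreal)
    \<Rightarrow> ((real^2 \<Rightarrow> complex) \<Rightarrow> ennreal) \<Rightarrow> bool" where
  "avg_bounded \<theta> N\<^sub>1 N\<^sub>2 N\<^sub>3 \<longleftrightarrow>
    (\<exists>C::real. 0 \<le> C \<and>
      (\<forall>f g. f \<in> borel_measurable borel \<longrightarrow> g \<in> borel_measurable borel \<longrightarrow>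
        N\<^sub>1 f < \<infinity> \<longrightarrow> N\<^sub>2 g < \<infinity> \<longrightarrow>
        (AE x in lborel. integrable arc_length (\<lambda>y. f (x - y) * g (x - rotation \<theta> y))) \<and>
        N\<^sub>3 (bilinear_avg \<theta> f g) \<le> ennreal C * N\<^sub>1 f * N\<^sub>2 g))"

definition Lp_bounded :: "real \<Rightarrow> real \<times> real \<times> real \<Rightarrow> bool" where
  "Lp_bounded \<theta> = (\<lambda>(a, b, c). avg_bounded \<theta> (Lnorm a) (Lnorm b) (Lnorm c))"

definition unit_cube :: "(real \<times> real \<times> real) set" where
  "unit_cube = {0..1} \<times> {0..1} \<times> {0..1}"

definition type_set :: "real \<Rightarrow> (real \<times> real \<times> real) set" where
  "type_set \<theta> = {v \<in> unit_cube. Lp_bounded \<theta> v}"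

definition polyhedron_generic :: "(real \<times> real \<times> real) set" where
  "polyhedron_generic = convex hull
    {(0, 0, 0), (2/3, 2/3, 1), (0, 2/3, 1/3), (2/3, 0, 1/3), (1, 0, 1), (0, 1, 1),
     (1/2, 1/2, 1/2)}"

definition polyhedron_pi :: "(real \<times> real \<times> real) set" where
  "polyhedron_pi = convex hull
    {(0, 0, 0), (2/3, 2/3, 1), (0, 2/3, 1/3), (2/3, 0, 1/3), (0, 1, 1), (1, 0, 1)}"

end

theory Submission
  imports Defs
begin

text \<open>
  All estimates reduce to the positive operator \<open>pos_avg\<close>, for which interpolation needs only Hoelder's
  inequality: writing \<open>f = f\<^sub>0\<^sup>1\<^sup>-\<^sup>s f\<^sub>1\<^sup>s\<close> with powers \<open>f\<^sub>0\<close>, \<open>f\<^sub>1\<close> of \<open>f\<close>, the set of exponents that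
  admit a bound is convex, so that only the vertices have to be treated. The basic tool is that
  \<open>(y, z) \<mapsto> y - z\<close> on pairs of points of the circle has Jacobian \<open>|y \<and> z|\<close>; hence
  \<open>\<integral>\<integral>\<integral> F (x - y) G (x - z) |y \<and> z| \<le> 2 \<parallel>F\<parallel>\<^sub>1 \<parallel>G\<parallel>\<^sub>1\<close>.

  For the bound of circular averages from \<open>L\<^sup>3\<^sup>/\<^sup>2\<close> to \<open>L\<^sup>3\<close>, which gives three of the vertices, expand the cube and
  write \<open>f\<^sub>1 f\<^sub>2 f\<^sub>3\<close> as the geometric mean of \<open>F\<^sub>1 F\<^sub>2 w\<^sub>1\<^sub>2\<close>, \<open>F\<^sub>1 F\<^sub>3 w\<^sub>1\<^sub>3\<close>, \<open>F\<^sub>2 F\<^sub>3 w\<^sub>2\<^sub>3\<close> with \<open>F = f\<^sup>3\<^sup>/\<^sup>2\<close> and weights whose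
  product is 1 and for which integrating \<open>w\<^sub>1\<^sub>2\<close> over the third point yields at most a multiple of \<open>|y\<^sub>1 \<and> y\<^sub>2|\<close>.
  At \<open>(1/2, 1/2, 1/2)\<close> the square of the \<open>L\<^sup>2\<close> norm is a fourfold product that can be paired in two ways, with
  Jacobians \<open>|y \<and> z|\<close> and \<open>|y \<and> \<Theta>z|\<close>, \<open>|\<Theta>y \<and> z|\<close>. As \<open>|sin \<theta>| \<le> |y \<and> z| + |y \<and> \<Theta>z|\<close>, these do not degenerate
  simultaneously if \<open>\<theta> \<noteq> \<pi>\<close>, and even the strong type bound holds; the Lorentz space bound follows from it
  because \<open>L\<^sup>2\<^sup>,\<^sup>1\<close> embeds into \<open>L\<^sup>2\<close>.

  Necessity is tested on indicator functions of discs and annuli and, for \<open>\<theta> = \<pi>\<close>, of \<open>\<epsilon>\<^sup>2 \<times> \<epsilon>\<close> boxes.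
\<close>

section \<open>The unit circle and its arc length\<close>

definition circ :: "real \<Rightarrow> real^2" where
  "circ t = vector [cos t, sin t]"

text \<open>On the circle this is the modulus of the sine of the angle between the two vectors, which also vanishes
  at antipodal points.\<close>

definition wedge :: "real^2 \<Rightarrow> real^2 \<Rightarrow> real" where
  "wedge y z = \<bar>y $ 1 * z $ 2 - y $ 2 * z $ 1\<bar>"

lemma vector_2_eq_Basis: "(vector [a, b] :: real^2) = a *\<^sub>R axis 1 1 + b *\<^sub>R axis 2 1"
  by (simp add: vec_eq_iff forall_2 axis_def)

lemma circ_nth [simp]: "circ t $ 1 = cos t" "circ t $ 2 = sin t"
  by (simp_all add: circ_def)

lemma continuous_circ [continuous_intros]:
  fixes f :: "'a::t2_space \<Rightarrow> real"
  shows "continuous_on S f \<Longrightarrow> continuous_on S (\<lambda>x. circ (f x))"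
  unfolding circ_def vector_2_eq_Basis
  by (intro continuous_on_add continuous_on_scaleR continuous_on_const continuous_on_cos continuous_on_sin)

lemma measurable_circ [measurable]: "circ \<in> borel_measurable borel"
  by (intro borel_measurable_continuous_onI continuous_intros)

lemma wedge_measurable [measurable]:
  assumes [measurable]: "f \<in> borel_measurable M" "g \<in> borel_measurable M"
  shows "(\<lambda>x. wedge (f x) (g x)) \<in> borel_measurable M"
proof -
  have *: "(\<lambda>x::real^2. x $ i) \<in> borel_measurable borel" for i
    by (intro borel_measurable_continuous_onI continuous_intros)
  have [measurable]: "(\<lambda>x. f x $ i) \<in> borel_measurable M" "(\<lambda>x. g x $ i) \<in> borel_measurable M" for i
    using measurable_compose[OF assms(1) *] measurable_compose[OF assms(2) *] by auto
  show ?thesis unfolding wedge_def by measurable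
qed

lemma rotation_measurable [measurable]: "rotation \<theta> \<in> borel_measurable borel"
  unfolding rotation_def vector_2_eq_Basis
  by (intro borel_measurable_continuous_onI continuous_intros)

lemma rotation_circ: "rotation \<theta> (circ t) = circ (t + \<theta>)"
  by (simp add: vec_eq_iff forall_2 rotation_def cos_add sin_add algebra_simps)

lemma norm_circ [simp]: "norm (circ t) = 1"
  by (simp add: norm_vec_def L2_set_def UNIV_2)

lemma circ_periodic: "circ (t + 2 * pi) = circ t"
  by (simp add: vec_eq_iff forall_2)

lemma circ_periodic_int: "circ (t + 2 * pi * of_int k) = circ t"
proof -
  have "sin (t + 2 * pi * of_int k) = sin t" "cos (t + 2 * pi * of_int k) = cos t"
    by (simp_all add: sin_add cos_add)
  then show ?thesis by (simp add: vec_eq_iff forall_2)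
qed

lemma sets_arc_length [measurable_cong, simp]: "sets arc_length = sets borel"
  by (simp add: arc_length_def)

lemma space_arc_length [simp]: "space arc_length = UNIV"
  by (simp add: arc_length_def)

lemma nn_integral_arc_length:
  assumes [measurable]: "h \<in> borel_measurable borel"
  shows "(\<integral>\<^sup>+y. h y \<partial>arc_length) = (\<integral>\<^sup>+t\<in>{0..<2*pi}. h (circ t) \<partial>lborel)"
  unfolding arc_length_def circ_def[symmetric]
  by (subst nn_integral_distr)
     (auto simp: nn_integral_restrict_space intro!: measurable_restrict_space1)

lemma emeasure_arc_length_UNIV [simp]: "emeasure arc_length UNIV = ennreal (2 * pi)"
proof -
  have "emeasure arc_length UNIV = (\<integral>\<^sup>+y. 1 \<partial>arc_length)" by simp
  then show ?thesis by (subst (asm) nn_integral_arc_length) auto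
qed

interpretation arc: finite_measure arc_length
  by standard simp

text \<open>Cut the period at \<open>p - c\<close>: the left piece translates to
  \<open>[c, p)\<close>, and periodicity carries the right piece to \<open>[0, c)\<close>.\<close>

lemma nn_integral_periodic_shift:
  fixes h :: "real \<Rightarrow> ennreal"
  assumes [measurable]: "h \<in> borel_measurable borel" and p: "\<And>t. h (t + p) = h t" and c: "0 \<le> c" "c \<le> p"
  shows "(\<integral>\<^sup>+t\<in>{0..<p}. h (t + c) \<partial>lborel) = (\<integral>\<^sup>+t\<in>{0..<p}. h t \<partial>lborel)"
proof -
  have q: "h (p + t) = h t" "h (p - c + t + c) = h t" for t
    using p[of t] by (simp_all add: algebra_simps)
  have "(\<integral>\<^sup>+t\<in>{0..<p}. h (t + c) \<partial>lborel)
      = (\<integral>\<^sup>+t\<in>{0..<p-c}. h (t + c) \<partial>lborel) + (\<integral>\<^sup>+t\<in>{p-c..<p}. h (t + c) \<partial>lborel)"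
    using c by (subst nn_integral_add[symmetric]) (auto intro!: nn_integral_cong split: split_indicator)
  also have "(\<integral>\<^sup>+t\<in>{0..<p-c}. h (t + c) \<partial>lborel) = (\<integral>\<^sup>+t\<in>{c..<p}. h t \<partial>lborel)"
    by (subst nn_integral_real_affine[where c=1 and t=c and f = "\<lambda>t. h t * indicator {c..<p} t"])
       (auto intro!: nn_integral_cong simp: indicator_def add.commute)
  also have "(\<integral>\<^sup>+t\<in>{p-c..<p}. h (t + c) \<partial>lborel) = (\<integral>\<^sup>+t\<in>{0..<c}. h t \<partial>lborel)"
    by (subst nn_integral_real_affine[where c=1 and t="p-c" and f = "\<lambda>t. h (t + c) * indicator {p-c..<p} t"])
       (auto intro!: nn_integral_cong simp: q split: split_indicator)
  also have "(\<integral>\<^sup>+t\<in>{c..<p}. h t \<partial>lborel) + (\<integral>\<^sup>+t\<in>{0..<c}. h t \<partial>lborel) = (\<integral>\<^sup>+t\<in>{0..<p}. h t \<partial>lborel)"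
    using c by (subst nn_integral_add[symmetric]) (auto intro!: nn_integral_cong simp: indicator_def)
  finally show ?thesis .
qed

lemma nn_integral_arc_length_shift:
  assumes [measurable]: "h \<in> borel_measurable borel"
  shows "(\<integral>\<^sup>+t\<in>{0..<2*pi}. h (circ (t + c)) \<partial>lborel) = (\<integral>\<^sup>+y. h y \<partial>arc_length)"
proof -
  \<comment> \<open>Whole turns are removed first, because the periodic shift is available only for
    shifts within one period.\<close>
  define k where "k = \<lfloor>c / (2*pi)\<rfloor>"
  define d where "d = c - 2 * pi * of_int k"
  have "of_int k \<le> c / (2*pi)" "c / (2*pi) < of_int k + 1"
    unfolding k_def by linarith+
  then have d: "0 \<le> d" "d \<le> 2 * pi"
    using pi_gt_zero by (auto simp: d_def field_simps)
  have "circ (t + c) = circ (t + d)" for t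
    using circ_periodic_int[of "t + d" k] by (simp add: d_def)
  then show ?thesis
    using nn_integral_periodic_shift[of "\<lambda>t. h (circ t)" "2*pi" d] d
    by (simp add: nn_integral_arc_length circ_periodic)
qed

lemma nn_integral_arc_length_rotation:
  assumes [measurable]: "h \<in> borel_measurable borel"
  shows "(\<integral>\<^sup>+y. h (rotation \<theta> y) \<partial>arc_length) = (\<integral>\<^sup>+y. h y \<partial>arc_length)"
  by (simp add: nn_integral_arc_length[of "\<lambda>y. h (rotation \<theta> y)"] rotation_circ nn_integral_arc_length_shift)

lemma wedge_circ: "wedge (circ s) (circ t) = \<bar>sin (t - s)\<bar>"
  by (simp add: wedge_def sin_diff mult.commute)

lemma wedge_commute: "wedge y z = wedge z y"
  unfolding wedge_def by (simp add: abs_minus_commute mult.commute)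

lemma AE_arc_length:
  assumes "\<And>t. P (circ t)" and [measurable]: "Measurable.pred borel P"
  shows "AE y in arc_length. P y"
  unfolding arc_length_def circ_def[symmetric]
  by (subst AE_distr_iff) (auto simp: assms intro!: measurable_restrict_space1)

text \<open>The exceptional angles are \<open>s\<close> plus integer multiples of \<pi>, a countable
  set. It has to be avoided wherever negative powers of \<open>wedge\<close> occur, since
  \<open>0 powr a\<close> is 0 rather than infinite.\<close>

lemma AE_arc_length_wedge: "AE z in arc_length. wedge (circ s) z \<noteq> 0"
proof -
  have "t \<in> range (\<lambda>n::int. of_int n * pi + s)" if z: "sin (t - s) = 0" for t
  proof -
    obtain n :: int where "t - s = of_int n * pi"
      using z unfolding sin_zero_iff_int2 by blast
    then have "t = of_int n * pi + s" by simp
    then show ?thesis by blast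
  qed
  then have "{t. sin (t - s) = 0} \<subseteq> range (\<lambda>n::int. of_int n * pi + s)" by blast
  then have "countable {t. sin (t - s) = 0}"
    by (rule countable_subset) simp
  then have "{t. sin (t - s) = 0} \<in> null_sets lborel"
    by (rule countable_imp_null_set_lborel)
  then have "AE t in lborel. sin (t - s) \<noteq> 0"
    using AE_not_in by force
  then have "AE t in restrict_space lborel {0..<2*pi}. wedge (circ s) (circ t) \<noteq> 0"
    by (simp add: AE_restrict_space_iff wedge_circ, elim eventually_mono) simp
  then show ?thesis
    unfolding arc_length_def circ_def[symmetric]
    by (simp add: AE_distr_iff measurable_restrict_space1)
qed

section \<open>The Jacobian of the difference of two points of the circle\<close>

text \<open>The planar measure is recognised as the image of the product of two lines by its values
  on boxes; then Tonelli's theorem applies.\<close>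

lemma nn_integral_lborel_vector_2:
  fixes h :: "real^2 \<Rightarrow> ennreal"
  assumes [measurable]: "h \<in> borel_measurable borel"
  shows "(\<integral>\<^sup>+w. h w \<partial>lborel) = (\<integral>\<^sup>+s. \<integral>\<^sup>+t. h (vector [s, t]) \<partial>lborel \<partial>lborel)"
proof -
  define V :: "real \<times> real \<Rightarrow> real^2" where "V = (\<lambda>(s, t). vector [s, t])"
  have V [measurable]: "V \<in> borel_measurable (lborel \<Otimes>\<^sub>M lborel)"
    unfolding V_def vector_2_eq_Basis by measurable
  have "lborel = distr (lborel \<Otimes>\<^sub>M lborel) borel V"
  proof (rule lborel_eqI)
    fix l u :: "real^2"
    assume lu: "\<And>b. b \<in> Basis \<Longrightarrow> l \<bullet> b \<le> u \<bullet> b"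
    have b: "axis 1 1 \<in> (Basis :: (real^2) set)" "axis 2 1 \<in> (Basis :: (real^2) set)"
      by (auto simp: Basis_vec_def)
    have le: "l $ 1 \<le> u $ 1" "l $ 2 \<le> u $ 2"
      using lu[OF b(1)] lu[OF b(2)] by (auto simp: inner_axis)
    have B: "(Basis :: (real^2) set) = {axis 1 1, axis 2 1}"
      by (auto simp: Basis_vec_def UNIV_2)
    have ne: "(axis 1 1 :: real^2) \<noteq> axis 2 1"
      by (simp add: axis_eq_axis)
    have "V -` box l u \<inter> space (lborel \<Otimes>\<^sub>M lborel) = {l $ 1<..<u $ 1} \<times> {l $ 2<..<u $ 2}"
      by (auto simp: V_def space_pair_measure mem_box B inner_axis)
    then have "emeasure (distr (lborel \<Otimes>\<^sub>M lborel) borel V) (box l u) = ennreal (u $ 1 - l $ 1) * ennreal (u $ 2 - l $ 2)"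
      using le by (simp add: emeasure_distr lborel.emeasure_pair_measure_Times)
    also have "\<dots> = (\<Prod>b\<in>Basis. (u - l) \<bullet> b)"
      using le by (simp add: B ne inner_axis ennreal_mult)
    finally show "emeasure (distr (lborel \<Otimes>\<^sub>M lborel) borel V) (box l u) = (\<Prod>b\<in>Basis. (u - l) \<bullet> b)" .
  qed simp
  then have "(\<integral>\<^sup>+w. h w \<partial>lborel) = (\<integral>\<^sup>+w. h w \<partial>distr (lborel \<Otimes>\<^sub>M lborel) borel V)"
    by simp
  also have "\<dots> = (\<integral>\<^sup>+p. h (V p) \<partial>(lborel \<Otimes>\<^sub>M lborel))"
    by (simp add: nn_integral_distr)
  also have "\<dots> = (\<integral>\<^sup>+s. \<integral>\<^sup>+t. h (V (s, t)) \<partial>lborel \<partial>lborel)"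
    by (subst lborel.nn_integral_fst[symmetric]) auto
  finally show ?thesis by (simp add: V_def)
qed

text \<open>The difference \<open>y - z\<close> is parametrised by the angle of \<open>y\<close> and the angle from \<open>y\<close> to \<open>z\<close>. The length of the
  chord determines the second one on \<open>(0, \<pi>)\<close> and on \<open>(\<pi>, 2\<pi>)\<close>, and then its direction determines the first.\<close>

definition chord :: "real \<Rightarrow> real^2 \<Rightarrow> real^2 \<Rightarrow> real^2" where
  "chord \<rho> v w = v + \<rho> *\<^sub>R (circ (w $ 1) - circ (w $ 1 + w $ 2))"

lemma inj_on_chord:
  assumes I: "I = {0<..<pi} \<or> I = {pi<..<2*pi}" and "\<rho> > 0"
  shows "inj_on (chord \<rho> v) {w. w $ 1 \<in> {0..<2*pi} \<and> w $ 2 \<in> I}"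
proof (rule inj_onI, clarsimp)
  fix w w' :: "real^2"
  assume eq: "chord \<rho> v w = chord \<rho> v w'"
    and w: "0 \<le> w $ 1" "w $ 1 < 2 * pi" "w $ 2 \<in> I"
    and w': "0 \<le> w' $ 1" "w' $ 1 < 2 * pi" "w' $ 2 \<in> I"
  define s t s' t' where st: "s = w $ 1" "t = w $ 2" "s' = w' $ 1" "t' = w' $ 2"
  have "circ s - circ (s + t) = circ s' - circ (s' + t')"
    using eq \<open>\<rho> > 0\<close> by (simp add: chord_def st)
  then have e: "cos s - cos (s + t) = cos s' - cos (s' + t')" "sin s - sin (s + t) = sin s' - sin (s' + t')"
    by (simp_all add: vec_eq_iff forall_2)
  \<comment> \<open>Squared length of the chord. It does not involve \<open>s\<close>, so equal
    chords give equal cosines of \<open>t\<close> and \<open>t'\<close>.\<close>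
  have n: "(cos s - cos (s + t))\<^sup>2 + (sin s - sin (s + t))\<^sup>2 = 2 - 2 * cos t" for s t :: real
  proof -
    have "(cos s - cos (s + t))\<^sup>2 + (sin s - sin (s + t))\<^sup>2 =
        ((cos s)\<^sup>2 + (sin s)\<^sup>2) + ((cos (s + t))\<^sup>2 + (sin (s + t))\<^sup>2)
         - 2 * (cos (s + t) * cos s + sin (s + t) * sin s)"
      by (simp add: power2_eq_square algebra_simps)
    also have "cos (s + t) * cos s + sin (s + t) * sin s = cos (s + t - s)"
      by (simp only: cos_diff)
    finally show ?thesis by simp
  qed
  have "cos t = cos t'"
    using n[of s t] n[of s' t'] e by simp
  \<comment> \<open>The cosine is injective on \<open>[0, \<pi>]\<close> only; the interval from
    \<pi> to 2\<pi> is reflected into it.\<close>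
  moreover have "cos (2 * pi - t) = cos t" "cos (2 * pi - t') = cos t'"
    by (simp_all add: cos_diff)
  ultimately have tt: "t = t'"
    using I w(3) w'(3) cos_inj_pi[of t t'] cos_inj_pi[of "2 * pi - t" "2 * pi - t'"]
    by (auto simp: st)
  \<comment> \<open>With \<open>t = t'\<close> the equations are linear in the difference of
    \<open>circ s\<close> and \<open>circ s'\<close>, with coefficients \<open>C\<close>,
    \<open>S\<close> and determinant \<open>C\<^sup>2 + S\<^sup>2\<close>. This is nonzero because
    \<open>t\<close> is not a multiple of 2\<pi>.\<close>
  define C S where CS: "C = 1 - cos t" "S = sin t"
  have "cos t \<noteq> 1"
  proof
    assume "cos t = 1"
    then obtain n :: int where "t = of_int n * (2 * pi)"
      using cos_one_2pi_int[of t] by (auto simp: mult_ac)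
    moreover have "0 < t" "t < 2 * pi" using I w(3) pi_gt_zero by (auto simp: st)
    ultimately have "0 < of_int n * (2 * pi)" "of_int n * (2 * pi) < 1 * (2 * pi)" by auto
    then have "0 < n" "(of_int n :: real) < 1" using pi_gt_zero
      by (simp_all add: zero_less_mult_iff mult_less_cancel_right)
    then show False by linarith
  qed
  then have pos: "C\<^sup>2 + S\<^sup>2 > 0"
    by (simp add: CS sum_power2_gt_zero_iff)
  have e1: "C * (cos s - cos s') + S * (sin s - sin s') = 0"
    using e(1) unfolding tt[symmetric] CS cos_add by (simp add: algebra_simps)
  have e2: "C * (sin s - sin s') - S * (cos s - cos s') = 0"
    using e(2) unfolding tt[symmetric] CS sin_add by (simp add: algebra_simps)
  have "(C\<^sup>2 + S\<^sup>2) * (cos s - cos s') = 0" "(C\<^sup>2 + S\<^sup>2) * (sin s - sin s') = 0"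
    using e1 e2 by algebra+
  then have "sin s = sin s' \<and> cos s = cos s'" using pos by auto
  then obtain n :: int where n: "s = s' + 2 * pi * of_int n"
    using sin_cos_eq_iff by blast
  have "\<bar>s - s'\<bar> < 2 * pi" using w w' by (auto simp: st)
  then have "\<bar>of_int n\<bar> < (1::real)"
    using n pi_gt_zero by (simp add: abs_mult)
  then have "n = 0" by linarith
  with n have "s = s'" by simp
  with tt show "w = w'" by (simp add: vec_eq_iff forall_2 st)
qed

definition chord_deriv :: "real \<Rightarrow> real^2 \<Rightarrow> real^2 \<Rightarrow> real^2" where
  "chord_deriv \<rho> w h = \<rho> *\<^sub>R (h $ 1 *\<^sub>R vector [- sin (w $ 1), cos (w $ 1)]
     - (h $ 1 + h $ 2) *\<^sub>R vector [- sin (w $ 1 + w $ 2), cos (w $ 1 + w $ 2)])"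

lemma chord_has_derivative: "(chord \<rho> v has_derivative chord_deriv \<rho> w) (at w within S)"
  unfolding chord_def chord_deriv_def circ_def vector_2_eq_Basis
  by (auto intro!: derivative_eq_intros bounded_linear_imp_has_derivative bounded_linear_vec_nth
      simp: algebra_simps)

text \<open>Up to a column operation and signs, the columns are \<rho> times the unit tangents at
  the two endpoints. These enclose the same angle as the endpoints themselves, so the result is
  \<open>\<rho>\<^sup>2\<close> times the \<open>wedge\<close> of the endpoints.\<close>

lemma det_chord_deriv: "\<bar>det (matrix (chord_deriv \<rho> w))\<bar> = \<rho>\<^sup>2 * \<bar>sin (w $ 2)\<bar>"
proof -
  have "det (matrix (chord_deriv \<rho> w)) = \<rho>\<^sup>2 * (sin (w $ 1) * cos (w $ 1 + w $ 2) - cos (w $ 1) * sin (w $ 1 + w $ 2))"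
    by (simp add: det_2 matrix_def chord_deriv_def axis_def algebra_simps power2_eq_square)
  also have "sin (w $ 1) * cos (w $ 1 + w $ 2) - cos (w $ 1) * sin (w $ 1 + w $ 2) = - sin (w $ 2)"
    using sin_diff[of "w $ 1" "w $ 1 + w $ 2"] by simp
  finally show ?thesis by (simp add: abs_mult)
qed

lemma nth_measurable [measurable]: "(\<lambda>w::real^'n. w $ i) \<in> borel_measurable borel"
  by (intro borel_measurable_continuous_onI continuous_intros)

lemma vector_2_measurable [measurable]:
  assumes [measurable]: "f \<in> borel_measurable M" "g \<in> borel_measurable M"
  shows "(\<lambda>x. vector [f x, g x] :: real^2) \<in> borel_measurable M"
  unfolding vector_2_eq_Basis by measurable

lemma chord_measurable [measurable]: "chord \<rho> v \<in> borel_measurable borel"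
  unfolding chord_def by measurable

text \<open>Change of variables for an injective map, proved for measures: the image
  \<open>N\<close> of the weighted parameter domain is dominated by Lebesgue measure on every Borel
  set. Only an inequality results, as the image of the domain is not identified.\<close>

lemma nn_integral_chord_le:
  assumes I: "I = {0<..<pi} \<or> I = {pi<..<2*pi}" and "\<rho> > 0"
    and [measurable]: "G \<in> borel_measurable borel"
  shows "(\<integral>\<^sup>+w. G (chord \<rho> v w) * ennreal (\<rho>\<^sup>2 * \<bar>sin (w $ 2)\<bar>) * indicator {0..<2*pi} (w $ 1) * indicator I (w $ 2) \<partial>lborel)
    \<le> (\<integral>\<^sup>+x. G x \<partial>lborel)"
proof -
  define S where "S = {w::real^2. w $ 1 \<in> {0..<2*pi} \<and> w $ 2 \<in> I}"
  have I_meas [measurable]: "I \<in> sets borel" using I by auto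
  have S_meas [measurable]: "S \<in> sets borel"
  proof -
    have "{w \<in> space borel. w $ 1 \<in> {0..<2*pi} \<and> w $ 2 \<in> I} \<in> sets (borel :: (real^2) measure)"
      by measurable
    then show ?thesis by (simp add: S_def)
  qed
  define dens where "dens w = ennreal (\<rho>\<^sup>2 * \<bar>sin (w $ 2)\<bar>) * indicator S w" for w :: "real^2"
  have [measurable]: "dens \<in> borel_measurable borel" unfolding dens_def by measurable
  define N where "N = distr (density lborel dens) borel (chord \<rho> v)"
  have le: "emeasure N A \<le> emeasure lborel A" if [measurable]: "A \<in> sets borel" for A
  proof -
    define T where "T = S \<inter> chord \<rho> v -` A"
    have T: "T \<in> sets borel"
      using measurable_sets[OF chord_measurable that] by (simp add: T_def)
    \<comment> \<open>Boundedness of \<open>T\<close> makes the Jacobian integrable on it, so that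
      the measure of the image is given by a finite integral.\<close>
    have Tb: "T \<subseteq> cbox (vector [0,0]) (vector [2*pi, 2*pi])"
      using I by (auto simp: T_def S_def mem_box_cart forall_2)
    have fT: "emeasure lborel T < \<infinity>"
      by (rule le_less_trans[OF emeasure_mono[OF Tb]]) (auto simp: emeasure_lborel_cbox_finite[unfolded infinity_ennreal_def])
    have int: "set_integrable lborel T (\<lambda>w. \<rho>\<^sup>2 * \<bar>sin (w $ 2)\<bar>)"
      unfolding set_integrable_def real_scaleR_def
    proof (rule integrableI_bounded_set[where A=T and B="\<rho>\<^sup>2"])
      show "AE x\<in>T in lborel. norm (indicat_real T x * (\<rho>\<^sup>2 * \<bar>sin (x $ 2)\<bar>)) \<le> \<rho>\<^sup>2"
        by (auto simp: indicator_def mult_left_le)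
    qed (use T fT in auto)
    have T': "T \<in> sets lebesgue" using T by simp
    have inj: "inj_on (chord \<rho> v) T"
      using inj_on_chord[OF I \<open>\<rho> > 0\<close>, of v] by (rule inj_on_subset) (auto simp: T_def S_def)
    let ?m = "integral T (\<lambda>w. \<rho>\<^sup>2 * \<bar>sin (w $ 2)\<bar>)"
    have "chord \<rho> v ` T \<in> lmeasurable \<and> measure lebesgue (chord \<rho> v ` T) = ?m"
      using has_measure_differentiable_image[OF T' chord_has_derivative inj, where m = ?m]
        set_borel_integral_eq_integral(1)[OF int]
      by (simp add: det_chord_deriv has_integral_integral)
    then have m: "chord \<rho> v ` T \<in> lmeasurable" "measure lebesgue (chord \<rho> v ` T) = ?m" by auto
    have "emeasure N A = (\<integral>\<^sup>+w. dens w * indicator (chord \<rho> v -` A) w \<partial>lborel)"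
      unfolding N_def using measurable_sets[OF chord_measurable that]
      by (simp add: emeasure_distr emeasure_density)
    also have "\<dots> = (\<integral>\<^sup>+w. ennreal (indicator T w *\<^sub>R (\<rho>\<^sup>2 * \<bar>sin (w $ 2)\<bar>)) \<partial>lborel)"
      by (intro nn_integral_cong) (auto simp: dens_def T_def split: split_indicator)
    also have "\<dots> = ennreal (LINT w|lborel. indicator T w *\<^sub>R (\<rho>\<^sup>2 * \<bar>sin (w $ 2)\<bar>))"
      using int unfolding set_integrable_def
      by (rule nn_integral_eq_integral) (auto simp: indicator_def)
    also have "(LINT w|lborel. indicator T w *\<^sub>R (\<rho>\<^sup>2 * \<bar>sin (w $ 2)\<bar>)) = ?m"
      using set_borel_integral_eq_integral(2)[OF int] unfolding set_lebesgue_integral_def .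
    also have "ennreal ?m = emeasure lebesgue (chord \<rho> v ` T)"
      unfolding emeasure_eq_measure2[OF m(1)] m(2) ..
    also have "\<dots> \<le> emeasure lebesgue A"
      using that by (intro emeasure_mono) (auto simp: T_def)
    finally show ?thesis using that by simp
  qed
  have "N \<le> lborel"
    by (subst le_measure) (auto simp: N_def le_fun_def le[unfolded N_def] emeasure_notin_sets)
  have "(\<integral>\<^sup>+x. G x \<partial>N) = (\<integral>\<^sup>+w. dens w * G (chord \<rho> v w) \<partial>lborel)"
    by (simp add: N_def nn_integral_distr nn_integral_density)
  also have "\<dots> = (\<integral>\<^sup>+w. G (chord \<rho> v w) * ennreal (\<rho>\<^sup>2 * \<bar>sin (w $ 2)\<bar>) * indicator {0..<2*pi} (w $ 1) * indicator I (w $ 2) \<partial>lborel)"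
    by (intro nn_integral_cong) (auto simp: dens_def S_def mult.commute split: split_indicator)
  finally show ?thesis
    using nn_integral_mono_measure[OF _ \<open>N \<le> lborel\<close>, of G] by (simp add: N_def)
qed

lemma arc_length_difference_le:
  assumes "\<rho> > 0" and [measurable]: "G \<in> borel_measurable borel"
  shows "(\<integral>\<^sup>+y. \<integral>\<^sup>+z. G (v + \<rho> *\<^sub>R (y - z)) * ennreal (wedge y z) \<partial>arc_length \<partial>arc_length)
    \<le> ennreal (2 / \<rho>\<^sup>2) * (\<integral>\<^sup>+x. G x \<partial>lborel)"
proof -
  define P where "P I = (\<integral>\<^sup>+w. G (chord \<rho> v w) * ennreal (\<rho>\<^sup>2 * \<bar>sin (w $ 2)\<bar>) * indicator {0..<2*pi} (w $ 1) * indicator I (w $ 2) \<partial>lborel)" for I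
  have P: "P I = (\<integral>\<^sup>+s\<in>{0..<2*pi}. \<integral>\<^sup>+t. G (v + \<rho> *\<^sub>R (circ s - circ (s + t))) * ennreal (\<rho>\<^sup>2 * \<bar>sin t\<bar>) * indicator I t \<partial>lborel \<partial>lborel)"
    if [measurable]: "I \<in> sets borel" for I
    unfolding P_def
    by (subst nn_integral_lborel_vector_2)
       (auto simp: chord_def mult_ac intro!: nn_integral_cong split: split_indicator)
  have le: "P {0<..<pi} \<le> (\<integral>\<^sup>+x. G x \<partial>lborel)" "P {pi<..<2*pi} \<le> (\<integral>\<^sup>+x. G x \<partial>lborel)"
    unfolding P_def by (rule nn_integral_chord_le; simp add: assms)+
  have inner: "(\<integral>\<^sup>+z. G (v + \<rho> *\<^sub>R (circ s - z)) * ennreal (wedge (circ s) z) \<partial>arc_length)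
      = ennreal (1 / \<rho>\<^sup>2) * ((\<integral>\<^sup>+t. G (v + \<rho> *\<^sub>R (circ s - circ (s + t))) * ennreal (\<rho>\<^sup>2 * \<bar>sin t\<bar>) * indicator {0<..<pi} t \<partial>lborel)
        + (\<integral>\<^sup>+t. G (v + \<rho> *\<^sub>R (circ s - circ (s + t))) * ennreal (\<rho>\<^sup>2 * \<bar>sin t\<bar>) * indicator {pi<..<2*pi} t \<partial>lborel))"
    (is "?l = _ * (?a + ?b)") for s
  proof -
    have "?l = (\<integral>\<^sup>+t\<in>{0..<2*pi}. G (v + \<rho> *\<^sub>R (circ s - circ (t + s))) * ennreal (wedge (circ s) (circ (t + s))) \<partial>lborel)"
      by (rule nn_integral_arc_length_shift[symmetric]) measurable
    also have "\<dots> = (\<integral>\<^sup>+t. ennreal (1 / \<rho>\<^sup>2) * (G (v + \<rho> *\<^sub>R (circ s - circ (s + t))) * ennreal (\<rho>\<^sup>2 * \<bar>sin t\<bar>) * indicator {0<..<pi} t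
       + G (v + \<rho> *\<^sub>R (circ s - circ (s + t))) * ennreal (\<rho>\<^sup>2 * \<bar>sin t\<bar>) * indicator {pi<..<2*pi} t) \<partial>lborel)"
    proof (intro nn_integral_cong)
      fix t :: real
      have r: "ennreal (1 / \<rho>\<^sup>2) * ennreal (\<rho>\<^sup>2 * \<bar>sin t\<bar>) = ennreal \<bar>sin t\<bar>"
        using \<open>\<rho> > 0\<close> by (simp add: ennreal_mult[symmetric])
      \<comment> \<open>The angles 0 and \<pi> belong to neither branch, but there the sine
        vanishes.\<close>
      consider "t \<in> {0<..<pi}" | "t \<in> {pi<..<2*pi}" | "t = 0 \<or> t = pi" | "t < 0" | "2 * pi \<le> t"
        by fastforce
      then show "G (v + \<rho> *\<^sub>R (circ s - circ (t + s))) * ennreal (wedge (circ s) (circ (t + s))) * indicator {0..<2*pi} t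
        = ennreal (1 / \<rho>\<^sup>2) * (G (v + \<rho> *\<^sub>R (circ s - circ (s + t))) * ennreal (\<rho>\<^sup>2 * \<bar>sin t\<bar>) * indicator {0<..<pi} t
       + G (v + \<rho> *\<^sub>R (circ s - circ (s + t))) * ennreal (\<rho>\<^sup>2 * \<bar>sin t\<bar>) * indicator {pi<..<2*pi} t)"
        by cases (auto simp: wedge_circ add.commute r[symmetric] mult_ac)
    qed
    also have "\<dots> = ennreal (1 / \<rho>\<^sup>2) * (?a + ?b)"
      by (simp add: nn_integral_cmult nn_integral_add)
    finally show ?thesis .
  qed
  have "(\<integral>\<^sup>+y. \<integral>\<^sup>+z. G (v + \<rho> *\<^sub>R (y - z)) * ennreal (wedge y z) \<partial>arc_length \<partial>arc_length)
     = ennreal (1 / \<rho>\<^sup>2) * (P {0<..<pi} + P {pi<..<2*pi})"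
    by (subst nn_integral_arc_length)
       (simp_all add: inner P distrib_right mult.assoc nn_integral_cmult nn_integral_add)
  also have "\<dots> \<le> ennreal (1 / \<rho>\<^sup>2) * ((\<integral>\<^sup>+x. G x \<partial>lborel) + (\<integral>\<^sup>+x. G x \<partial>lborel))"
    by (intro mult_left_mono add_mono le) auto
  also have "\<dots> = ennreal (2 / \<rho>\<^sup>2) * (\<integral>\<^sup>+x. G x \<partial>lborel)"
    unfolding mult_2[symmetric] by (simp add: mult.assoc[symmetric] ennreal_mult[symmetric] mult.commute[of _ 2] flip: ennreal_numeral)
  finally show ?thesis .
qed

lemma nn_integral_arc_length_Fubini:
  assumes [measurable]: "(\<lambda>(x, y). h x y) \<in> borel_measurable (borel \<Otimes>\<^sub>M borel)"
  shows "(\<integral>\<^sup>+x. \<integral>\<^sup>+y. h x y \<partial>arc_length \<partial>lborel) = (\<integral>\<^sup>+y. \<integral>\<^sup>+x. h x y \<partial>lborel \<partial>arc_length)"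
proof -
  interpret pair_sigma_finite lborel arc_length ..
  show ?thesis by (rule Fubini'[symmetric]) measurable
qed

lemma nn_integral_translation:
  fixes h :: "real^2 \<Rightarrow> ennreal"
  assumes [measurable]: "h \<in> borel_measurable borel"
  shows "(\<integral>\<^sup>+x. h (x - c) \<partial>lborel) = (\<integral>\<^sup>+x. h x \<partial>lborel)"
  by (subst (2) lborel_distr_plus[of "- c", symmetric]) (simp add: nn_integral_distr)

text \<open>Translating \<open>x\<close> by \<open>\<rho> *\<^sub>R y\<close> frees \<open>F\<close>
  of the circle variables. For fixed \<open>x\<close> the remaining integral over \<open>y\<close>
  and \<open>z\<close> is then the one bounded by \<open>arc_length_difference_le\<close>.\<close>

lemma wedge_pair_le:
  assumes "\<rho> > 0" and [measurable]: "F \<in> borel_measurable borel" "G \<in> borel_measurable borel"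
  shows "(\<integral>\<^sup>+x. \<integral>\<^sup>+y. \<integral>\<^sup>+z. F (x - \<rho> *\<^sub>R y) * G (x - \<rho> *\<^sub>R z) * ennreal (wedge y z) \<partial>arc_length \<partial>arc_length \<partial>lborel)
    \<le> ennreal (2 / \<rho>\<^sup>2) * (\<integral>\<^sup>+x. F x \<partial>lborel) * (\<integral>\<^sup>+x. G x \<partial>lborel)"
proof -
  have "(\<integral>\<^sup>+x. \<integral>\<^sup>+y. \<integral>\<^sup>+z. F (x - \<rho> *\<^sub>R y) * G (x - \<rho> *\<^sub>R z) * ennreal (wedge y z) \<partial>arc_length \<partial>arc_length \<partial>lborel)
    = (\<integral>\<^sup>+y. \<integral>\<^sup>+x. \<integral>\<^sup>+z. F (x - \<rho> *\<^sub>R y) * G (x - \<rho> *\<^sub>R z) * ennreal (wedge y z) \<partial>arc_length \<partial>lborel \<partial>arc_length)"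
    by (rule nn_integral_arc_length_Fubini) measurable
  also have "\<dots> = (\<integral>\<^sup>+y. \<integral>\<^sup>+x. \<integral>\<^sup>+z. F x * G (x + \<rho> *\<^sub>R y - \<rho> *\<^sub>R z) * ennreal (wedge y z) \<partial>arc_length \<partial>lborel \<partial>arc_length)"
  proof (rule nn_integral_cong)
    fix y
    show "(\<integral>\<^sup>+x. \<integral>\<^sup>+z. F (x - \<rho> *\<^sub>R y) * G (x - \<rho> *\<^sub>R z) * ennreal (wedge y z) \<partial>arc_length \<partial>lborel)
      = (\<integral>\<^sup>+x. \<integral>\<^sup>+z. F x * G (x + \<rho> *\<^sub>R y - \<rho> *\<^sub>R z) * ennreal (wedge y z) \<partial>arc_length \<partial>lborel)"
      using nn_integral_translation[of "\<lambda>x. \<integral>\<^sup>+z. F x * G (x + \<rho> *\<^sub>R y - \<rho> *\<^sub>R z) * ennreal (wedge y z) \<partial>arc_length" "\<rho> *\<^sub>R y"]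
      by simp
  qed
  also have "\<dots> = (\<integral>\<^sup>+x. \<integral>\<^sup>+y. \<integral>\<^sup>+z. F x * G (x + \<rho> *\<^sub>R y - \<rho> *\<^sub>R z) * ennreal (wedge y z) \<partial>arc_length \<partial>arc_length \<partial>lborel)"
    by (rule nn_integral_arc_length_Fubini[symmetric]) measurable
  also have "\<dots> = (\<integral>\<^sup>+x. F x * (\<integral>\<^sup>+y. \<integral>\<^sup>+z. G (x + \<rho> *\<^sub>R (y - z)) * ennreal (wedge y z) \<partial>arc_length \<partial>arc_length) \<partial>lborel)"
    by (intro nn_integral_cong) (simp add: nn_integral_cmult mult.assoc scaleR_diff_right add_diff_eq)
  also have "\<dots> \<le> (\<integral>\<^sup>+x. F x * (ennreal (2 / \<rho>\<^sup>2) * (\<integral>\<^sup>+x. G x \<partial>lborel)) \<partial>lborel)"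
    by (intro nn_integral_mono mult_left_mono arc_length_difference_le assms) auto
  also have "\<dots> = ennreal (2 / \<rho>\<^sup>2) * (\<integral>\<^sup>+x. F x \<partial>lborel) * (\<integral>\<^sup>+x. G x \<partial>lborel)"
    by (simp add: nn_integral_multc mult_ac)
  finally show ?thesis .
qed

section \<open>The endpoint estimate for circular averages\<close>

text \<open>The Taylor bound gives \<open>x - x ^ 3 / 6\<close> as a minorant, and
  \<open>x \<le> 2\<close> makes it at least \<open>x / 3\<close>. The slope is not the best one,
  but only some positive constant matters.\<close>

lemma sin_ge_third:
  assumes "0 \<le> x" "x \<le> pi / 2"
  shows "x / 3 \<le> sin x"
proof -
  have "\<bar>sin x - (\<Sum>m<3. sin_coeff m * x ^ m)\<bar> \<le> inverse (fact 3) * \<bar>x\<bar> ^ 3"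
    by (rule Maclaurin_sin_bound)
  then have "6 * \<bar>sin x - x\<bar> \<le> x ^ 3"
    using assms(1) by (simp add: sin_coeff_def lessThan_nat_numeral fact_numeral field_simps)
  then have "x - x ^ 3 / 6 \<le> sin x"
    using abs_ge_minus_self[of "sin x - x"] by (simp add: field_simps)
  moreover have "x ^ 3 \<le> 4 * x"
  proof -
    have "x \<le> 2" using assms pi_less_4 by simp
    then have "x ^ 2 \<le> 2 ^ 2" using assms(1) by (intro power_mono)
    then show ?thesis using mult_right_mono[of "x ^ 2" 4 x] assms(1)
      by (simp add: power3_eq_cube power2_eq_square)
  qed
  ultimately show ?thesis by simp
qed

lemma nn_integral_abs:
  fixes \<phi> :: "real \<Rightarrow> ennreal"
  assumes [measurable]: "\<phi> \<in> borel_measurable borel"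
  shows "(\<integral>\<^sup>+t. \<phi> \<bar>t\<bar> \<partial>lborel) = 2 * (\<integral>\<^sup>+t\<in>{0<..}. \<phi> t \<partial>lborel)"
proof -
  have "AE t in lborel. t \<noteq> (0::real)"
    by (rule AE_lborel_singleton)
  then have "(\<integral>\<^sup>+t. \<phi> \<bar>t\<bar> \<partial>lborel) = (\<integral>\<^sup>+t. \<phi> t * indicator {0<..} t + \<phi> (- t) * indicator {0<..} (- t) \<partial>lborel)"
    by (intro nn_integral_cong_AE) (auto elim!: eventually_mono split: split_indicator)
  also have "\<dots> = (\<integral>\<^sup>+t\<in>{0<..}. \<phi> t \<partial>lborel) + (\<integral>\<^sup>+t. \<phi> (- t) * indicator {0<..} (- t) \<partial>lborel)"
    by (intro nn_integral_add) measurable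
  also have "(\<integral>\<^sup>+t. \<phi> (- t) * indicator {0<..} (- t) \<partial>lborel) = (\<integral>\<^sup>+t\<in>{0<..}. \<phi> t \<partial>lborel)"
    using nn_integral_real_affine[of "\<lambda>t. \<phi> t * indicator {0<..} t" "-1" 0] by simp
  finally show ?thesis by (simp add: mult_2)
qed

text \<open>On one period, the modulus of the sine is at least a third of the distance to the
  nearest of 0, \<pi> and 2\<pi>. As \<open>\<phi>\<close> is antitone, it is dominated by three
  translated and dilated copies; each has integral 6 times that over the half-line.\<close>

lemma nn_integral_wedge_le:
  fixes \<phi> :: "real \<Rightarrow> ennreal"
  assumes [measurable]: "\<phi> \<in> borel_measurable borel"
    and anti: "\<And>x y. 0 < x \<Longrightarrow> x \<le> y \<Longrightarrow> \<phi> y \<le> \<phi> x"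
  shows "(\<integral>\<^sup>+z. \<phi> (wedge (circ s) z) \<partial>arc_length) \<le> 18 * (\<integral>\<^sup>+t\<in>{0<..}. \<phi> t \<partial>lborel)"
proof -
  have aff: "(\<integral>\<^sup>+t. \<phi> \<bar>(t - c) / 3\<bar> \<partial>lborel) = 6 * (\<integral>\<^sup>+t\<in>{0<..}. \<phi> t \<partial>lborel)" for c :: real
    using nn_integral_real_affine[of "\<lambda>t. \<phi> \<bar>(t - c) / 3\<bar>" 3 c] nn_integral_abs[of \<phi>]
    by (simp add: mult.assoc[symmetric] del: mult.assoc)
  have "(\<integral>\<^sup>+z. \<phi> (wedge (circ s) z) \<partial>arc_length)
      = (\<integral>\<^sup>+t\<in>{0..<2*pi}. \<phi> (wedge (circ s) (circ (t + s))) \<partial>lborel)"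
    by (rule nn_integral_arc_length_shift[symmetric]) measurable
  also have "\<dots> \<le> (\<integral>\<^sup>+t. \<phi> \<bar>(t - 0) / 3\<bar> + \<phi> \<bar>(t - pi) / 3\<bar> + \<phi> \<bar>(t - 2 * pi) / 3\<bar> \<partial>lborel)"
  proof (intro nn_integral_mono_AE)
    have "AE t in lborel. t \<noteq> (0::real)" "AE t in lborel. t \<noteq> pi"
      by (rule AE_lborel_singleton)+
    then show "AE t in lborel. \<phi> (wedge (circ s) (circ (t + s))) * indicator {0..<2*pi} t
       \<le> \<phi> \<bar>(t - 0) / 3\<bar> + \<phi> \<bar>(t - pi) / 3\<bar> + \<phi> \<bar>(t - 2 * pi) / 3\<bar>"
    proof eventually_elim
      case (elim t)
      have w: "\<phi> (wedge (circ s) (circ (t + s))) * indicator {0..<2*pi} t \<le> \<phi> \<bar>sin t\<bar>"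
        by (auto simp: wedge_circ split: split_indicator)
      have l1: "a \<le> a + b + c" and l2: "b \<le> a + b + c" and l3: "c \<le> a + b + c" for a b c :: ennreal
        by (auto simp: add.assoc intro: add_increasing add_increasing2)
      consider "t \<notin> {0..<2*pi}" | "0 < t" "t \<le> pi / 2" | "pi / 2 \<le> t" "t < pi"
        | "pi < t" "t \<le> 3 * pi / 2" | "3 * pi / 2 \<le> t" "t < 2 * pi"
        using elim by fastforce
      then show ?case
      proof cases
        case 2
        then have "\<phi> \<bar>sin t\<bar> \<le> \<phi> \<bar>t / 3\<bar>"
          using sin_ge_third[of t] by (intro anti) auto
        then show ?thesis by (intro order_trans[OF w order_trans[OF _ l1]]) simp
      next
        case 3
        have "sin t = sin (pi - t)" by simp
        then have "\<phi> \<bar>sin t\<bar> \<le> \<phi> \<bar>(t - pi) / 3\<bar>"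
          using sin_ge_third[of "pi - t"] 3 by (intro anti) auto
        then show ?thesis by (rule order_trans[OF w order_trans[OF _ l2]])
      next
        case 4
        have "sin t = - sin (t - pi)" by simp
        then have "\<phi> \<bar>sin t\<bar> \<le> \<phi> \<bar>(t - pi) / 3\<bar>"
          using sin_ge_third[of "t - pi"] 4 by (intro anti) auto
        then show ?thesis by (rule order_trans[OF w order_trans[OF _ l2]])
      next
        case 5
        have "sin t = - sin (2 * pi - t)" by simp
        then have "\<phi> \<bar>sin t\<bar> \<le> \<phi> \<bar>(t - 2 * pi) / 3\<bar>"
          using sin_ge_third[of "2 * pi - t"] 5 by (intro anti) auto
        then show ?thesis by (rule order_trans[OF w order_trans[OF _ l3]])
      qed auto
    qed
  qed
  also have "\<dots> = (\<integral>\<^sup>+t. \<phi> \<bar>(t - 0) / 3\<bar> \<partial>lborel) + (\<integral>\<^sup>+t. \<phi> \<bar>(t - pi) / 3\<bar> \<partial>lborel) + (\<integral>\<^sup>+t. \<phi> \<bar>(t - 2 * pi) / 3\<bar> \<partial>lborel)"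
    by (subst nn_integral_add, measurable)+
  also have "\<dots> = 18 * (\<integral>\<^sup>+t\<in>{0<..}. \<phi> t \<partial>lborel)"
    unfolding aff distrib_right[symmetric] by simp
  finally show ?thesis .
qed

text \<open>Replace \<open>t + D\<close> by \<open>D\<close> for \<open>t \<le> D\<close> and by
  \<open>t\<close> for \<open>t > D\<close>. The integrals of \<open>t powr (-3/4)\<close> up to
  \<open>D\<close> and of \<open>t powr (-3/2)\<close> beyond it both lead to
  \<open>D powr (-1/2)\<close>, and the constants add up to \<open>3 * 4 + 3 * 2\<close>.\<close>

lemma powr_singular_integral:
  assumes "D > 0"
  shows "(\<integral>\<^sup>+t\<in>{0<..}. ennreal ((t * (t + D) / 3) powr (- (3/4))) \<partial>lborel) \<le> ennreal (18 * D powr (- (1/2)))"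
proof -
  have i1: "(\<integral>\<^sup>+t\<in>{0..D}. ennreal (t powr (- (3/4))) \<partial>lborel) = ennreal (4 * D powr (1/4))"
    using nn_integral_has_integral_lebesgue'[OF _ has_integral_powr_from_0[of "- (3/4)" D]] assms
    by (simp add: mult.commute)
  have i2: "(\<integral>\<^sup>+t\<in>{D..}. ennreal (t powr (- (3/2))) \<partial>lborel) = ennreal (2 * D powr (- (1/2)))"
    using nn_integral_has_integral_lebesgue'[OF _ has_integral_powr_to_inf[of "- (3/2)" D]] assms
    by (simp add: mult.commute)
  have "(\<integral>\<^sup>+t\<in>{0<..}. ennreal ((t * (t + D) / 3) powr (- (3/4))) \<partial>lborel)
    \<le> (\<integral>\<^sup>+t. ennreal (3 * D powr (- (3/4))) * (ennreal (t powr (- (3/4))) * indicator {0..D} t)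
         + 3 * (ennreal (t powr (- (3/2))) * indicator {D..} t) \<partial>lborel)"
  proof (rule nn_integral_mono)
    fix t :: real
    have c: "(1/3) powr (- (3/4)) \<le> (3::real)"
    proof -
      have "(1/3) powr (- (3/4)) = (3::real) powr (3/4)"
        by (simp add: powr_divide powr_minus field_simps)
      also have "\<dots> \<le> 3 powr 1" by (intro powr_mono) auto
      finally show ?thesis by simp
    qed
    have "(t * (t + D) / 3) powr (- (3/4)) \<le> (1/3) powr (- (3/4)) * (t powr (- (3/4)) * D powr (- (3/4)))" if "t > 0"
    proof -
      have "(t * (t + D) / 3) powr (- (3/4)) \<le> (1/3 * (t * D)) powr (- (3/4))"
        using that assms by (intro powr_mono2') (auto simp: field_simps)
      then show ?thesis using that assms by (simp add: powr_mult del: times_divide_eq_left)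
    qed
    also have "(1/3) powr (- (3/4)) * (t powr (- (3/4)) * D powr (- (3/4))) \<le> 3 * (t powr (- (3/4)) * D powr (- (3/4)))"
      by (intro mult_right_mono c) auto
    finally have 1: "(t * (t + D) / 3) powr (- (3/4)) \<le> 3 * D powr (- (3/4)) * t powr (- (3/4))" if "t > 0"
      using that by (simp add: mult_ac)
    have "(t * (t + D) / 3) powr (- (3/4)) \<le> (1/3) powr (- (3/4)) * t powr (- (3/2))" if "t > 0"
    proof -
      have "(t * (t + D) / 3) powr (- (3/4)) \<le> (1/3 * (t * t)) powr (- (3/4))"
        using that assms by (intro powr_mono2') (auto simp: field_simps)
      also have "\<dots> = (1/3) powr (- (3/4)) * (t powr (- (3/4)) * t powr (- (3/4)))"
        using that by (simp add: powr_mult del: times_divide_eq_left)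
      also have "t powr (- (3/4)) * t powr (- (3/4)) = t powr (- (3/2))"
        by (simp add: powr_add[symmetric])
      finally show ?thesis .
    qed
    also have "(1/3) powr (- (3/4)) * t powr (- (3/2)) \<le> 3 * t powr (- (3/2))"
      by (intro mult_right_mono c) auto
    finally have 2: "(t * (t + D) / 3) powr (- (3/4)) \<le> 3 * t powr (- (3/2))" if "t > 0"
      using that by simp
    consider "t \<le> 0" | "0 < t" "t \<le> D" | "D < t" "0 < t" using assms by linarith
    then show "ennreal ((t * (t + D) / 3) powr (- (3/4))) * indicator {0<..} t
      \<le> ennreal (3 * D powr (- (3/4))) * (ennreal (t powr (- (3/4))) * indicator {0..D} t)
         + 3 * (ennreal (t powr (- (3/2))) * indicator {D..} t)"
    proof cases
      case 2
      then have "ennreal ((t * (t + D) / 3) powr (- (3/4))) \<le> ennreal (3 * D powr (- (3/4))) * ennreal (t powr (- (3/4)))"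
        using 1 by (subst ennreal_mult[symmetric]) (auto intro: ennreal_leI)
      then show ?thesis using 2 by (auto intro: add_increasing2)
    next
      case 3
      then have "ennreal ((t * (t + D) / 3) powr (- (3/4))) \<le> 3 * ennreal (t powr (- (3/2)))"
        using 2 by (subst ennreal_numeral[symmetric], subst ennreal_mult[symmetric]) (auto intro: ennreal_leI)
      then show ?thesis using 3 by auto
    qed auto
  qed
  also have "\<dots> = ennreal (3 * D powr (- (3/4))) * ennreal (4 * D powr (1/4)) + 3 * ennreal (2 * D powr (- (1/2)))"
    by (simp add: nn_integral_add nn_integral_cmult i1 i2)
  also have "\<dots> = ennreal (12 * (D powr (- (3/4)) * D powr (1/4)) + 6 * D powr (- (1/2)))"
    by (subst ennreal_numeral[symmetric]) (simp only: ennreal_mult[symmetric] ennreal_plus[symmetric] powr_ge_zero mult_nonneg_nonneg zero_le_numeral add_nonneg_nonneg, simp add: mult_ac)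
  also have "D powr (- (3/4)) * D powr (1/4) = D powr (- (1/2))"
    by (simp add: powr_add[symmetric])
  finally show ?thesis by simp
qed

lemma norm_1_circ:
  assumes "norm y = 1"
  obtains s where "y = circ s"
proof -
  have "(y $ 1)\<^sup>2 + (y $ 2)\<^sup>2 = 1"
    using assms by (simp add: norm_vec_def L2_set_def UNIV_2)
  then obtain s where "y $ 1 = cos s" "y $ 2 = sin s"
    by (rule sincos_total_2pi)
  then have "y = circ s" by (simp add: vec_eq_iff forall_2)
  then show ?thesis by (rule that)
qed

lemma AE_arc_length_norm: "AE y in arc_length. norm y = 1"
  by (rule AE_arc_length) simp_all

lemma wedge_nonneg [simp]: "0 \<le> wedge y z"
  by (simp add: wedge_def)

text \<open>The modulus of the sine is subadditive, by the addition formula with cosines bounded by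
  1. This serves both for the singular kernel and for the nondegeneracy argument at
  \<open>(1/2, 1/2, 1/2)\<close>.\<close>

lemma wedge_triangle:
  assumes "norm x = 1" "norm y = 1" "norm z = 1"
  shows "wedge x z \<le> wedge x y + wedge y z"
proof -
  obtain r s t where c: "x = circ r" "y = circ s" "z = circ t"
    using assms by (meson norm_1_circ)
  have "\<bar>sin (t - r)\<bar> = \<bar>sin (s - r) * cos (t - s) + cos (s - r) * sin (t - s)\<bar>"
    using sin_add[of "s - r" "t - s"] by simp
  also have "\<dots> \<le> \<bar>sin (s - r)\<bar> * \<bar>cos (t - s)\<bar> + \<bar>cos (s - r)\<bar> * \<bar>sin (t - s)\<bar>"
    unfolding abs_mult[symmetric] by (rule abs_triangle_ineq)
  also have "\<dots> \<le> \<bar>sin (s - r)\<bar> * 1 + 1 * \<bar>sin (t - s)\<bar>"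
    by (intro add_mono mult_left_mono mult_right_mono) auto
  finally show ?thesis by (simp add: c wedge_circ)
qed

lemma wedge_kernel_integral:
  assumes "norm x = 1" "norm y = 1" "wedge x y \<noteq> 0"
  shows "(\<integral>\<^sup>+z. ennreal ((wedge x z * wedge y z) powr (- (3/4))) \<partial>arc_length) \<le> ennreal (648 * wedge x y powr (- (1/2)))"
proof -
  define D where "D = wedge x y"
  have D: "D > 0" using assms by (simp add: D_def less_le)
  \<comment> \<open>As \<open>D \<le> A + B\<close> for the two factors \<open>A\<close>, \<open>B\<close>, we have \<open>min A B + D \<le> 3 max A B\<close>; so \<open>\<phi>\<close> at the smaller
    factor is a majorant, and unlike the kernel it is antitone.\<close>
  define \<phi> where "\<phi> t = ennreal ((t * (t + D) / 3) powr (- (3/4)))" for t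
  have [measurable]: "\<phi> \<in> borel_measurable borel" unfolding \<phi>_def by measurable
  have anti: "\<phi> b \<le> \<phi> a" if "0 < a" "a \<le> b" for a b
    unfolding \<phi>_def using that D by (intro ennreal_leI powr_mono2') (auto intro!: mult_mono)
  have le: "(\<integral>\<^sup>+z. \<phi> (wedge u z) \<partial>arc_length) \<le> ennreal (324 * D powr (- (1/2)))" if "norm u = 1" for u
  proof -
    obtain s where "u = circ s" using \<open>norm u = 1\<close> by (rule norm_1_circ)
    then have "(\<integral>\<^sup>+z. \<phi> (wedge u z) \<partial>arc_length) \<le> 18 * (\<integral>\<^sup>+t\<in>{0<..}. \<phi> t \<partial>lborel)"
      using nn_integral_wedge_le[of \<phi> s] anti by simp
    also have "\<dots> \<le> 18 * ennreal (18 * D powr (- (1/2)))"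
      unfolding \<phi>_def by (intro mult_left_mono powr_singular_integral D) auto
    also have "\<dots> = ennreal (324 * D powr (- (1/2)))"
      by (subst ennreal_numeral[symmetric], subst ennreal_mult[symmetric]) auto
    finally show ?thesis .
  qed
  have "(\<integral>\<^sup>+z. ennreal ((wedge x z * wedge y z) powr (- (3/4))) \<partial>arc_length)
    \<le> (\<integral>\<^sup>+z. \<phi> (wedge x z) + \<phi> (wedge y z) \<partial>arc_length)"
  proof (rule nn_integral_mono_AE)
    have "AE z in arc_length. wedge x z \<noteq> 0" "AE z in arc_length. wedge y z \<noteq> 0"
      using assms(1,2) by (metis AE_arc_length_wedge norm_1_circ)+
    with AE_arc_length_norm
    show "AE z in arc_length. ennreal ((wedge x z * wedge y z) powr (- (3/4))) \<le> \<phi> (wedge x z) + \<phi> (wedge y z)"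
    proof eventually_elim
      case (elim z)
      define A B where AB: "A = wedge x z" "B = wedge y z"
      have pos: "A > 0" "B > 0" using elim by (auto simp: AB less_le)
      have "D \<le> A + B"
        using wedge_triangle[OF assms(1) elim(1) assms(2)] by (simp add: D_def AB wedge_commute)
      have le: "(A * B) powr (- (3/4)) \<le> (B * (B + D) / 3) powr (- (3/4))" if "B \<le> A" "D \<le> A + B" "0 < A" "0 < B" for A B
      proof (rule powr_mono2')
        have "B * (B + D) \<le> B * (3 * A)" using that by (intro mult_left_mono) auto
        then show "B * (B + D) / 3 \<le> A * B" by (simp add: mult_ac)
      qed (use that D in auto)
      have "ennreal ((A * B) powr (- (3/4))) \<le> \<phi> A + \<phi> B"
      proof (cases "B \<le> A")
        case True
        then have "ennreal ((A * B) powr (- (3/4))) \<le> \<phi> B"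
          unfolding \<phi>_def using le pos \<open>D \<le> A + B\<close> by (intro ennreal_leI) auto
        then show ?thesis by (simp add: add_increasing)
      next
        case False
        then have "ennreal ((A * B) powr (- (3/4))) \<le> \<phi> A"
          unfolding \<phi>_def using le[of A B] pos \<open>D \<le> A + B\<close>
          by (intro ennreal_leI) (auto simp: mult.commute add.commute)
        then show ?thesis by (simp add: add_increasing2)
      qed
      then show ?case by (simp add: AB)
    qed
  qed
  also have "\<dots> = (\<integral>\<^sup>+z. \<phi> (wedge x z) \<partial>arc_length) + (\<integral>\<^sup>+z. \<phi> (wedge y z) \<partial>arc_length)"
    by (intro nn_integral_add) measurable
  also have "\<dots> \<le> ennreal (324 * D powr (- (1/2))) + ennreal (324 * D powr (- (1/2)))"
    by (intro add_mono le assms)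
  also have "\<dots> = ennreal (648 * D powr (- (1/2)))"
    by (subst ennreal_plus[symmetric]) auto
  finally show ?thesis by (simp add: D_def)
qed

section \<open>The cube of a circular average\<close>

lemma cube_AM_GM:
  fixes x y z :: real
  assumes "0 \<le> x" "0 \<le> y" "0 \<le> z"
  shows "x * y * z \<le> (x ^ 3 + y ^ 3 + z ^ 3) / 3"
proof -
  have "0 \<le> (x + y + z) * ((x - y)\<^sup>2 + (y - z)\<^sup>2 + (z - x)\<^sup>2)"
    using assms by simp
  also have "\<dots> = 2 * (x ^ 3 + y ^ 3 + z ^ 3 - 3 * (x * y * z))"
    by (simp add: power2_eq_square power3_eq_cube algebra_simps)
  finally show ?thesis by simp
qed

text \<open>The arithmetic-geometric mean inequality for the three quantities \<open>X\<close>. Each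
  of \<open>a\<close>, \<open>b\<close>, \<open>c\<close> enters two of them with exponent 1/2, and
  each weight enters with exponents 1/2, -1/4 and -1/4, so their product is
  \<open>a * b * c\<close>.\<close>

lemma trilinear_pointwise:
  fixes a b c p q r :: real
  assumes "0 \<le> a" "0 \<le> b" "0 \<le> c" "0 < p" "0 < q" "0 < r"
  shows "a * b * c \<le>
     ((a powr (3/2) * b powr (3/2)) * (p powr (3/2) * (q * r) powr (- (3/4)))
    + (a powr (3/2) * c powr (3/2)) * (q powr (3/2) * (p * r) powr (- (3/4)))
    + (b powr (3/2) * c powr (3/2)) * (r powr (3/2) * (p * q) powr (- (3/4)))) / 3"
proof -
  define X where "X a b p q r = (a powr (1/2) * b powr (1/2)) * (p powr (1/2) * (q * r) powr (- (1/4)))" for a b p q r :: real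
  have X: "0 \<le> X a b p q r" "X a b p q r ^ 3 = (a powr (3/2) * b powr (3/2)) * (p powr (3/2) * (q * r) powr (- (3/4)))"
    for a b p q r :: real
  proof -
    have c: "(x powr e) ^ 3 = x powr (3 * e)" for x e :: real
      by (simp add: powr_powr[symmetric] powr_realpow' powr_power mult.commute)
    show "0 \<le> X a b p q r" by (simp add: X_def)
    show "X a b p q r ^ 3 = (a powr (3/2) * b powr (3/2)) * (p powr (3/2) * (q * r) powr (- (3/4)))"
      by (simp add: X_def power_mult_distrib c)
  qed
  have s: "x powr (1/2) * x powr (1/2) = x" if "0 \<le> x" for x :: real
    using that by (simp add: powr_add[symmetric])
  have u: "x powr (1/2) * (x powr (- (1/4)) * x powr (- (1/4))) = 1" if "0 < x" for x :: real
    using that by (simp add: powr_add[symmetric])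
  have "X a b p q r * X a c q p r * X b c r p q
     = (a powr (1/2) * a powr (1/2)) * (b powr (1/2) * b powr (1/2)) * (c powr (1/2) * c powr (1/2))
      * (p powr (1/2) * (p powr (- (1/4)) * p powr (- (1/4))))
      * (q powr (1/2) * (q powr (- (1/4)) * q powr (- (1/4))))
      * (r powr (1/2) * (r powr (- (1/4)) * r powr (- (1/4))))"
    using assms by (simp add: X_def powr_mult mult_ac)
  also have "\<dots> = a * b * c"
    using assms by (simp add: s u)
  finally show ?thesis
    using cube_AM_GM[OF X(1)[of a b p q r] X(1)[of a c q p r] X(1)[of b c r p q]] by (simp add: X(2))
qed

lemma nn_integral_arc_length_commute:
  assumes [measurable]: "(\<lambda>(x, y). h x y) \<in> borel_measurable (borel \<Otimes>\<^sub>M borel)"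
  shows "(\<integral>\<^sup>+x. \<integral>\<^sup>+y. h x y \<partial>arc_length \<partial>arc_length) = (\<integral>\<^sup>+y. \<integral>\<^sup>+x. h x y \<partial>arc_length \<partial>arc_length)"
proof -
  interpret pair_sigma_finite arc_length arc_length ..
  show ?thesis by (rule Fubini'[symmetric]) measurable
qed

lemma nn_integral_cube:
  assumes [measurable]: "h \<in> borel_measurable M"
  shows "(\<integral>\<^sup>+x. h x \<partial>M) ^ 3 = (\<integral>\<^sup>+x. \<integral>\<^sup>+y. \<integral>\<^sup>+z. h x * h y * h z \<partial>M \<partial>M \<partial>M)"
  by (simp add: nn_integral_cmult nn_integral_multc power3_eq_cube mult.assoc)

text \<open>The point \<open>w\<close> occurs in the weight alone. Integrating it out leaves
  \<open>wedge y z\<close> to the power \<open>3/2 - 1/2 = 1\<close>, exactly the Jacobian needed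
  for \<open>wedge_pair_le\<close>; the constant is \<open>648 * 2\<close>.\<close>

lemma weighted_pair_le:
  assumes "\<rho> > 0" and [measurable]: "F \<in> borel_measurable borel"
    and F: "(\<integral>\<^sup>+x. F x \<partial>lborel) \<le> 1"
  shows "(\<integral>\<^sup>+x. \<integral>\<^sup>+y. \<integral>\<^sup>+z. \<integral>\<^sup>+w. F (x - \<rho> *\<^sub>R y) * F (x - \<rho> *\<^sub>R z)
            * ennreal (wedge y z powr (3/2) * (wedge y w * wedge z w) powr (- (3/4)))
            \<partial>arc_length \<partial>arc_length \<partial>arc_length \<partial>lborel) \<le> ennreal (1296 / \<rho>\<^sup>2)"
proof -
  have w: "(\<integral>\<^sup>+w. ennreal (wedge y z powr (3/2) * (wedge y w * wedge z w) powr (- (3/4))) \<partial>arc_length)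
     \<le> ennreal (648 * wedge y z)" if "norm y = 1" "norm z = 1" for y z
  \<comment> \<open>In the degenerate case the factor \<open>wedge y z powr (3/2)\<close> is 0, and
    so is the whole weight.\<close>
  proof (cases "wedge y z = 0")
    case False
    have "(\<integral>\<^sup>+w. ennreal (wedge y z powr (3/2) * (wedge y w * wedge z w) powr (- (3/4))) \<partial>arc_length)
      = ennreal (wedge y z powr (3/2)) * (\<integral>\<^sup>+w. ennreal ((wedge y w * wedge z w) powr (- (3/4))) \<partial>arc_length)"
      by (subst nn_integral_cmult[symmetric]) (auto simp: ennreal_mult)
    also have "\<dots> \<le> ennreal (wedge y z powr (3/2)) * ennreal (648 * wedge y z powr (- (1/2)))"
      using that False by (intro mult_left_mono wedge_kernel_integral) auto
    also have "\<dots> = ennreal (648 * (wedge y z powr (3/2) * wedge y z powr (- (1/2))))"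
      by (simp add: ennreal_mult[symmetric] mult_ac)
    also have "wedge y z powr (3/2) * wedge y z powr (- (1/2)) = wedge y z"
      using False by (simp add: powr_add[symmetric])
    finally show ?thesis .
  qed simp
  have "(\<integral>\<^sup>+x. \<integral>\<^sup>+y. \<integral>\<^sup>+z. \<integral>\<^sup>+w. F (x - \<rho> *\<^sub>R y) * F (x - \<rho> *\<^sub>R z)
            * ennreal (wedge y z powr (3/2) * (wedge y w * wedge z w) powr (- (3/4)))
            \<partial>arc_length \<partial>arc_length \<partial>arc_length \<partial>lborel)
    \<le> (\<integral>\<^sup>+x. \<integral>\<^sup>+y. \<integral>\<^sup>+z. 648 * (F (x - \<rho> *\<^sub>R y) * F (x - \<rho> *\<^sub>R z) * ennreal (wedge y z)) \<partial>arc_length \<partial>arc_length \<partial>lborel)"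
  proof (rule nn_integral_mono, rule nn_integral_mono_AE)
    fix x :: "real^2"
    show "AE y in arc_length. (\<integral>\<^sup>+z. \<integral>\<^sup>+w. F (x - \<rho> *\<^sub>R y) * F (x - \<rho> *\<^sub>R z)
            * ennreal (wedge y z powr (3/2) * (wedge y w * wedge z w) powr (- (3/4)))
            \<partial>arc_length \<partial>arc_length)
       \<le> (\<integral>\<^sup>+z. 648 * (F (x - \<rho> *\<^sub>R y) * F (x - \<rho> *\<^sub>R z) * ennreal (wedge y z)) \<partial>arc_length)"
      using AE_arc_length_norm
    proof eventually_elim
      case (elim y)
      show ?case
      proof (rule nn_integral_mono_AE)
        show "AE z in arc_length. (\<integral>\<^sup>+w. F (x - \<rho> *\<^sub>R y) * F (x - \<rho> *\<^sub>R z)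
            * ennreal (wedge y z powr (3/2) * (wedge y w * wedge z w) powr (- (3/4))) \<partial>arc_length)
          \<le> 648 * (F (x - \<rho> *\<^sub>R y) * F (x - \<rho> *\<^sub>R z) * ennreal (wedge y z))"
          using AE_arc_length_norm
        proof eventually_elim
          case (elim z)
          have "(\<integral>\<^sup>+w. F (x - \<rho> *\<^sub>R y) * F (x - \<rho> *\<^sub>R z)
            * ennreal (wedge y z powr (3/2) * (wedge y w * wedge z w) powr (- (3/4))) \<partial>arc_length)
           = F (x - \<rho> *\<^sub>R y) * F (x - \<rho> *\<^sub>R z) * (\<integral>\<^sup>+w. ennreal (wedge y z powr (3/2) * (wedge y w * wedge z w) powr (- (3/4))) \<partial>arc_length)"
            by (rule nn_integral_cmult) measurable
          also have "\<dots> \<le> F (x - \<rho> *\<^sub>R y) * F (x - \<rho> *\<^sub>R z) * ennreal (648 * wedge y z)"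
            using elim \<open>norm y = 1\<close> by (intro mult_left_mono w) auto
          finally show ?case by (simp add: ennreal_mult mult_ac)
        qed
      qed
    qed
  qed
  also have "\<dots> = 648 * (\<integral>\<^sup>+x. \<integral>\<^sup>+y. \<integral>\<^sup>+z. F (x - \<rho> *\<^sub>R y) * F (x - \<rho> *\<^sub>R z) * ennreal (wedge y z) \<partial>arc_length \<partial>arc_length \<partial>lborel)"
    by (simp add: nn_integral_cmult)
  also have "\<dots> \<le> 648 * (ennreal (2 / \<rho>\<^sup>2) * (\<integral>\<^sup>+x. F x \<partial>lborel) * (\<integral>\<^sup>+x. F x \<partial>lborel))"
    by (intro mult_left_mono wedge_pair_le assms) auto
  also have "\<dots> \<le> 648 * (ennreal (2 / \<rho>\<^sup>2) * 1 * 1)"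
    by (intro mult_left_mono mult_mono F) auto
  also have "\<dots> = ennreal (1296 / \<rho>\<^sup>2)"
    by (simp, subst ennreal_numeral[symmetric], subst ennreal_mult[symmetric]) auto
  finally show ?thesis .
qed

lemma circular_average_bound:
  assumes "\<rho> > 0" and [measurable]: "f \<in> borel_measurable borel" and f0: "\<And>x. 0 \<le> f x"
    and f1: "(\<integral>\<^sup>+x. ennreal (f x powr (3/2)) \<partial>lborel) \<le> 1"
  shows "(\<integral>\<^sup>+x. (\<integral>\<^sup>+y. ennreal (f (x - \<rho> *\<^sub>R y)) \<partial>arc_length) ^ 3 \<partial>lborel) \<le> ennreal (1296 / \<rho>\<^sup>2)"
proof -
  define F where "F x = ennreal (f x powr (3/2))" for x
  have [measurable]: "F \<in> borel_measurable borel" unfolding F_def by measurable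
  define k where "k y z w = ennreal (wedge y z powr (3/2) * (wedge y w * wedge z w) powr (- (3/4)))" for y z w
  have k_meas [measurable]: "(\<lambda>x. k (a x) (b x) (c x)) \<in> borel_measurable M"
    if [measurable]: "a \<in> borel_measurable M" "b \<in> borel_measurable M" "c \<in> borel_measurable M" for a b c M
    unfolding k_def by measurable
  define P where "P x y z = F (x - \<rho> *\<^sub>R y) * F (x - \<rho> *\<^sub>R z)" for x y z
  have P_meas [measurable]: "(\<lambda>x. P (a x) (b x) (c x)) \<in> borel_measurable M"
    if [measurable]: "a \<in> borel_measurable M" "b \<in> borel_measurable M" "c \<in> borel_measurable M" for a b c M
    unfolding P_def by measurable
  define J where "J = (\<integral>\<^sup>+x. \<integral>\<^sup>+y. \<integral>\<^sup>+z. \<integral>\<^sup>+w. P x y z * k y z w \<partial>arc_length \<partial>arc_length \<partial>arc_length \<partial>lborel)"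
  have J: "J \<le> ennreal (1296 / \<rho>\<^sup>2)"
    unfolding J_def P_def k_def using weighted_pair_le[of \<rho> F] f1 \<open>\<rho> > 0\<close> by (simp add: F_def)
  \<comment> \<open>The three terms of the pointwise inequality differ by a permutation of the
    circle points, so each integrates to \<open>J\<close>; together they absorb the factor
    1/3.\<close>
  have J2: "(\<integral>\<^sup>+x. \<integral>\<^sup>+y. \<integral>\<^sup>+z. \<integral>\<^sup>+w. P x y w * k y w z \<partial>arc_length \<partial>arc_length \<partial>arc_length \<partial>lborel) = J"
    unfolding J_def
    by (rule nn_integral_cong, rule nn_integral_cong, rule nn_integral_arc_length_commute) measurable
  have J3: "(\<integral>\<^sup>+x. \<integral>\<^sup>+y. \<integral>\<^sup>+z. \<integral>\<^sup>+w. P x z w * k z w y \<partial>arc_length \<partial>arc_length \<partial>arc_length \<partial>lborel) = J"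
  proof -
    have "(\<integral>\<^sup>+x. \<integral>\<^sup>+y. \<integral>\<^sup>+z. \<integral>\<^sup>+w. P x z w * k z w y \<partial>arc_length \<partial>arc_length \<partial>arc_length \<partial>lborel)
      = (\<integral>\<^sup>+x. \<integral>\<^sup>+z. \<integral>\<^sup>+y. \<integral>\<^sup>+w. P x z w * k z w y \<partial>arc_length \<partial>arc_length \<partial>arc_length \<partial>lborel)"
      by (rule nn_integral_cong, rule nn_integral_arc_length_commute) measurable
    also have "\<dots> = J" unfolding J_def
      by (rule nn_integral_cong, rule nn_integral_cong, rule nn_integral_arc_length_commute) measurable
    finally show ?thesis .
  qed
  define T where "T = ennreal (1/3)"
  have pw: "ennreal (f (x - \<rho> *\<^sub>R y)) * ennreal (f (x - \<rho> *\<^sub>R z)) * ennreal (f (x - \<rho> *\<^sub>R w))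
     \<le> T * (P x y z * k y z w + P x y w * k y w z + P x z w * k z w y)"
    if "wedge y z \<noteq> 0" "wedge y w \<noteq> 0" "wedge z w \<noteq> 0" for x y z w
  proof -
    have "ennreal (f (x - \<rho> *\<^sub>R y)) * ennreal (f (x - \<rho> *\<^sub>R z)) * ennreal (f (x - \<rho> *\<^sub>R w))
       = ennreal (f (x - \<rho> *\<^sub>R y) * f (x - \<rho> *\<^sub>R z) * f (x - \<rho> *\<^sub>R w))"
      by (simp add: ennreal_mult f0)
    also have "\<dots> \<le> ennreal (1/3 * (
         (f (x - \<rho> *\<^sub>R y) powr (3/2) * f (x - \<rho> *\<^sub>R z) powr (3/2)) * (wedge y z powr (3/2) * (wedge y w * wedge z w) powr (- (3/4)))
       + (f (x - \<rho> *\<^sub>R y) powr (3/2) * f (x - \<rho> *\<^sub>R w) powr (3/2)) * (wedge y w powr (3/2) * (wedge y z * wedge z w) powr (- (3/4)))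
       + (f (x - \<rho> *\<^sub>R z) powr (3/2) * f (x - \<rho> *\<^sub>R w) powr (3/2)) * (wedge z w powr (3/2) * (wedge y z * wedge y w) powr (- (3/4)))))"
      using trilinear_pointwise[OF f0 f0 f0, of "wedge y z" "wedge y w" "wedge z w"
         "x - \<rho> *\<^sub>R y" "x - \<rho> *\<^sub>R z" "x - \<rho> *\<^sub>R w"] that
      by (intro ennreal_leI) (simp add: less_le)
    also have "\<dots> = T * (P x y z * k y z w + P x y w * k y w z + P x z w * k z w y)"
      by (simp add: T_def P_def k_def F_def wedge_commute[of w z] wedge_commute[of w y] wedge_commute[of z y]
         ennreal_mult[symmetric] ennreal_plus[symmetric] del: ennreal_plus)
    finally show ?thesis .
  qed
  have "(\<integral>\<^sup>+x. (\<integral>\<^sup>+y. ennreal (f (x - \<rho> *\<^sub>R y)) \<partial>arc_length) ^ 3 \<partial>lborel)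
    = (\<integral>\<^sup>+x. \<integral>\<^sup>+y. \<integral>\<^sup>+z. \<integral>\<^sup>+w. ennreal (f (x - \<rho> *\<^sub>R y)) * ennreal (f (x - \<rho> *\<^sub>R z)) * ennreal (f (x - \<rho> *\<^sub>R w))
        \<partial>arc_length \<partial>arc_length \<partial>arc_length \<partial>lborel)"
    by (simp add: nn_integral_cube)
  also have "\<dots> \<le> (\<integral>\<^sup>+x. \<integral>\<^sup>+y. \<integral>\<^sup>+z. \<integral>\<^sup>+w. T * (P x y z * k y z w + P x y w * k y w z + P x z w * k z w y)
        \<partial>arc_length \<partial>arc_length \<partial>arc_length \<partial>lborel)"
  proof (rule nn_integral_mono, rule nn_integral_mono_AE)
    fix x :: "real^2"
    \<comment> \<open>The inequality \<open>pw\<close> needs three nonzero wedges. For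
      \<open>y\<close> on the circle almost every \<open>z\<close> is admissible, and then almost
      every \<open>w\<close>.\<close>
    have wz: "AE z in arc_length. wedge u z \<noteq> 0" if "norm u = 1" for u
      using that by (metis AE_arc_length_wedge norm_1_circ)
    show "AE y in arc_length. (\<integral>\<^sup>+z. \<integral>\<^sup>+w. ennreal (f (x - \<rho> *\<^sub>R y)) * ennreal (f (x - \<rho> *\<^sub>R z)) * ennreal (f (x - \<rho> *\<^sub>R w))
        \<partial>arc_length \<partial>arc_length) \<le> (\<integral>\<^sup>+z. \<integral>\<^sup>+w. T * (P x y z * k y z w + P x y w * k y w z + P x z w * k z w y)
        \<partial>arc_length \<partial>arc_length)"
      using AE_arc_length_norm
    proof eventually_elim
      case (elim y)
      show ?case
      proof (rule nn_integral_mono_AE)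
        show "AE z in arc_length. (\<integral>\<^sup>+w. ennreal (f (x - \<rho> *\<^sub>R y)) * ennreal (f (x - \<rho> *\<^sub>R z)) * ennreal (f (x - \<rho> *\<^sub>R w))
        \<partial>arc_length) \<le> (\<integral>\<^sup>+w. T * (P x y z * k y z w + P x y w * k y w z + P x z w * k z w y) \<partial>arc_length)"
          using AE_arc_length_norm wz[OF elim]
        proof eventually_elim
          case (elim z)
          show ?case
          proof (rule nn_integral_mono_AE)
            show "AE w in arc_length. ennreal (f (x - \<rho> *\<^sub>R y)) * ennreal (f (x - \<rho> *\<^sub>R z)) * ennreal (f (x - \<rho> *\<^sub>R w))
               \<le> T * (P x y z * k y z w + P x y w * k y w z + P x z w * k z w y)"
              using wz[OF \<open>norm y = 1\<close>] wz[OF \<open>norm z = 1\<close>]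
              by eventually_elim (rule pw, use elim in auto)
          qed
        qed
      qed
    qed
  qed
  also have "\<dots> = T * (J + J + J)"
  proof -
    have "(\<integral>\<^sup>+x. \<integral>\<^sup>+y. \<integral>\<^sup>+z. \<integral>\<^sup>+w. T * (P x y z * k y z w + P x y w * k y w z + P x z w * k z w y)
        \<partial>arc_length \<partial>arc_length \<partial>arc_length \<partial>lborel)
     = T * (J + (\<integral>\<^sup>+x. \<integral>\<^sup>+y. \<integral>\<^sup>+z. \<integral>\<^sup>+w. P x y w * k y w z \<partial>arc_length \<partial>arc_length \<partial>arc_length \<partial>lborel)
        + (\<integral>\<^sup>+x. \<integral>\<^sup>+y. \<integral>\<^sup>+z. \<integral>\<^sup>+w. P x z w * k z w y \<partial>arc_length \<partial>arc_length \<partial>arc_length \<partial>lborel))"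
      by (simp add: J_def nn_integral_cmult nn_integral_add)
    then show ?thesis unfolding J2 J3 .
  qed
  also have "\<dots> = J"
  proof -
    have "J + J + J = 3 * J" by (simp add: distrib_right[of 1 2, simplified] mult_2 add.assoc)
    then have "T * (J + J + J) = (T * 3) * J" by (simp add: mult.assoc)
    also have "T * 3 = 1"
      unfolding T_def by (subst ennreal_numeral[symmetric], subst ennreal_mult[symmetric]) auto
    finally show ?thesis by simp
  qed
  finally show ?thesis using J by (rule order_trans)
qed

section \<open>Interpolation for the positive operator\<close>

lemma ennpowr_measurable [measurable]:
  assumes [measurable]: "f \<in> borel_measurable M"
  shows "(\<lambda>x. ennpowr (f x) a) \<in> borel_measurable M"
  unfolding ennpowr_def by measurable

lemma ennpowr_ennreal [simp]: "0 \<le> x \<Longrightarrow> ennpowr (ennreal x) a = ennreal (x powr a)"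
  by (simp add: ennpowr_def)

lemma ennpowr_top [simp]: "ennpowr top a = top"
  by (simp add: ennpowr_def)

lemma ennpowr_0 [simp]: "ennpowr 0 a = 0"
  by (simp add: ennpowr_def)

lemma ennpowr_mono: "u \<le> v \<Longrightarrow> 0 \<le> a \<Longrightarrow> ennpowr u a \<le> ennpowr v a"
  by (cases u; cases v) (auto simp: top_unique intro!: ennreal_leI powr_mono2)

lemma ennpowr_ennpowr: "ennpowr (ennpowr u a) b = ennpowr u (a * b)"
  by (cases u) (auto simp: powr_powr)

lemma ennpowr_mult: "ennpowr (u * v) a = ennpowr u a * ennpowr v a"
proof (cases "u = 0 \<or> v = 0")
  case False
  then show ?thesis
    by (cases u; cases v) (auto simp: ennreal_mult[symmetric] powr_mult ennreal_mult_top ennreal_top_mult)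
qed auto

lemma ennpowr_1 [simp]: "ennpowr u 1 = u"
  by (cases u) auto

lemma ennpowr_numeral: "ennpowr u (numeral n) = u ^ numeral n"
  by (cases u) (auto simp: ennreal_power power_top_ennreal powr_numeral)

lemma ennpowr_eq_top_iff [simp]: "ennpowr u a = top \<longleftrightarrow> u = top"
  by (auto simp: ennpowr_def)

lemma ennpowr_Young:
  assumes "0 < s" "s < 1"
  shows "ennpowr u (1 - s) * ennpowr v s \<le> ennreal (1 - s) * u + ennreal s * v"
proof (cases "u = top \<or> v = top")
  case True
  then show ?thesis using assms by (auto simp: ennreal_mult_top)
next
  case False
  then obtain a b where ab: "u = ennreal a" "0 \<le> a" "v = ennreal b" "0 \<le> b"
    by (cases u; cases v) auto
  have "a powr (1 - s) * b powr s \<le> (1 - s) * a + s * b"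
  proof (cases "a = 0 \<or> b = 0")
    case False
    then show ?thesis using assms ab by (intro Youngs_inequality_0) auto
  qed (use assms ab in auto)
  then show ?thesis using assms ab by (simp add: ennreal_mult[symmetric] ennreal_plus[symmetric] del: ennreal_plus)
qed

text \<open>Dividing \<open>u\<close> and \<open>v\<close> by their integrals reduces the claim to
  the pointwise inequality \<open>ennpowr_Young\<close>. Zero and infinite integrals are treated
  beforehand.\<close>

lemma nn_integral_Holder:
  assumes [measurable]: "u \<in> borel_measurable M" "v \<in> borel_measurable M" and s: "0 < s" "s < 1"
  shows "(\<integral>\<^sup>+x. ennpowr (u x) (1 - s) * ennpowr (v x) s \<partial>M)
    \<le> ennpowr (\<integral>\<^sup>+x. u x \<partial>M) (1 - s) * ennpowr (\<integral>\<^sup>+x. v x \<partial>M) s" (is "?L \<le> ennpowr ?U _ * ennpowr ?V _")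
proof -
  consider "?U = 0 \<or> ?V = 0" | "?U \<noteq> 0" "?V \<noteq> 0" "?U = top \<or> ?V = top"
    | "?U \<noteq> 0" "?V \<noteq> 0" "?U \<noteq> top" "?V \<noteq> top" by blast
  then show ?thesis
  proof cases
    case 1
    then have "(AE x in M. u x = 0) \<or> (AE x in M. v x = 0)"
      by (simp add: nn_integral_0_iff_AE)
    then have "AE x in M. ennpowr (u x) (1 - s) * ennpowr (v x) s = 0"
      by (auto elim: eventually_mono)
    then have "?L = 0" by (subst nn_integral_0_iff_AE) auto
    then show ?thesis by simp
  next
    case 2
    \<comment> \<open>Infinity times zero is zero in \<open>ennreal\<close>; nonvanishing of both
      factors is what makes the right-hand side infinite.\<close>
    have "ennpowr w r \<noteq> 0" if "w \<noteq> 0" for w r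
      using that by (cases w) (auto simp: less_le)
    with 2 show ?thesis by (auto simp: ennreal_mult_top ennreal_top_mult)
  next
    case 3
    then obtain U V where UV: "?U = ennreal U" "U > 0" "?V = ennreal V" "V > 0"
      by (cases ?U; cases ?V) (auto simp: less_le)
    have "?L = (\<integral>\<^sup>+x. (ennpowr (ennreal U) (1 - s) * ennpowr (ennreal V) s) *
        (ennpowr (ennreal (1 / U) * u x) (1 - s) * ennpowr (ennreal (1 / V) * v x) s) \<partial>M)"
    proof (rule nn_integral_cong)
      fix x
      have "ennpowr (u x) (1 - s) = ennpowr (ennreal U * (ennreal (1 / U) * u x)) (1 - s)"
           "ennpowr (v x) s = ennpowr (ennreal V * (ennreal (1 / V) * v x)) s"
        using UV by (simp_all add: mult.assoc[symmetric] ennreal_mult[symmetric])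
      then have "ennpowr (u x) (1 - s) = ennpowr (ennreal U) (1 - s) * ennpowr (ennreal (1 / U) * u x) (1 - s)"
           "ennpowr (v x) s = ennpowr (ennreal V) s * ennpowr (ennreal (1 / V) * v x) s"
        by (metis ennpowr_mult)+
      then show "ennpowr (u x) (1 - s) * ennpowr (v x) s = (ennpowr (ennreal U) (1 - s) * ennpowr (ennreal V) s) *
        (ennpowr (ennreal (1 / U) * u x) (1 - s) * ennpowr (ennreal (1 / V) * v x) s)"
        by (metis mult.assoc mult.left_commute)
    qed
    also have "\<dots> \<le> (\<integral>\<^sup>+x. (ennpowr (ennreal U) (1 - s) * ennpowr (ennreal V) s) *
        (ennreal (1 - s) * (ennreal (1 / U) * u x) + ennreal s * (ennreal (1 / V) * v x)) \<partial>M)"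
      by (intro nn_integral_mono mult_left_mono ennpowr_Young s) auto
    also have "\<dots> = (ennpowr (ennreal U) (1 - s) * ennpowr (ennreal V) s) *
        (ennreal (1 - s) * (ennreal (1 / U) * ?U) + ennreal s * (ennreal (1 / V) * ?V))"
      by (simp add: nn_integral_cmult nn_integral_add)
    also have "ennreal (1 - s) * (ennreal (1 / U) * ?U) + ennreal s * (ennreal (1 / V) * ?V) = 1"
      using UV s by (simp add: ennreal_mult[symmetric] ennreal_plus[symmetric] del: ennreal_plus)
    finally show ?thesis by (simp add: UV)
  qed
qed

section \<open>The positive operator and the convexity of its exponents\<close>

definition pos_avg :: "real \<Rightarrow> (real^2 \<Rightarrow> real) \<Rightarrow> (real^2 \<Rightarrow> real) \<Rightarrow> real^2 \<Rightarrow> ennreal" where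
  "pos_avg \<theta> f g x = (\<integral>\<^sup>+y. ennreal (f (x - y) * g (x - rotation \<theta> y)) \<partial>arc_length)"

text \<open>For \<open>a = 0\<close> the bound is imposed at every point, since \<open>pos_avg\<close> integrates over circles, which are null sets.\<close>

definition Lunit :: "real \<Rightarrow> (real^2 \<Rightarrow> real) \<Rightarrow> bool" where
  "Lunit a f \<longleftrightarrow> f \<in> borel_measurable borel \<and> (\<forall>x. 0 \<le> f x) \<and>
    (if a = 0 then \<forall>x. f x \<le> 1 else (\<integral>\<^sup>+x. ennreal (f x powr (1 / a)) \<partial>lborel) \<le> 1)"

text \<open>The inequality between norms is kept raised to the power \<open>1 / c\<close>, so that
  Hoelder's inequality applies to the integral without extracting roots.\<close>

definition Lbound :: "real \<Rightarrow> real \<Rightarrow> (real^2 \<Rightarrow> ennreal) \<Rightarrow> bool" where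
  "Lbound c K F \<longleftrightarrow> (if c = 0 then AE x in lborel. F x \<le> ennreal K
    else (\<integral>\<^sup>+x. ennpowr (F x) (1 / c) \<partial>lborel) \<le> ennreal (K powr (1 / c)))"

text \<open>Only unit balls are tested; general functions are recovered by homogeneity.\<close>

definition pos_bounded :: "real \<Rightarrow> real \<times> real \<times> real \<Rightarrow> bool" where
  "pos_bounded \<theta> = (\<lambda>(a, b, c). \<exists>K>0. \<forall>f g. Lunit a f \<longrightarrow> Lunit b g \<longrightarrow> Lbound c K (pos_avg \<theta> f g))"

lemma pos_avg_measurable [measurable]:
  assumes [measurable]: "f \<in> borel_measurable borel" "g \<in> borel_measurable borel"
  shows "pos_avg \<theta> f g \<in> borel_measurable borel"
  unfolding pos_avg_def by measurable

text \<open>Take \<open>f powr (a0 / a)\<close> and \<open>f powr (a1 / a)\<close>: their powers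
  \<open>1 / a0\<close> and \<open>1 / a1\<close> are both \<open>f powr (1 / a)\<close>, and the
  exponents in the product add up to 1. If \<open>a = 0\<close>, all exponents vanish and
  \<open>f\<close> itself serves twice.\<close>

lemma Lunit_power:
  assumes f: "Lunit a f" and "0 \<le> a0" "0 \<le> a1" and s: "0 < s" "s < 1" and a: "a = (1 - s) * a0 + s * a1"
  obtains f0 f1 where "Lunit a0 f0" "Lunit a1 f1" "\<And>x. f x = f0 x powr (1 - s) * f1 x powr s"
proof (cases "a = 0")
  case True
  then have "a0 = 0" "a1 = 0"
    using a s assms(2,3) by (auto simp: add_nonneg_eq_0_iff)
  moreover have "f x = f x powr (1 - s) * f x powr s" for x
    using f by (simp add: Lunit_def powr_add[symmetric])
  ultimately show ?thesis using f True that by metis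
next
  case False
  then have "a > 0" using a s assms(2,3) by (simp add: less_le)
  have meas [measurable]: "f \<in> borel_measurable borel" and f0: "\<And>x. 0 \<le> f x" using f by (auto simp: Lunit_def)
  \<comment> \<open>For \<open>r = 0\<close> this function is 1 where \<open>f\<close> is nonzero
    and 0 elsewhere, as \<open>0 powr 0 = 0\<close>; hence it is bounded by 1.\<close>
  have L: "Lunit r (\<lambda>x. f x powr (r / a))" if "0 \<le> r" for r
  proof (cases "r = 0")
    case True
    then show ?thesis by (auto simp: Lunit_def)
  next
    case r: False
    then show ?thesis using f False by (auto simp: Lunit_def powr_powr)
  qed
  have "f x = (f x powr (a0 / a)) powr (1 - s) * (f x powr (a1 / a)) powr s" for x
  proof -
    have "(f x powr (a0 / a)) powr (1 - s) * (f x powr (a1 / a)) powr s = f x powr (((1 - s) * a0 + s * a1) / a)"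
      by (simp add: powr_powr powr_add[symmetric] add_divide_distrib mult.commute add.commute)
    also have "\<dots> = f x" using a \<open>a > 0\<close> f0 by simp
    finally show ?thesis by simp
  qed
  then show ?thesis using L assms(2,3) that by metis
qed

lemma pos_avg_Holder:
  assumes f: "\<And>x. f x = f0 x powr (1 - s) * f1 x powr s" and g: "\<And>x. g x = g0 x powr (1 - s) * g1 x powr s"
    and [measurable]: "f0 \<in> borel_measurable borel" "f1 \<in> borel_measurable borel"
      "g0 \<in> borel_measurable borel" "g1 \<in> borel_measurable borel"
    and nn: "\<And>x. 0 \<le> f0 x" "\<And>x. 0 \<le> f1 x" "\<And>x. 0 \<le> g0 x" "\<And>x. 0 \<le> g1 x"
    and s: "0 < s" "s < 1"
  shows "pos_avg \<theta> f g x \<le> ennpowr (pos_avg \<theta> f0 g0 x) (1 - s) * ennpowr (pos_avg \<theta> f1 g1 x) s"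
proof -
  have "pos_avg \<theta> f g x = (\<integral>\<^sup>+y. ennpowr (ennreal (f0 (x - y) * g0 (x - rotation \<theta> y))) (1 - s)
      * ennpowr (ennreal (f1 (x - y) * g1 (x - rotation \<theta> y))) s \<partial>arc_length)"
    unfolding pos_avg_def
    by (intro nn_integral_cong) (simp add: f g nn powr_mult ennreal_mult[symmetric] mult_ac)
  also have "\<dots> \<le> ennpowr (pos_avg \<theta> f0 g0 x) (1 - s) * ennpowr (pos_avg \<theta> f1 g1 x) s"
    unfolding pos_avg_def by (rule nn_integral_Holder) (use s in \<open>auto, measurable\<close>)
  finally show ?thesis .
qed

lemma Lbound_mono:
  assumes "Lbound c K F" "K \<le> L" "0 < K" "0 \<le> c"
  shows "Lbound c L F"
proof -
  have "ennreal K \<le> ennreal L" "ennreal (K powr (1 / c)) \<le> ennreal (L powr (1 / c))"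
    using assms by (auto intro!: ennreal_leI powr_mono2)
  then show ?thesis
    using assms(1) unfolding Lbound_def
    by (auto split: if_splits intro: order_trans elim!: eventually_mono)
qed

text \<open>At the endpoint of bounded functions, \<open>F0\<close> is replaced by its essential
  bound and leaves the integral; the remaining power of \<open>F1\<close> is just
  \<open>1 / c1\<close>.\<close>

lemma Lbound_Holder_0:
  assumes L0: "Lbound 0 K F0" and L1: "Lbound c1 K F1" and K: "K > 0" and c1: "c1 > 0"
    and s: "0 < s" "s < 1" and [measurable]: "F1 \<in> borel_measurable borel"
    and F: "\<And>x. F x \<le> ennpowr (F0 x) (1 - s) * ennpowr (F1 x) s"
  shows "Lbound (s * c1) K F"
proof -
  have "(\<integral>\<^sup>+x. ennpowr (F x) (1 / (s * c1)) \<partial>lborel)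
    \<le> (\<integral>\<^sup>+x. ennreal (K powr ((1 - s) / (s * c1))) * ennpowr (F1 x) (1 / c1) \<partial>lborel)"
  proof (rule nn_integral_mono_AE)
    have "AE x in lborel. F0 x \<le> ennreal K" using L0 by (simp add: Lbound_def)
    then show "AE x in lborel. ennpowr (F x) (1 / (s * c1)) \<le> ennreal (K powr ((1 - s) / (s * c1))) * ennpowr (F1 x) (1 / c1)"
    proof eventually_elim
      case (elim x)
      have "ennpowr (F x) (1 / (s * c1)) \<le> ennpowr (ennpowr (F0 x) (1 - s) * ennpowr (F1 x) s) (1 / (s * c1))"
        using s c1 by (intro ennpowr_mono F) auto
      also have "\<dots> = ennpowr (F0 x) ((1 - s) / (s * c1)) * ennpowr (F1 x) (1 / c1)"
        using s by (simp add: ennpowr_mult ennpowr_ennpowr)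
      also have "\<dots> \<le> ennpowr (ennreal K) ((1 - s) / (s * c1)) * ennpowr (F1 x) (1 / c1)"
        using s c1 by (intro mult_right_mono ennpowr_mono elim) auto
      finally show ?case using K by simp
    qed
  qed
  also have "\<dots> = ennreal (K powr ((1 - s) / (s * c1))) * (\<integral>\<^sup>+x. ennpowr (F1 x) (1 / c1) \<partial>lborel)"
    by (rule nn_integral_cmult) measurable
  also have "\<dots> \<le> ennreal (K powr ((1 - s) / (s * c1))) * ennreal (K powr (1 / c1))"
    using L1 c1 by (intro mult_left_mono) (auto simp: Lbound_def)
  also have "\<dots> = ennreal (K powr ((1 - s) / (s * c1) + 1 / c1))"
    by (simp add: ennreal_mult[symmetric] powr_add)
  also have "(1 - s) / (s * c1) + 1 / c1 = 1 / (s * c1)"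
    using s c1 by (simp add: field_simps)
  finally show ?thesis using s c1 by (simp add: Lbound_def)
qed

lemma Lbound_Holder:
  assumes L0: "Lbound c0 K F0" and L1: "Lbound c1 K F1" and K: "K > 0" and c: "0 \<le> c0" "0 \<le> c1"
    and s: "0 < s" "s < 1" and [measurable]: "F0 \<in> borel_measurable borel" "F1 \<in> borel_measurable borel"
    and F: "\<And>x. F x \<le> ennpowr (F0 x) (1 - s) * ennpowr (F1 x) s"
  shows "Lbound ((1 - s) * c0 + s * c1) K F"
proof -
  consider "c0 = 0" "c1 = 0" | "c0 = 0" "c1 > 0" | "c0 > 0" "c1 = 0" | "c0 > 0" "c1 > 0"
    using c by linarith
  then show ?thesis
  proof cases
    case 1
    then have "AE x in lborel. F0 x \<le> ennreal K" "AE x in lborel. F1 x \<le> ennreal K"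
      using L0 L1 by (auto simp: Lbound_def)
    then have "AE x in lborel. F x \<le> ennreal K"
    proof eventually_elim
      case (elim x)
      have "F x \<le> ennpowr (ennreal K) (1 - s) * ennpowr (ennreal K) s"
        using s by (intro order_trans[OF F] mult_mono ennpowr_mono elim) auto
      also have "\<dots> = ennreal K" using K by (simp add: ennreal_mult[symmetric] powr_add[symmetric])
      finally show ?case .
    qed
    then show ?thesis using 1 by (simp add: Lbound_def)
  next
    case 2
    then show ?thesis using Lbound_Holder_0[of K F0 c1 F1 s F] assms by simp
  next
    case 3
    then show ?thesis using Lbound_Holder_0[of K F1 c0 F0 "1 - s" F] assms by (simp add: mult.commute)
  next
    case 4
    define c where "c = (1 - s) * c0 + s * c1"
    have "c > 0" unfolding c_def using 4 s by (simp add: add_pos_pos)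
    \<comment> \<open>Chosen so that \<open>(1 - s) / c = (1 - \<mu>) / c0\<close> and
      \<open>s / c = \<mu> / c1\<close>: the power \<open>1 / c\<close> of the product splits into
      the powers controlled by \<open>L0\<close> and \<open>L1\<close>.\<close>
    define \<mu> where "\<mu> = s * c1 / c"
    have \<mu>: "0 < \<mu>" "1 - \<mu> = (1 - s) * c0 / c"
      using 4 s \<open>c > 0\<close> by (auto simp: \<mu>_def c_def field_simps)
    have "\<mu> < 1" using \<mu>(2) 4 s \<open>c > 0\<close> by (smt (verit) divide_pos_pos mult_pos_pos)
    have "(\<integral>\<^sup>+x. ennpowr (F x) (1 / c) \<partial>lborel)
      \<le> (\<integral>\<^sup>+x. ennpowr (ennpowr (F0 x) (1 / c0)) (1 - \<mu>) * ennpowr (ennpowr (F1 x) (1 / c1)) \<mu> \<partial>lborel)"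
    proof (rule nn_integral_mono)
      fix x
      have "ennpowr (F x) (1 / c) \<le> ennpowr (ennpowr (F0 x) (1 - s) * ennpowr (F1 x) s) (1 / c)"
        using \<open>c > 0\<close> by (intro ennpowr_mono F) auto
      also have "\<dots> = ennpowr (ennpowr (F0 x) (1 / c0)) (1 - \<mu>) * ennpowr (ennpowr (F1 x) (1 / c1)) \<mu>"
        using 4 unfolding \<mu>(2) by (simp add: ennpowr_mult ennpowr_ennpowr \<mu>_def)
      finally show "ennpowr (F x) (1 / c) \<le> ennpowr (ennpowr (F0 x) (1 / c0)) (1 - \<mu>) * ennpowr (ennpowr (F1 x) (1 / c1)) \<mu>" .
    qed
    also have "\<dots> \<le> ennpowr (\<integral>\<^sup>+x. ennpowr (F0 x) (1 / c0) \<partial>lborel) (1 - \<mu>) * ennpowr (\<integral>\<^sup>+x. ennpowr (F1 x) (1 / c1) \<partial>lborel) \<mu>"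
      by (rule nn_integral_Holder) (use \<mu> \<open>\<mu> < 1\<close> in auto)
    also have "\<dots> \<le> ennpowr (ennreal (K powr (1 / c0))) (1 - \<mu>) * ennpowr (ennreal (K powr (1 / c1))) \<mu>"
      using L0 L1 4 \<mu> \<open>\<mu> < 1\<close> by (intro mult_mono ennpowr_mono) (auto simp: Lbound_def)
    also have "\<dots> = ennreal (K powr ((1 / c0) * (1 - \<mu>) + (1 / c1) * \<mu>))"
      by (simp add: ennreal_mult[symmetric] powr_powr powr_add)
    also have "(1 / c0) * (1 - \<mu>) + (1 / c1) * \<mu> = 1 / c"
      using 4 unfolding \<mu>(2) by (simp add: \<mu>_def add_divide_distrib[symmetric])
    finally show ?thesis using \<open>c > 0\<close> by (simp add: Lbound_def c_def)
  qed
qed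

lemma convex_pos_bounded: "convex {(a, b, c). 0 \<le> a \<and> 0 \<le> b \<and> 0 \<le> c \<and> pos_bounded \<theta> (a, b, c)}"
proof (rule convexI)
  fix x y r s
  assume x: "x \<in> {(a, b, c). 0 \<le> a \<and> 0 \<le> b \<and> 0 \<le> c \<and> pos_bounded \<theta> (a, b, c)}"
    and y: "y \<in> {(a, b, c). 0 \<le> a \<and> 0 \<le> b \<and> 0 \<le> c \<and> pos_bounded \<theta> (a, b, c)}"
    and rs: "0 \<le> r" "0 \<le> s" "r + s = (1::real)"
  obtain a0 b0 c0 a1 b1 c1 where xy: "x = (a0, b0, c0)" "y = (a1, b1, c1)"
    by (metis prod_cases3)
  have nn: "0 \<le> a0" "0 \<le> b0" "0 \<le> c0" "0 \<le> a1" "0 \<le> b1" "0 \<le> c1"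
    and b: "pos_bounded \<theta> (a0, b0, c0)" "pos_bounded \<theta> (a1, b1, c1)"
    using x y by (auto simp: xy)
  have r: "r = 1 - s" using rs by simp
  have "pos_bounded \<theta> ((1 - s) * a0 + s * a1, (1 - s) * b0 + s * b1, (1 - s) * c0 + s * c1)"
  proof -
    consider "s = 0" | "s = 1" | "0 < s" "s < 1" using rs by linarith
    then show ?thesis
    proof cases
      case 3
      obtain K0 K1 where K: "K0 > 0" "K1 > 0"
        and B0: "\<And>f g. Lunit a0 f \<Longrightarrow> Lunit b0 g \<Longrightarrow> Lbound c0 K0 (pos_avg \<theta> f g)"
        and B1: "\<And>f g. Lunit a1 f \<Longrightarrow> Lunit b1 g \<Longrightarrow> Lbound c1 K1 (pos_avg \<theta> f g)"
        using b by (auto simp: pos_bounded_def)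
      \<comment> \<open>The maximum brings both endpoint estimates under one constant, as
        \<open>Lbound_Holder\<close> requires.\<close>
      show ?thesis unfolding pos_bounded_def prod.case
      proof (intro exI[of _ "max K0 K1"] conjI allI impI)
        fix f g
        assume "Lunit ((1 - s) * a0 + s * a1) f" "Lunit ((1 - s) * b0 + s * b1) g"
        then obtain f0 f1 g0 g1 where fg: "Lunit a0 f0" "Lunit a1 f1" "Lunit b0 g0" "Lunit b1 g1"
          "\<And>x. f x = f0 x powr (1 - s) * f1 x powr s" "\<And>x. g x = g0 x powr (1 - s) * g1 x powr s"
          using Lunit_power[OF _ _ _ 3 refl] nn by metis
        have m [measurable]: "f0 \<in> borel_measurable borel" "f1 \<in> borel_measurable borel"
          "g0 \<in> borel_measurable borel" "g1 \<in> borel_measurable borel"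
          and n: "\<And>x. 0 \<le> f0 x" "\<And>x. 0 \<le> f1 x" "\<And>x. 0 \<le> g0 x" "\<And>x. 0 \<le> g1 x"
          using fg(1-4) by (auto simp: Lunit_def)
        show "Lbound ((1 - s) * c0 + s * c1) (max K0 K1) (pos_avg \<theta> f g)"
        proof (rule Lbound_Holder[OF _ _ _ nn(3,6) 3])
          show "Lbound c0 (max K0 K1) (pos_avg \<theta> f0 g0)" "Lbound c1 (max K0 K1) (pos_avg \<theta> f1 g1)"
            using Lbound_mono[OF B0[OF fg(1,3)]] Lbound_mono[OF B1[OF fg(2,4)]] K nn by auto
          show "pos_avg \<theta> f g x \<le> ennpowr (pos_avg \<theta> f0 g0 x) (1 - s) * ennpowr (pos_avg \<theta> f1 g1 x) s" for x
            by (rule pos_avg_Holder[OF fg(5,6) m n 3])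
        qed (use K in auto)
      qed (use K in auto)
    qed (use b in auto)
  qed
  then show "r *\<^sub>R x + s *\<^sub>R y \<in> {(a, b, c). 0 \<le> a \<and> 0 \<le> b \<and> 0 \<le> c \<and> pos_bounded \<theta> (a, b, c)}"
    using nn rs by (auto simp: xy r)
qed

section \<open>The vertices of the polyhedra\<close>

lemma LboundI_const:
  assumes "\<And>x. F x \<le> ennreal K"
  shows "Lbound 0 K F"
  using assms by (simp add: Lbound_def)

lemma LunitD:
  assumes "Lunit a f"
  shows "f \<in> borel_measurable borel" "0 \<le> f x" "a = 0 \<Longrightarrow> f x \<le> 1"
    "a \<noteq> 0 \<Longrightarrow> (\<integral>\<^sup>+x. ennreal (f x powr (1 / a)) \<partial>lborel) \<le> 1"
  using assms by (auto simp: Lunit_def)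

text \<open>The factor in \<open>1 *\<^sub>R y\<close> keeps the shape of an average over a circle
  of radius \<rho>, to which the general estimates apply with \<open>\<rho> = 1\<close>.\<close>

lemma pos_avg_le_left:
  assumes f: "Lunit a f" and g: "Lunit 0 g"
  shows "pos_avg \<theta> f g x \<le> (\<integral>\<^sup>+y. ennreal (f (x - 1 *\<^sub>R y)) \<partial>arc_length)"
  unfolding pos_avg_def
  by (intro nn_integral_mono ennreal_leI) (simp add: mult_left_le LunitD(2)[OF f] LunitD(3)[OF g])

lemma pos_avg_le_right:
  assumes f: "Lunit 0 f" and g: "Lunit b g"
  shows "pos_avg \<theta> f g x \<le> (\<integral>\<^sup>+y. ennreal (g (x - 1 *\<^sub>R y)) \<partial>arc_length)"
proof -
  have [measurable]: "g \<in> borel_measurable borel" using g by (rule LunitD)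
  have "pos_avg \<theta> f g x \<le> (\<integral>\<^sup>+y. ennreal (g (x - rotation \<theta> y)) \<partial>arc_length)"
    unfolding pos_avg_def
    by (intro nn_integral_mono ennreal_leI)
       (simp add: mult_left_le_one_le LunitD(2)[OF f] LunitD(3)[OF f] LunitD(2)[OF g])
  also have "\<dots> = (\<integral>\<^sup>+y. ennreal (g (x - y)) \<partial>arc_length)"
    by (rule nn_integral_arc_length_rotation) measurable
  finally show ?thesis by simp
qed

lemma average_L1:
  assumes "Lunit 1 f"
  shows "(\<integral>\<^sup>+x. \<integral>\<^sup>+y. ennreal (f (x - 1 *\<^sub>R y)) \<partial>arc_length \<partial>lborel) \<le> ennreal (2 * pi)"
proof -
  have [measurable]: "f \<in> borel_measurable borel" using assms by (rule LunitD)
  have "(\<integral>\<^sup>+x. \<integral>\<^sup>+y. ennreal (f (x - 1 *\<^sub>R y)) \<partial>arc_length \<partial>lborel)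
     = (\<integral>\<^sup>+y. \<integral>\<^sup>+x. ennreal (f (x - y)) \<partial>lborel \<partial>arc_length)"
    by (subst nn_integral_arc_length_Fubini) auto
  also have "\<dots> = (\<integral>\<^sup>+y. \<integral>\<^sup>+x. ennreal (f x) \<partial>lborel \<partial>arc_length)"
    by (intro nn_integral_cong nn_integral_translation) measurable
  also have "\<dots> \<le> (\<integral>\<^sup>+y. 1 \<partial>arc_length)"
    using LunitD(4)[OF assms] LunitD(2)[OF assms] by (intro nn_integral_mono) simp
  finally show ?thesis by simp
qed

lemma average_L32:
  assumes "Lunit (2/3) f"
  shows "(\<integral>\<^sup>+x. (\<integral>\<^sup>+y. ennreal (f (x - 1 *\<^sub>R y)) \<partial>arc_length) ^ 3 \<partial>lborel) \<le> ennreal 1296"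
  using circular_average_bound[of 1 f] LunitD[OF assms] by simp

lemma Lbound_1: "(\<integral>\<^sup>+x. F x \<partial>lborel) \<le> ennreal K \<Longrightarrow> 0 < K \<Longrightarrow> Lbound 1 K F"
  by (simp add: Lbound_def)

text \<open>For \<open>K \<ge> 1\<close> a bound for the integral of the cube can be weakened from
  \<open>K\<close> to the cube of \<open>K\<close>, which avoids cube roots in the
  constants.\<close>

lemma Lbound_third:
  assumes "(\<integral>\<^sup>+x. F x ^ 3 \<partial>lborel) \<le> ennreal K" "1 \<le> K"
  shows "Lbound (1/3) K F"
proof -
  have "K \<le> K powr 3" using powr_mono[of 1 3 K] assms by simp
  then have "ennreal K \<le> ennreal (K powr 3)" by (rule ennreal_leI)
  then show ?thesis using order_trans[OF assms(1)] by (simp add: Lbound_def ennpowr_numeral del: ennreal_le_iff ennreal_le_iff2)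
qed

lemma Lbound_half:
  assumes "(\<integral>\<^sup>+x. F x ^ 2 \<partial>lborel) \<le> ennreal K" "1 \<le> K"
  shows "Lbound (1/2) K F"
proof -
  have "K \<le> K powr 2" using powr_mono[of 1 2 K] assms by simp
  then have "ennreal K \<le> ennreal (K powr 2)" by (rule ennreal_leI)
  then show ?thesis using order_trans[OF assms(1)] by (simp add: Lbound_def ennpowr_numeral del: ennreal_le_iff ennreal_le_iff2)
qed

lemma pos_bounded_0_0_0: "pos_bounded \<theta> (0, 0, 0)"
  unfolding pos_bounded_def prod.case
proof (intro exI[of _ "2 * pi"] conjI allI impI LboundI_const)
  fix f g x assume "Lunit 0 f" and g: "Lunit 0 g"
  then have "pos_avg \<theta> f g x \<le> (\<integral>\<^sup>+y. 1 \<partial>arc_length)"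
    by (intro order_trans[OF pos_avg_le_left] nn_integral_mono) (auto simp: LunitD)
  then show "pos_avg \<theta> f g x \<le> ennreal (2 * pi)" by simp
qed simp

lemma pos_bounded_1_0_1: "pos_bounded \<theta> (1, 0, 1)"
  unfolding pos_bounded_def prod.case
proof (intro exI[of _ "2 * pi"] conjI allI impI Lbound_1)
  fix f g assume "Lunit 1 f" "Lunit 0 g"
  then show "(\<integral>\<^sup>+x. pos_avg \<theta> f g x \<partial>lborel) \<le> ennreal (2 * pi)"
    by (intro order_trans[OF nn_integral_mono[OF pos_avg_le_left] average_L1])
qed simp_all

lemma pos_bounded_0_1_1: "pos_bounded \<theta> (0, 1, 1)"
  unfolding pos_bounded_def prod.case
proof (intro exI[of _ "2 * pi"] conjI allI impI Lbound_1)
  fix f g assume "Lunit 0 f" "Lunit 1 g"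
  then show "(\<integral>\<^sup>+x. pos_avg \<theta> f g x \<partial>lborel) \<le> ennreal (2 * pi)"
    by (intro order_trans[OF nn_integral_mono[OF pos_avg_le_right] average_L1])
qed simp_all

lemma pos_bounded_twothirds_0_third: "pos_bounded \<theta> (2/3, 0, 1/3)"
  unfolding pos_bounded_def prod.case
proof (intro exI[of _ "1296"] conjI allI impI Lbound_third)
  fix f g assume "Lunit (2/3) f" "Lunit 0 g"
  then show "(\<integral>\<^sup>+x. pos_avg \<theta> f g x ^ 3 \<partial>lborel) \<le> ennreal 1296"
    by (intro order_trans[OF nn_integral_mono[OF power_mono[OF pos_avg_le_left]] average_L32]) auto
qed simp_all

lemma pos_bounded_0_twothirds_third: "pos_bounded \<theta> (0, 2/3, 1/3)"
  unfolding pos_bounded_def prod.case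
proof (intro exI[of _ "1296"] conjI allI impI Lbound_third)
  fix f g assume "Lunit 0 f" "Lunit (2/3) g"
  then show "(\<integral>\<^sup>+x. pos_avg \<theta> f g x ^ 3 \<partial>lborel) \<le> ennreal 1296"
    by (intro order_trans[OF nn_integral_mono[OF power_mono[OF pos_avg_le_right]] average_L32]) auto
qed simp_all

section \<open>The vertex \<open>(2/3, 2/3, 1)\<close>\<close>

lemma circ_diff: "circ t - circ (t + \<theta>) = - ((2 * sin (\<theta> / 2)) *\<^sub>R circ (t + (\<theta> / 2 + pi / 2)))"
proof -
  have t: "t = (t + \<theta> / 2) - \<theta> / 2" "t + \<theta> = (t + \<theta> / 2) + \<theta> / 2" by auto
  have "cos t - cos (t + \<theta>) = 2 * sin (\<theta> / 2) * sin (t + \<theta> / 2)"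
    by (subst t(1), subst t(2)) (simp only: cos_add cos_diff, simp)
  moreover have "sin t - sin (t + \<theta>) = - (2 * sin (\<theta> / 2) * cos (t + \<theta> / 2))"
    by (subst t(1), subst t(2)) (simp only: sin_add sin_diff, simp)
  moreover have "cos (t + (\<theta> / 2 + pi / 2)) = - sin (t + \<theta> / 2)" "sin (t + (\<theta> / 2 + pi / 2)) = cos (t + \<theta> / 2)"
    unfolding add.assoc[symmetric] by (simp_all only: cos_add[of _ "pi/2"] sin_add[of _ "pi/2"], simp_all)
  ultimately show ?thesis by (simp add: vec_eq_iff forall_2)
qed

text \<open>As \<open>y\<close> runs over the circle, \<open>y - rotation \<theta> y\<close> runs
  over the circle of radius \<rho>. After a translation the integral is therefore the pairing of
  \<open>f\<close> with a circular average of \<open>g\<close>, and the bound from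
  \<open>3/2\<close> to \<open>3\<close> is dual to the exponent of \<open>f\<close>.\<close>

lemma pos_bounded_twothirds_twothirds_1:
  assumes "0 < \<theta>" "\<theta> < 2 * pi"
  shows "pos_bounded \<theta> (2/3, 2/3, 1)"
proof -
  define \<rho> where "\<rho> = 2 * sin (\<theta> / 2)"
  have \<rho>: "\<rho> > 0" using assms by (simp add: \<rho>_def sin_gt_zero)
  show ?thesis unfolding pos_bounded_def prod.case
  proof (intro exI[of _ "2/3 + 1/3 * (1296 / \<rho>\<^sup>2)"] conjI allI impI Lbound_1)
    fix f g assume f: "Lunit (2/3) f" and g: "Lunit (2/3) g"
    have [measurable]: "f \<in> borel_measurable borel" "g \<in> borel_measurable borel"
      using f g by (auto intro: LunitD)
    define A where "A x = (\<integral>\<^sup>+y. ennreal (g (x - \<rho> *\<^sub>R y)) \<partial>arc_length)" for x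
    have [measurable]: "A \<in> borel_measurable borel" unfolding A_def by measurable
    have A: "(\<integral>\<^sup>+y. ennreal (g (x + y - rotation \<theta> y)) \<partial>arc_length) = A x" for x
    proof -
      have "(\<integral>\<^sup>+y. ennreal (g (x + y - rotation \<theta> y)) \<partial>arc_length)
        = (\<integral>\<^sup>+t\<in>{0..<2*pi}. ennreal (g (x - \<rho> *\<^sub>R circ (t + (\<theta> / 2 + pi / 2)))) \<partial>lborel)"
        by (subst nn_integral_arc_length)
           (simp_all add: rotation_circ add_diff_eq[symmetric] circ_diff \<rho>_def)
      also have "\<dots> = A x"
        unfolding A_def by (rule nn_integral_arc_length_shift[of "\<lambda>y. ennreal (g (x - \<rho> *\<^sub>R y))"]) measurable
      finally show ?thesis .
    qed
    have "(\<integral>\<^sup>+x. pos_avg \<theta> f g x \<partial>lborel)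
      = (\<integral>\<^sup>+y. \<integral>\<^sup>+x. ennreal (f (x - y)) * ennreal (g (x - rotation \<theta> y)) \<partial>lborel \<partial>arc_length)"
      unfolding pos_avg_def
      by (subst nn_integral_arc_length_Fubini) (auto simp: ennreal_mult LunitD(2)[OF f] LunitD(2)[OF g])
    also have "\<dots> = (\<integral>\<^sup>+y. \<integral>\<^sup>+x. ennreal (f x) * ennreal (g (x + y - rotation \<theta> y)) \<partial>lborel \<partial>arc_length)"
    proof (rule nn_integral_cong)
      fix y
      show "(\<integral>\<^sup>+x. ennreal (f (x - y)) * ennreal (g (x - rotation \<theta> y)) \<partial>lborel)
        = (\<integral>\<^sup>+x. ennreal (f x) * ennreal (g (x + y - rotation \<theta> y)) \<partial>lborel)"
        using nn_integral_translation[of "\<lambda>x. ennreal (f x) * ennreal (g (x + y - rotation \<theta> y))" y] by simp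
    qed
    also have "\<dots> = (\<integral>\<^sup>+x. ennreal (f x) * A x \<partial>lborel)"
      by (subst nn_integral_arc_length_Fubini[symmetric]) (simp_all add: nn_integral_cmult A)
    also have "\<dots> \<le> (\<integral>\<^sup>+x. ennreal (2/3) * ennreal (f x powr (3/2)) + ennreal (1/3) * A x ^ 3 \<partial>lborel)"
    proof (rule nn_integral_mono)
      fix x
      \<comment> \<open>Young's inequality with weights 2/3 and 1/3 stands in for Hoelder's, which
        suffices because both functions are normalised.\<close>
      have "ennreal (f x) * A x = ennpowr (ennreal (f x powr (3/2))) (1 - 1/3) * ennpowr (ennpowr (A x) 3) (1/3)"
        by (simp add: ennpowr_ennpowr powr_powr LunitD(2)[OF f])
      also have "\<dots> \<le> ennreal (1 - 1/3) * ennreal (f x powr (3/2)) + ennreal (1/3) * ennpowr (A x) 3"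
        by (rule ennpowr_Young) auto
      finally show "ennreal (f x) * A x \<le> ennreal (2/3) * ennreal (f x powr (3/2)) + ennreal (1/3) * A x ^ 3"
        by (simp add: ennpowr_numeral)
    qed
    also have "\<dots> = ennreal (2/3) * (\<integral>\<^sup>+x. ennreal (f x powr (3/2)) \<partial>lborel) + ennreal (1/3) * (\<integral>\<^sup>+x. A x ^ 3 \<partial>lborel)"
      by (subst nn_integral_add) (simp_all add: nn_integral_cmult)
    also have "\<dots> \<le> ennreal (2/3) * ennreal 1 + ennreal (1/3) * ennreal (1296 / \<rho>\<^sup>2)"
      unfolding A_def using LunitD(4)[OF f] LunitD[OF g]
      by (intro add_mono mult_left_mono circular_average_bound \<rho>) auto
    also have "\<dots> = ennreal (2/3 + 1/3 * (1296 / \<rho>\<^sup>2))"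
      by (subst ennreal_mult[symmetric], simp, simp, subst ennreal_mult[symmetric], simp, simp, subst ennreal_plus[symmetric]) auto
    finally show "(\<integral>\<^sup>+x. pos_avg \<theta> f g x \<partial>lborel) \<le> ennreal (2/3 + 1/3 * (1296 / \<rho>\<^sup>2))" .
  qed (use \<rho> in \<open>auto intro!: add_pos_pos\<close>)
qed

section \<open>The vertex \<open>(1/2, 1/2, 1/2)\<close>\<close>

lemma wedge_rotation: "wedge (rotation \<theta> y) (rotation \<theta> z) = wedge y z"
proof -
  have "(cos \<theta> * y $ 1 - sin \<theta> * y $ 2) * (sin \<theta> * z $ 1 + cos \<theta> * z $ 2)
      - (sin \<theta> * y $ 1 + cos \<theta> * y $ 2) * (cos \<theta> * z $ 1 - sin \<theta> * z $ 2)
     = ((sin \<theta>)\<^sup>2 + (cos \<theta>)\<^sup>2) * (y $ 1 * z $ 2 - y $ 2 * z $ 1)"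
    by algebra
  then show ?thesis by (simp add: wedge_def rotation_def)
qed

lemma wedge_self_rotation: "norm z = 1 \<Longrightarrow> wedge z (rotation \<theta> z) = \<bar>sin \<theta>\<bar>"
  by (erule norm_1_circ) (simp add: rotation_circ wedge_circ)

lemma norm_rotation: "norm z = 1 \<Longrightarrow> norm (rotation \<theta> z) = 1"
  by (erule norm_1_circ) (simp add: rotation_circ)

text \<open>Here \<open>a\<close>, \<open>b\<close> stand for the values of \<open>f\<close>,
  \<open>g\<close> belonging to \<open>y\<close>, and \<open>a'\<close>, \<open>b'\<close> for those
  belonging to \<open>z\<close>. Twice their product is bounded by sums of squares in two ways,
  pairing \<open>a\<close> with \<open>a'\<close> or with \<open>b'\<close>; these bounds are
  weighted by \<open>w\<close> and by \<open>min w1 w2\<close>, whose sum is at least the modulus of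
  \<open>sin \<theta>\<close>.\<close>

lemma bilinear_L2_pointwise:
  fixes a b a' b' :: real
  assumes "0 \<le> a" "0 \<le> b" "0 \<le> a'" "0 \<le> b'" and y: "norm y = 1" and z: "norm z = 1"
  shows "2 * \<bar>sin \<theta>\<bar> * ((a * b) * (a' * b')) \<le>
     a\<^sup>2 * a'\<^sup>2 * wedge y z + b\<^sup>2 * b'\<^sup>2 * wedge (rotation \<theta> y) (rotation \<theta> z)
     + a\<^sup>2 * b'\<^sup>2 * wedge y (rotation \<theta> z) + b\<^sup>2 * a'\<^sup>2 * wedge (rotation \<theta> y) z"
proof -
  define M where "M = (a * b) * (a' * b')"
  define w w1 w2 where w: "w = wedge y z" "w1 = wedge y (rotation \<theta> z)" "w2 = wedge (rotation \<theta> y) z"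
  have M: "0 \<le> M" "2 * M \<le> a\<^sup>2 * a'\<^sup>2 + b\<^sup>2 * b'\<^sup>2" "2 * M \<le> a\<^sup>2 * b'\<^sup>2 + b\<^sup>2 * a'\<^sup>2"
    using assms(1-4) sum_squares_bound[of "a * a'" "b * b'"] sum_squares_bound[of "a * b'" "b * a'"]
    by (auto simp: M_def power_mult_distrib mult_ac)
  have "\<bar>sin \<theta>\<bar> \<le> w + w1"
    using wedge_triangle[OF z y norm_rotation[OF z, of \<theta>]] wedge_self_rotation[OF z]
    by (simp add: w wedge_commute)
  moreover have "\<bar>sin \<theta>\<bar> \<le> w + w2"
    using wedge_triangle[OF y z norm_rotation[OF y, of \<theta>]] wedge_self_rotation[OF y]
    by (simp add: w wedge_commute)
  ultimately have s: "\<bar>sin \<theta>\<bar> \<le> w + min w1 w2" by linarith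
  have nn: "0 \<le> w" "0 \<le> w1" "0 \<le> w2" by (simp_all add: w)
  have "2 * \<bar>sin \<theta>\<bar> * M \<le> 2 * (w + min w1 w2) * M"
    using s M by (intro mult_right_mono) auto
  also have "\<dots> = w * (2 * M) + min w1 w2 * (2 * M)" by (simp add: algebra_simps)
  also have "\<dots> \<le> w * (a\<^sup>2 * a'\<^sup>2 + b\<^sup>2 * b'\<^sup>2) + min w1 w2 * (a\<^sup>2 * b'\<^sup>2 + b\<^sup>2 * a'\<^sup>2)"
    using M nn by (intro add_mono mult_left_mono) auto
  also have "\<dots> \<le> w * (a\<^sup>2 * a'\<^sup>2 + b\<^sup>2 * b'\<^sup>2) + (w1 * (a\<^sup>2 * b'\<^sup>2) + w2 * (b\<^sup>2 * a'\<^sup>2))"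
    unfolding distrib_left[of "min w1 w2"] by (intro add_left_mono add_mono mult_right_mono) auto
  finally show ?thesis by (simp add: M_def w wedge_rotation algebra_simps)
qed

lemma nn_integral_square:
  assumes [measurable]: "h \<in> borel_measurable M"
  shows "(\<integral>\<^sup>+x. h x \<partial>M) ^ 2 = (\<integral>\<^sup>+x. \<integral>\<^sup>+y. h x * h y \<partial>M \<partial>M)"
  by (simp add: nn_integral_cmult nn_integral_multc power2_eq_square)

lemma nn_integral_rotation_right:
  assumes [measurable]: "(\<lambda>(y, z). h y z) \<in> borel_measurable (borel \<Otimes>\<^sub>M borel)"
  shows "(\<integral>\<^sup>+y. \<integral>\<^sup>+z. h y (rotation \<theta> z) \<partial>arc_length \<partial>arc_length) = (\<integral>\<^sup>+y. \<integral>\<^sup>+z. h y z \<partial>arc_length \<partial>arc_length)"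
  by (intro nn_integral_cong nn_integral_arc_length_rotation) measurable

lemma nn_integral_rotation_left:
  assumes [measurable]: "(\<lambda>(y, z). h y z) \<in> borel_measurable (borel \<Otimes>\<^sub>M borel)"
  shows "(\<integral>\<^sup>+y. \<integral>\<^sup>+z. h (rotation \<theta> y) z \<partial>arc_length \<partial>arc_length) = (\<integral>\<^sup>+y. \<integral>\<^sup>+z. h y z \<partial>arc_length \<partial>arc_length)"
  by (rule nn_integral_arc_length_rotation[of "\<lambda>y. \<integral>\<^sup>+z. h y z \<partial>arc_length"]) measurable

text \<open>The square of the average is a double integral over the circle. The pointwise inequality
  turns it into four integrals, each at most 2 by \<open>wedge_pair_le\<close>; dividing 8 by
  \<open>2 * S\<close> gives the constant, which is at least 1 because
  \<open>S \<le> 1\<close>.\<close>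

lemma pos_bounded_half_half_half:
  assumes "sin \<theta> \<noteq> 0"
  shows "pos_bounded \<theta> (1/2, 1/2, 1/2)"
proof -
  define S where "S = \<bar>sin \<theta>\<bar>"
  have S: "0 < S" "S \<le> 1" using assms by (auto simp: S_def)
  show ?thesis unfolding pos_bounded_def prod.case
  proof (intro exI[of _ "4 / S"] conjI allI impI Lbound_half)
    fix f g assume f: "Lunit (1/2) f" and g: "Lunit (1/2) g"
    have [measurable]: "f \<in> borel_measurable borel" "g \<in> borel_measurable borel"
      using f g by (auto intro: LunitD)
    define F G where FG: "F x = ennreal ((f x)\<^sup>2)" "G x = ennreal ((g x)\<^sup>2)" for x
    have [measurable]: "F \<in> borel_measurable borel" "G \<in> borel_measurable borel"
      unfolding FG by measurable
    have F1: "(\<integral>\<^sup>+x. F x \<partial>lborel) \<le> 1" "(\<integral>\<^sup>+x. G x \<partial>lborel) \<le> 1"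
      using LunitD(4)[OF f] LunitD(4)[OF g] LunitD(2)[OF f] LunitD(2)[OF g]
      by (auto simp: FG powr_numeral)
    define h where "h x y = ennreal (f (x - y) * g (x - rotation \<theta> y))" for x y
    have [measurable]: "h x \<in> borel_measurable borel" for x unfolding h_def by measurable
    define Q where "Q U V x y z = U (x - 1 *\<^sub>R y) * V (x - 1 *\<^sub>R z) * ennreal (wedge y z)"
      for U V :: "real^2 \<Rightarrow> ennreal" and x y z
    have Q: "(\<integral>\<^sup>+x. \<integral>\<^sup>+y. \<integral>\<^sup>+z. Q U V x y z \<partial>arc_length \<partial>arc_length \<partial>lborel) \<le> 2"
      if [measurable]: "U \<in> borel_measurable borel" "V \<in> borel_measurable borel"
        and "(\<integral>\<^sup>+x. U x \<partial>lborel) \<le> 1" "(\<integral>\<^sup>+x. V x \<partial>lborel) \<le> 1" for U V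
    proof -
      have "(\<integral>\<^sup>+x. \<integral>\<^sup>+y. \<integral>\<^sup>+z. Q U V x y z \<partial>arc_length \<partial>arc_length \<partial>lborel)
         \<le> ennreal (2 / 1\<^sup>2) * (\<integral>\<^sup>+x. U x \<partial>lborel) * (\<integral>\<^sup>+x. V x \<partial>lborel)"
        unfolding Q_def by (rule wedge_pair_le) auto
      also have "\<dots> \<le> ennreal (2 / 1\<^sup>2) * 1 * 1"
        by (intro mult_mono that) auto
      finally show ?thesis by simp
    qed
    have [measurable]: "(\<lambda>x. Q U V (a x) (b x) (c x)) \<in> borel_measurable M"
      if [measurable]: "U \<in> borel_measurable borel" "V \<in> borel_measurable borel"
        "a \<in> borel_measurable M" "b \<in> borel_measurable M" "c \<in> borel_measurable M" for U V a b c M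
      unfolding Q_def by measurable
    have "ennreal (2 * S) * (\<integral>\<^sup>+x. pos_avg \<theta> f g x ^ 2 \<partial>lborel)
      = (\<integral>\<^sup>+x. \<integral>\<^sup>+y. \<integral>\<^sup>+z. ennreal (2 * S) * (h x y * h x z) \<partial>arc_length \<partial>arc_length \<partial>lborel)"
    proof -
      have "pos_avg \<theta> f g x ^ 2 = (\<integral>\<^sup>+y. \<integral>\<^sup>+z. h x y * h x z \<partial>arc_length \<partial>arc_length)" for x
        unfolding pos_avg_def h_def[symmetric] by (rule nn_integral_square) measurable
      moreover have "(\<lambda>(x, y, z). h x y * h x z) \<in> borel_measurable (borel \<Otimes>\<^sub>M borel \<Otimes>\<^sub>M borel)"
        unfolding h_def by measurable
      ultimately show ?thesis unfolding h_def by (simp add: nn_integral_cmult)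
    qed
    also have "\<dots> \<le> (\<integral>\<^sup>+x. \<integral>\<^sup>+y. \<integral>\<^sup>+z. Q F F x y z + Q G G x (rotation \<theta> y) (rotation \<theta> z)
         + Q F G x y (rotation \<theta> z) + Q G F x (rotation \<theta> y) z \<partial>arc_length \<partial>arc_length \<partial>lborel)"
    proof (rule nn_integral_mono, rule nn_integral_mono_AE)
      fix x
      show "AE y in arc_length. (\<integral>\<^sup>+z. ennreal (2 * S) * (h x y * h x z) \<partial>arc_length)
        \<le> (\<integral>\<^sup>+z. Q F F x y z + Q G G x (rotation \<theta> y) (rotation \<theta> z)
         + Q F G x y (rotation \<theta> z) + Q G F x (rotation \<theta> y) z \<partial>arc_length)"
        using AE_arc_length_norm
      proof eventually_elim
        case (elim y)
        show ?case
        proof (rule nn_integral_mono_AE)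
          show "AE z in arc_length. ennreal (2 * S) * (h x y * h x z)
            \<le> Q F F x y z + Q G G x (rotation \<theta> y) (rotation \<theta> z) + Q F G x y (rotation \<theta> z) + Q G F x (rotation \<theta> y) z"
            using AE_arc_length_norm
          proof eventually_elim
            case (elim z)
            note nn = LunitD(2)[OF f] LunitD(2)[OF g]
            have "ennreal (2 * S) * (h x y * h x z)
              = ennreal (2 * S * ((f (x - y) * g (x - rotation \<theta> y)) * (f (x - z) * g (x - rotation \<theta> z))))"
              unfolding h_def using S nn by (simp add: ennreal_mult)
            also have "\<dots> \<le> ennreal ((f (x - y))\<^sup>2 * (f (x - z))\<^sup>2 * wedge y z
              + (g (x - rotation \<theta> y))\<^sup>2 * (g (x - rotation \<theta> z))\<^sup>2 * wedge (rotation \<theta> y) (rotation \<theta> z)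
              + (f (x - y))\<^sup>2 * (g (x - rotation \<theta> z))\<^sup>2 * wedge y (rotation \<theta> z)
              + (g (x - rotation \<theta> y))\<^sup>2 * (f (x - z))\<^sup>2 * wedge (rotation \<theta> y) z)"
              unfolding S_def using \<open>norm y = 1\<close> elim nn
              by (intro ennreal_leI bilinear_L2_pointwise) auto
            also have "\<dots> = Q F F x y z + Q G G x (rotation \<theta> y) (rotation \<theta> z) + Q F G x y (rotation \<theta> z) + Q G F x (rotation \<theta> y) z"
              by (simp add: Q_def FG ennreal_mult)
            finally show ?case .
          qed
        qed
      qed
    qed
    also have "\<dots> = (\<integral>\<^sup>+x. (\<integral>\<^sup>+y. \<integral>\<^sup>+z. Q F F x y z \<partial>arc_length \<partial>arc_length)
      + (\<integral>\<^sup>+y. \<integral>\<^sup>+z. Q G G x (rotation \<theta> y) (rotation \<theta> z) \<partial>arc_length \<partial>arc_length)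
      + (\<integral>\<^sup>+y. \<integral>\<^sup>+z. Q F G x y (rotation \<theta> z) \<partial>arc_length \<partial>arc_length)
      + (\<integral>\<^sup>+y. \<integral>\<^sup>+z. Q G F x (rotation \<theta> y) z \<partial>arc_length \<partial>arc_length) \<partial>lborel)"
      by (simp add: nn_integral_add)
    \<comment> \<open>Invariance of arc length removes the rotations in each circle variable
      separately.\<close>
    also have "\<dots> = (\<integral>\<^sup>+x. (\<integral>\<^sup>+y. \<integral>\<^sup>+z. Q F F x y z \<partial>arc_length \<partial>arc_length)
      + (\<integral>\<^sup>+y. \<integral>\<^sup>+z. Q G G x y z \<partial>arc_length \<partial>arc_length)
      + (\<integral>\<^sup>+y. \<integral>\<^sup>+z. Q F G x y z \<partial>arc_length \<partial>arc_length)
      + (\<integral>\<^sup>+y. \<integral>\<^sup>+z. Q G F x y z \<partial>arc_length \<partial>arc_length) \<partial>lborel)"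
    proof (rule nn_integral_cong)
      fix x
      have "(\<integral>\<^sup>+y. \<integral>\<^sup>+z. Q G G x (rotation \<theta> y) (rotation \<theta> z) \<partial>arc_length \<partial>arc_length)
          = (\<integral>\<^sup>+y. \<integral>\<^sup>+z. Q G G x (rotation \<theta> y) z \<partial>arc_length \<partial>arc_length)"
        by (rule nn_integral_rotation_right[of "\<lambda>y z. Q G G x (rotation \<theta> y) z"]) measurable
      also have "\<dots> = (\<integral>\<^sup>+y. \<integral>\<^sup>+z. Q G G x y z \<partial>arc_length \<partial>arc_length)"
        by (rule nn_integral_rotation_left) measurable
      finally have 1: "(\<integral>\<^sup>+y. \<integral>\<^sup>+z. Q G G x (rotation \<theta> y) (rotation \<theta> z) \<partial>arc_length \<partial>arc_length)
         = (\<integral>\<^sup>+y. \<integral>\<^sup>+z. Q G G x y z \<partial>arc_length \<partial>arc_length)" .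
      have 2: "(\<integral>\<^sup>+y. \<integral>\<^sup>+z. Q F G x y (rotation \<theta> z) \<partial>arc_length \<partial>arc_length) = (\<integral>\<^sup>+y. \<integral>\<^sup>+z. Q F G x y z \<partial>arc_length \<partial>arc_length)"
        by (rule nn_integral_rotation_right) measurable
      have 3: "(\<integral>\<^sup>+y. \<integral>\<^sup>+z. Q G F x (rotation \<theta> y) z \<partial>arc_length \<partial>arc_length) = (\<integral>\<^sup>+y. \<integral>\<^sup>+z. Q G F x y z \<partial>arc_length \<partial>arc_length)"
        by (rule nn_integral_rotation_left) measurable
      show "(\<integral>\<^sup>+y. \<integral>\<^sup>+z. Q F F x y z \<partial>arc_length \<partial>arc_length)
      + (\<integral>\<^sup>+y. \<integral>\<^sup>+z. Q G G x (rotation \<theta> y) (rotation \<theta> z) \<partial>arc_length \<partial>arc_length)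
      + (\<integral>\<^sup>+y. \<integral>\<^sup>+z. Q F G x y (rotation \<theta> z) \<partial>arc_length \<partial>arc_length)
      + (\<integral>\<^sup>+y. \<integral>\<^sup>+z. Q G F x (rotation \<theta> y) z \<partial>arc_length \<partial>arc_length)
      = (\<integral>\<^sup>+y. \<integral>\<^sup>+z. Q F F x y z \<partial>arc_length \<partial>arc_length)
      + (\<integral>\<^sup>+y. \<integral>\<^sup>+z. Q G G x y z \<partial>arc_length \<partial>arc_length)
      + (\<integral>\<^sup>+y. \<integral>\<^sup>+z. Q F G x y z \<partial>arc_length \<partial>arc_length)
      + (\<integral>\<^sup>+y. \<integral>\<^sup>+z. Q G F x y z \<partial>arc_length \<partial>arc_length)"
        unfolding 1 2 3 ..
    qed
    also have "\<dots> = (\<integral>\<^sup>+x. \<integral>\<^sup>+y. \<integral>\<^sup>+z. Q F F x y z \<partial>arc_length \<partial>arc_length \<partial>lborel)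
      + (\<integral>\<^sup>+x. \<integral>\<^sup>+y. \<integral>\<^sup>+z. Q G G x y z \<partial>arc_length \<partial>arc_length \<partial>lborel)
      + (\<integral>\<^sup>+x. \<integral>\<^sup>+y. \<integral>\<^sup>+z. Q F G x y z \<partial>arc_length \<partial>arc_length \<partial>lborel)
      + (\<integral>\<^sup>+x. \<integral>\<^sup>+y. \<integral>\<^sup>+z. Q G F x y z \<partial>arc_length \<partial>arc_length \<partial>lborel)"
      by (simp add: nn_integral_add)
    also have "\<dots> \<le> 2 + 2 + 2 + 2"
      by (intro add_mono Q F1) measurable
    finally have 8: "ennreal (2 * S) * (\<integral>\<^sup>+x. pos_avg \<theta> f g x ^ 2 \<partial>lborel) \<le> ennreal 8" by simp
    have "(\<integral>\<^sup>+x. pos_avg \<theta> f g x ^ 2 \<partial>lborel) = ennreal (1 / (2 * S)) * (ennreal (2 * S) * (\<integral>\<^sup>+x. pos_avg \<theta> f g x ^ 2 \<partial>lborel))"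
      using S by (subst mult.assoc[symmetric], subst ennreal_mult[symmetric]) auto
    also have "\<dots> \<le> ennreal (1 / (2 * S)) * ennreal 8"
      by (intro mult_left_mono 8) auto
    also have "\<dots> = ennreal (4 / S)"
      using S by (subst ennreal_mult[symmetric]) auto
    finally show "(\<integral>\<^sup>+x. pos_avg \<theta> f g x ^ 2 \<partial>lborel) \<le> ennreal (4 / S)" .
  qed (use S in \<open>auto simp: field_simps\<close>)
qed

section \<open>From the positive operator to the bilinear average\<close>

text \<open>A single circle is a null set, so it may lie in the exceptional set entirely; Tonelli's
  theorem shows that this affects only a null set of centres. The map \<open>L\<close> is later the
  identity or the rotation.\<close>

lemma AE_arc_length_translate:
  fixes P :: "real^2 \<Rightarrow> bool"
  assumes P: "AE u in lborel. P u" and [measurable]: "Measurable.pred borel P" and [measurable]: "L \<in> borel_measurable borel"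
  shows "AE x in lborel. AE y in arc_length. P (x - L y)"
proof -
  have 0: "(\<integral>\<^sup>+x. indicator {u. \<not> P u} (x - c) \<partial>lborel) = 0" for c :: "real^2"
  proof -
    have "(\<integral>\<^sup>+x. indicator {u. \<not> P u} (x - c) \<partial>lborel) = (\<integral>\<^sup>+x. indicator {u. \<not> P u} x \<partial>lborel)"
      by (rule nn_integral_translation) measurable
    also have "\<dots> = 0"
      using P by (subst nn_integral_0_iff_AE) (auto elim!: eventually_mono simp: indicator_def)
    finally show ?thesis .
  qed
  have "(\<integral>\<^sup>+x. \<integral>\<^sup>+y. indicator {u. \<not> P u} (x - L y) \<partial>arc_length \<partial>lborel) = 0"
    by (subst nn_integral_arc_length_Fubini) (auto simp: 0)
  then have "AE x in lborel. (\<integral>\<^sup>+y. indicator {u. \<not> P u} (x - L y) \<partial>arc_length) = 0"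
    by (subst (asm) nn_integral_0_iff_AE) auto
  then show ?thesis
  proof eventually_elim
    case (elim x)
    then have "AE y in arc_length. indicator {u. \<not> P u} (x - L y) = (0::ennreal)"
      by (subst (asm) nn_integral_0_iff_AE) auto
    then show ?case by eventually_elim (auto simp: indicator_def split: if_splits)
  qed
qed

text \<open>A number strictly above the norm is divided out rather than the norm itself, which may
  be 0.\<close>

lemma Lunit_normalize:
  assumes [measurable]: "f \<in> borel_measurable borel" and N: "Lnorm a f < ennreal M" and a: "0 \<le> a"
  obtains F where "Lunit a F" "AE x in lborel. norm (f x) = M * F x"
proof -
  have M: "M > 0" using N by (auto simp: not_le[symmetric] ennreal_neg)
  show thesis
  proof (cases "a = 0")
    case True
    \<comment> \<open>Truncation gives the bound at every point that \<open>Lunit 0\<close> demands;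
      it changes the function only on a null set.\<close>
    define F where "F x = min (norm (f x) / M) 1" for x
    have "esssup lborel (\<lambda>x. ennreal (norm (f x))) < ennreal M"
      using N True by (simp add: Lnorm_def)
    then have "AE x in lborel. ennreal (norm (f x)) \<le> ennreal M"
      using esssup_AE[of "\<lambda>x. ennreal (norm (f x))" lborel] by (auto elim!: eventually_mono)
    then have "AE x in lborel. norm (f x) = M * F x"
      by eventually_elim (use M in \<open>auto simp: F_def min_def field_simps\<close>)
    moreover have "F \<in> borel_measurable borel" unfolding F_def by measurable
    then have "Lunit a F" using M True by (auto simp: Lunit_def F_def)
    ultimately show thesis using that by blast
  next
    case False
    define I where "I = (\<integral>\<^sup>+x. ennreal (norm (f x) powr (1 / a)) \<partial>lborel)"
    have "ennpowr I a \<le> ennreal M" using N False by (simp add: Lnorm_def I_def)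
    then have "ennpowr (ennpowr I a) (1 / a) \<le> ennpowr (ennreal M) (1 / a)"
      using a by (intro ennpowr_mono) auto
    then have I: "I \<le> ennreal (M powr (1 / a))" using False M by (simp add: ennpowr_ennpowr)
    have "(\<integral>\<^sup>+x. ennreal ((norm (f x) / M) powr (1 / a)) \<partial>lborel) = (\<integral>\<^sup>+x. ennreal ((1 / M) powr (1 / a)) * ennreal (norm (f x) powr (1 / a)) \<partial>lborel)"
      using M by (intro nn_integral_cong) (simp add: ennreal_mult[symmetric] powr_mult[symmetric])
    also have "\<dots> = ennreal ((1 / M) powr (1 / a)) * I"
      unfolding I_def by (rule nn_integral_cmult) measurable
    also have "\<dots> \<le> ennreal ((1 / M) powr (1 / a)) * ennreal (M powr (1 / a))"
      by (intro mult_left_mono I) auto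
    also have "\<dots> = 1"
      using M by (simp add: ennreal_mult[symmetric] powr_mult[symmetric])
    finally have "Lunit a (\<lambda>x. norm (f x) / M)"
      using M False by (auto simp: Lunit_def)
    moreover have "AE x in lborel. norm (f x) = M * (norm (f x) / M)" using M by simp
    ultimately show thesis using that by blast
  qed
qed

lemma Lbound_finite:
  assumes "Lbound c K F" and [measurable]: "F \<in> borel_measurable borel"
  shows "AE x in lborel. F x < top"
proof (cases "c = 0")
  case True
  then show ?thesis using assms(1) by (auto simp: Lbound_def elim!: eventually_mono intro: le_less_trans)
next
  case False
  then have "(\<integral>\<^sup>+x. ennpowr (F x) (1 / c) \<partial>lborel) \<le> ennreal (K powr (1 / c))"
    using assms(1) by (simp add: Lbound_def)
  then have "(\<integral>\<^sup>+x. ennpowr (F x) (1 / c) \<partial>lborel) < top"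
    by (rule le_less_trans) simp
  then have "AE x in lborel. ennpowr (F x) (1 / c) \<noteq> \<infinity>"
    by (intro nn_integral_PInf_AE) auto
  then show ?thesis by eventually_elim (simp add: less_top)
qed

lemma Lnorm_le:
  assumes [measurable]: "h \<in> borel_measurable borel" and F: "Lbound c K F" and c: "0 \<le> c" and K: "0 < K" and M: "0 < M"
    and [measurable]: "F \<in> borel_measurable borel"
    and h: "AE x in lborel. ennreal (norm (h x)) \<le> ennreal M * F x"
  shows "Lnorm c h \<le> ennreal (M * K)"
proof (cases "c = 0")
  case True
  have "AE x in lborel. F x \<le> ennreal K" using F True by (simp add: Lbound_def)
  with h have "AE x in lborel. ennreal (norm (h x)) \<le> ennreal (M * K)"
  proof eventually_elim
    case (elim x)
    have "ennreal M * F x \<le> ennreal M * ennreal K" by (intro mult_left_mono elim) auto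
    then show ?case using elim M K by (simp add: ennreal_mult)
  qed
  then show ?thesis using True by (simp add: Lnorm_def) (intro esssup_I, auto)
next
  case False
  then have c: "c > 0" using c by simp
  have "(\<integral>\<^sup>+x. ennreal (norm (h x) powr (1 / c)) \<partial>lborel) \<le> (\<integral>\<^sup>+x. ennreal (M powr (1 / c)) * ennpowr (F x) (1 / c) \<partial>lborel)"
  proof (rule nn_integral_mono_AE)
    show "AE x in lborel. ennreal (norm (h x) powr (1 / c)) \<le> ennreal (M powr (1 / c)) * ennpowr (F x) (1 / c)"
      using h
    proof eventually_elim
      case (elim x)
      have "ennpowr (ennreal (norm (h x))) (1 / c) \<le> ennpowr (ennreal M * F x) (1 / c)"
        using c by (intro ennpowr_mono elim) auto
      then show ?case using M by (simp add: ennpowr_mult)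
    qed
  qed
  also have "\<dots> = ennreal (M powr (1 / c)) * (\<integral>\<^sup>+x. ennpowr (F x) (1 / c) \<partial>lborel)"
    by (rule nn_integral_cmult) measurable
  also have "\<dots> \<le> ennreal (M powr (1 / c)) * ennreal (K powr (1 / c))"
    using F False by (intro mult_left_mono) (auto simp: Lbound_def)
  also have "\<dots> = ennreal ((M * K) powr (1 / c))"
    using M K by (simp add: ennreal_mult[symmetric] powr_mult)
  finally have "ennpowr (\<integral>\<^sup>+x. ennreal (norm (h x) powr (1 / c)) \<partial>lborel) c \<le> ennpowr (ennreal ((M * K) powr (1 / c))) c"
    using c by (intro ennpowr_mono) auto
  then show ?thesis using False M K by (simp add: Lnorm_def powr_powr)
qed

lemma bilinear_avg_measurable [measurable]:
  assumes [measurable]: "f \<in> borel_measurable borel" "g \<in> borel_measurable borel"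
  shows "bilinear_avg \<theta> f g \<in> borel_measurable borel"
  unfolding bilinear_avg_def
  by (rule arc.borel_measurable_lebesgue_integral) measurable

text \<open>Up to scaling, the modulus of the bilinear average is dominated by
  \<open>pos_avg\<close> of normalised functions, whose almost everywhere finiteness yields
  convergence of the defining integral. The norm inequality is first proved for strict majorants of
  both norms.\<close>

lemma Lp_bounded_if_pos_bounded:
  assumes "pos_bounded \<theta> (a, b, c)" and nn: "0 \<le> a" "0 \<le> b" "0 \<le> c"
  shows "Lp_bounded \<theta> (a, b, c)"
proof -
  obtain K where K: "K > 0" and B: "\<And>F G. Lunit a F \<Longrightarrow> Lunit b G \<Longrightarrow> Lbound c K (pos_avg \<theta> F G)"
    using assms(1) by (auto simp: pos_bounded_def)
  show ?thesis unfolding Lp_bounded_def prod.case avg_bounded_def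
  proof (intro exI[of _ K] conjI allI impI)
    fix f g :: "real^2 \<Rightarrow> complex"
    assume [measurable]: "f \<in> borel_measurable borel" "g \<in> borel_measurable borel"
      and N: "Lnorm a f < \<infinity>" "Lnorm b g < \<infinity>"
    have *: "(AE x in lborel. integrable arc_length (\<lambda>y. f (x - y) * g (x - rotation \<theta> y))) \<and>
       Lnorm c (bilinear_avg \<theta> f g) \<le> ennreal (M * M' * K)"
      if M: "Lnorm a f < ennreal M" "Lnorm b g < ennreal M'" for M M'
    proof -
      have pos: "M > 0" "M' > 0" using M by (auto simp: not_le[symmetric] ennreal_neg)
      obtain F where F: "Lunit a F" "AE x in lborel. norm (f x) = M * F x"
        using Lunit_normalize[OF _ M(1) nn(1)] by auto
      obtain G where G: "Lunit b G" "AE x in lborel. norm (g x) = M' * G x"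
        using Lunit_normalize[OF _ M(2) nn(2)] by auto
      have [measurable]: "F \<in> borel_measurable borel" "G \<in> borel_measurable borel"
        using F G by (auto intro: LunitD)
      note L = B[OF F(1) G(1)]
      have "AE x in lborel. AE y in arc_length. norm (f (x - y)) = M * F (x - y)"
        by (rule AE_arc_length_translate[OF F(2)]) measurable
      moreover have "AE x in lborel. AE y in arc_length. norm (g (x - rotation \<theta> y)) = M' * G (x - rotation \<theta> y)"
        by (rule AE_arc_length_translate[OF G(2)]) measurable
      ultimately have eq: "AE x in lborel. (\<integral>\<^sup>+y. ennreal (norm (f (x - y) * g (x - rotation \<theta> y))) \<partial>arc_length)
         = ennreal (M * M') * pos_avg \<theta> F G x"
      proof eventually_elim
        case (elim x)
        have "(\<integral>\<^sup>+y. ennreal (norm (f (x - y) * g (x - rotation \<theta> y))) \<partial>arc_length)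
          = (\<integral>\<^sup>+y. ennreal (M * M') * ennreal (F (x - y) * G (x - rotation \<theta> y)) \<partial>arc_length)"
        proof (rule nn_integral_cong_AE)
          show "AE y in arc_length. ennreal (norm (f (x - y) * g (x - rotation \<theta> y)))
            = ennreal (M * M') * ennreal (F (x - y) * G (x - rotation \<theta> y))"
            using elim
          proof eventually_elim
            case (elim y)
            then show ?case using pos LunitD(2)[OF F(1)] LunitD(2)[OF G(1)]
              by (simp add: norm_mult ennreal_mult[symmetric] mult_ac)
          qed
        qed
        also have "\<dots> = ennreal (M * M') * pos_avg \<theta> F G x"
          unfolding pos_avg_def by (rule nn_integral_cmult) measurable
        finally show ?case .
      qed
      have fin: "AE x in lborel. pos_avg \<theta> F G x < top"
        by (rule Lbound_finite[OF L]) measurable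
      have int: "AE x in lborel. integrable arc_length (\<lambda>y. f (x - y) * g (x - rotation \<theta> y))"
        using eq fin
      proof eventually_elim
        case (elim x)
        show ?case
          by (rule integrableI_bounded) (use elim in \<open>auto simp: ennreal_mult_less_top\<close>)
      qed
      have "AE x in lborel. ennreal (norm (bilinear_avg \<theta> f g x)) \<le> ennreal (M * M') * pos_avg \<theta> F G x"
        using eq int
      proof eventually_elim
        case (elim x)
        have "ennreal (norm (bilinear_avg \<theta> f g x)) \<le> (\<integral>\<^sup>+y. ennreal (norm (f (x - y) * g (x - rotation \<theta> y))) \<partial>arc_length)"
          unfolding bilinear_avg_def by (rule integral_norm_bound_ennreal) (rule elim)
        then show ?case using elim by simp
      qed
      then have "Lnorm c (bilinear_avg \<theta> f g) \<le> ennreal (M * M' * K)"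
        using pos by (intro Lnorm_le[OF _ L nn(3) K]) auto
      then show ?thesis using int by blast
    qed
    obtain n1 n2 where n: "Lnorm a f = ennreal n1" "0 \<le> n1" "Lnorm b g = ennreal n2" "0 \<le> n2"
      using N by (cases "Lnorm a f"; cases "Lnorm b g") auto
    \<comment> \<open>Letting the majorants decrease to the norms also covers functions of norm
      0.\<close>
    have **: "Lnorm c (bilinear_avg \<theta> f g) \<le> ennreal ((n1 + 1 / real (Suc k)) * (n2 + 1 / real (Suc k)) * K)" for k
      using *[of "n1 + 1 / real (Suc k)" "n2 + 1 / real (Suc k)"] n by (simp add: ennreal_less_iff)
    have "(\<lambda>k. ennreal ((n1 + 1 / real (Suc k)) * (n2 + 1 / real (Suc k)) * K)) \<longlonglongrightarrow> ennreal ((n1 + 0) * (n2 + 0) * K)"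
      by (intro tendsto_ennrealI tendsto_intros LIMSEQ_Suc[OF lim_1_over_n])
    then have "Lnorm c (bilinear_avg \<theta> f g) \<le> ennreal ((n1 + 0) * (n2 + 0) * K)"
      by (rule tendsto_lowerbound) (use ** in auto)
    then show "Lnorm c (bilinear_avg \<theta> f g) \<le> ennreal K * Lnorm a f * Lnorm b g"
      using n K by (simp add: ennreal_mult mult_ac)
    show "AE x in lborel. integrable arc_length (\<lambda>y. f (x - y) * g (x - rotation \<theta> y))"
      using *[of "n1 + 1" "n2 + 1"] n by (simp add: ennreal_less_iff)
  qed (use K in auto)
qed

section \<open>The embedding of the Lorentz space \<open>L\<^sup>2\<^sup>,\<^sup>1\<close> into
  \<open>L\<^sup>2\<close>\<close>

lemma distribution_le_rearrangement:
  assumes [measurable]: "f \<in> borel_measurable borel"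
  shows "(\<integral>\<^sup>+s\<in>{0<..}. indicator {s. ennreal t < emeasure lborel {x. s < norm (f x)}} s \<partial>lborel) \<le> decreasing_rearrangement f t"
proof (cases "decreasing_rearrangement f t")
  case (real r)
  \<comment> \<open>A level whose superlevel set has measure above \<open>t\<close> lies below every
    competitor in the infimum; so all such levels fit into an interval of length
    \<open>r\<close>.\<close>
  have "s \<le> r" if s: "s > 0" "ennreal t < emeasure lborel {x. s < norm (f x)}" for s
  proof -
    have "ennreal s \<le> decreasing_rearrangement f t"
      unfolding decreasing_rearrangement_def
    proof (rule Inf_greatest, clarify)
      fix u assume u: "emeasure lborel {x. u < ennreal (norm (f x))} \<le> ennreal t"
      show "ennreal s \<le> u"
      proof (rule ccontr)
        assume "\<not> ennreal s \<le> u"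
        then have "emeasure lborel {x. s < norm (f x)} \<le> emeasure lborel {x. u < ennreal (norm (f x))}"
          using s by (intro emeasure_mono) (auto simp: not_le intro: less_le_trans ennreal_leI dest: less_imp_le)
        then show False using u s by auto
      qed
    qed
    then show ?thesis using real s(1) by (auto simp: ennreal_le_iff2)
  qed
  then have "(\<integral>\<^sup>+s\<in>{0<..}. indicator {s. ennreal t < emeasure lborel {x. s < norm (f x)}} s \<partial>lborel) \<le> (\<integral>\<^sup>+s. indicator {0..r} s \<partial>lborel)"
    by (intro nn_integral_mono) (auto split: split_indicator)
  also have "\<dots> = ennreal r" using real by simp
  finally show ?thesis using real by simp
qed simp

text \<open>The primitive of \<open>t powr (-1/2)\<close> is \<open>2 * t powr (1/2)\<close>. For
  infinite \<open>m\<close> the truncations at \<open>n\<^sup>2\<close> have integrals at least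
  \<open>n\<close>.\<close>

lemma nn_integral_inverse_sqrt:
  "(\<integral>\<^sup>+t\<in>{0<..}. ennreal (t powr (- (1/2))) * indicator {t. ennreal t < m} t \<partial>lborel) \<ge> 2 * ennpowr m (1/2)"
    (is "?I m \<ge> _")
proof -
  have fin: "?I (ennreal r) \<ge> ennreal (2 * r powr (1/2))" if "0 \<le> r" for r
  proof -
    have "ennreal (2 * r powr (1/2)) = (\<integral>\<^sup>+t. ennreal (t powr (- (1/2))) * indicator {0..r} t \<partial>lborel)"
      using nn_integral_has_integral_lebesgue'[OF _ has_integral_powr_from_0[of "- (1/2)" r]] that
      by (simp add: mult.commute)
    also have "\<dots> \<le> ?I (ennreal r)"
    proof (rule nn_integral_mono_AE)
      have "AE t in lborel. t \<noteq> 0" "AE t in lborel. t \<noteq> r" by (rule AE_lborel_singleton)+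
      then show "AE t in lborel. ennreal (t powr (- (1/2))) * indicator {0..r} t
        \<le> ennreal (t powr (- (1/2))) * indicator {t. ennreal t < ennreal r} t * indicator {0<..} t"
        by eventually_elim (auto simp: ennreal_less_iff split: split_indicator)
    qed
    finally show ?thesis .
  qed
  show ?thesis
  proof (cases m)
    case (real r)
    then show ?thesis using fin[of r] by (simp add: ennreal_mult)
  next
    case top
    have "ennreal (real n) \<le> ?I top" for n
    proof -
      have "ennreal (real n) \<le> ennreal (2 * ((real n)\<^sup>2) powr (1/2))"
        by (intro ennreal_leI) (simp add: powr_half_sqrt)
      also have "\<dots> \<le> ?I (ennreal ((real n)\<^sup>2))" by (rule fin) simp
      also have "\<dots> \<le> ?I top"
        by (intro nn_integral_mono) (auto split: split_indicator)
      finally show ?thesis .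
    qed
    then have "?I top = top"
      by (metis ennreal_of_nat_eq_real_of_nat ennreal_Ex_less_of_nat less_top not_le)
    then show ?thesis using top by simp
  qed
qed

text \<open>Let \<open>d\<close> be the distribution function, \<open>\<phi>\<close> its square root
  and \<open>I\<close> the integral of \<open>\<phi>\<close>. Writing \<open>2 * \<phi> s\<close> as
  an integral of \<open>t powr (-1/2)\<close> and exchanging the order bounds \<open>2 * I\<close>
  by the Lorentz norm, while the square of the \<open>L\<^sup>2\<close> norm is at most
  \<open>2 * I * I\<close>.\<close>

lemma Lnorm_le_lorentz_norm:
  assumes [measurable]: "f \<in> borel_measurable borel"
  shows "Lnorm (1/2) f \<le> lorentz_norm 2 1 f"
proof -
  define d where "d s = emeasure lborel {x. s < norm (f x)}" for s :: real
  have d_eq: "d s = (\<integral>\<^sup>+x. indicator {s. s < norm (f x)} s \<partial>lborel)" for s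
  proof -
    have "{x \<in> space borel. s < norm (f x)} \<in> sets borel" by measurable
    then have "d s = (\<integral>\<^sup>+x. indicator {x. s < norm (f x)} x \<partial>lborel)"
      by (simp add: d_def)
    also have "\<dots> = (\<integral>\<^sup>+x. indicator {s. s < norm (f x)} s \<partial>lborel)"
      by (intro nn_integral_cong) (auto split: split_indicator)
    finally show ?thesis .
  qed
  have [measurable]: "d \<in> borel_measurable borel"
  proof -
    have "(\<lambda>s. \<integral>\<^sup>+x. indicator {(s, x). s < norm (f x)} (s, x) \<partial>lborel) \<in> borel_measurable borel"
      by measurable
    also have "(\<lambda>s. \<integral>\<^sup>+x. indicator {(s, x). s < norm (f x)} (s, x) \<partial>lborel) = d"
      unfolding d_eq by (intro ext nn_integral_cong) (auto split: split_indicator)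
    finally show ?thesis .
  qed
  have d_mono: "d s' \<le> d s" if "s \<le> s'" for s s'
    unfolding d_def using that by (intro emeasure_mono) auto
  define \<phi> where "\<phi> s = ennpowr (d s) (1/2)" for s
  have [measurable]: "\<phi> \<in> borel_measurable borel" unfolding \<phi>_def by measurable
  have \<phi>2: "\<phi> s * \<phi> s = d s" for s
    by (cases "d s") (simp_all add: \<phi>_def ennpowr_def ennreal_mult[symmetric] powr_add[symmetric])
  define I where "I = (\<integral>\<^sup>+s\<in>{0<..}. \<phi> s \<partial>lborel)"
  have "2 * I = (\<integral>\<^sup>+s. 2 * \<phi> s * indicator {0<..} s \<partial>lborel)"
    unfolding I_def by (subst nn_integral_cmult[symmetric]) (auto simp: mult.assoc)
  also have "\<dots> \<le> (\<integral>\<^sup>+s. (\<integral>\<^sup>+t\<in>{0<..}. ennreal (t powr (- (1/2))) * indicator {t. ennreal t < d s} t \<partial>lborel) * indicator {0<..} s \<partial>lborel)"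
    unfolding \<phi>_def by (intro nn_integral_mono mult_right_mono nn_integral_inverse_sqrt) auto
  also have "\<dots> = (\<integral>\<^sup>+s. \<integral>\<^sup>+t. ennreal (t powr (- (1/2))) * indicator {0<..} t * (indicator {s. ennreal t < d s} s * indicator {0<..} s) \<partial>lborel \<partial>lborel)"
    by (intro nn_integral_cong, subst nn_integral_multc[symmetric]) (auto intro!: nn_integral_cong split: split_indicator)
  also have "\<dots> = (\<integral>\<^sup>+t. \<integral>\<^sup>+s. ennreal (t powr (- (1/2))) * indicator {0<..} t * (indicator {s. ennreal t < d s} s * indicator {0<..} s) \<partial>lborel \<partial>lborel)"
    by (rule lborel_pair.Fubini'[symmetric]) measurable
  also have "\<dots> = (\<integral>\<^sup>+t. ennreal (t powr (- (1/2))) * indicator {0<..} t * (\<integral>\<^sup>+s\<in>{0<..}. indicator {s. ennreal t < d s} s \<partial>lborel) \<partial>lborel)"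
    by (intro nn_integral_cong nn_integral_cmult) measurable
  also have "\<dots> \<le> (\<integral>\<^sup>+t. ennreal (t powr (- (1/2))) * indicator {0<..} t * decreasing_rearrangement f t \<partial>lborel)"
    unfolding d_def by (intro nn_integral_mono mult_left_mono distribution_le_rearrangement) auto
  also have "\<dots> = lorentz_norm 2 1 f"
  proof -
    have e: "ennreal (t powr (1/2)) * ennreal (1 / t) = ennreal (t powr (- (1/2)))" if "t > 0" for t :: real
    proof -
      have "t powr (- (1/2)) = t powr (1/2) * (1 / t)"
        using powr_add[of t "1/2" "-1"] that by (simp add: powr_minus_divide)
      then show ?thesis using that by (simp add: ennreal_mult[symmetric])
    qed
    have r: "a * r * b = (a * b) * r" for a b r :: ennreal
      by (simp only: mult_ac)
    have "ennreal (t powr (- (1/2))) * indicator {0<..} t * decreasing_rearrangement f t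
      = ennpowr (ennreal (t powr (1/2)) * decreasing_rearrangement f t) 1 * ennreal (1 / t) * indicator {0<..} t" for t
    proof (cases "t > 0")
      case True
      then show ?thesis using r[of "ennreal (t powr (1/2))" "decreasing_rearrangement f t" "ennreal (1 / t)"]
        unfolding e[OF True] by simp
    qed simp
    then show ?thesis unfolding lorentz_norm_def by simp
  qed
  finally have I: "2 * I \<le> lorentz_norm 2 1 f" .
  \<comment> \<open>As \<open>\<phi>\<close> is antitone, its integral over \<open>(0, s]\<close> is
    at least \<open>s\<close> times its value at \<open>s\<close>.\<close>
  have s\<phi>: "ennreal s * \<phi> s \<le> I" if "s > 0" for s
  proof -
    have "ennreal s * \<phi> s = (\<integral>\<^sup>+u. \<phi> s * indicator {0<..s} u \<partial>lborel)"
      using that by (simp add: nn_integral_cmult mult.commute)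
    also have "\<dots> \<le> I"
      unfolding I_def \<phi>_def by (intro nn_integral_mono) (auto split: split_indicator intro!: ennpowr_mono d_mono)
    finally show ?thesis .
  qed
  \<comment> \<open>Layer cake formula: the square is the integral of \<open>2 * s\<close> over the
    levels below the modulus.\<close>
  have "(\<integral>\<^sup>+x. ennreal ((norm (f x))\<^sup>2) \<partial>lborel)
    = (\<integral>\<^sup>+x. \<integral>\<^sup>+s. ennreal (2 * s) * indicator {0<..} s * indicator {s. s < norm (f x)} s \<partial>lborel \<partial>lborel)"
  proof (rule nn_integral_cong)
    fix x
    have "((\<lambda>s. 2 * s) has_integral ((norm (f x))\<^sup>2 - 0\<^sup>2)) {0..norm (f x)}"
      by (rule fundamental_theorem_of_calculus)
         (auto intro!: derivative_eq_intros simp: has_real_derivative_iff_has_vector_derivative[symmetric])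
    then have "(\<integral>\<^sup>+s. ennreal (2 * s) * indicator {0..norm (f x)} s \<partial>lborel) = ennreal ((norm (f x))\<^sup>2)"
      by (subst nn_integral_has_integral_lebesgue'[where I="(norm (f x))\<^sup>2"]) auto
    moreover have "(\<integral>\<^sup>+s. ennreal (2 * s) * indicator {0..norm (f x)} s \<partial>lborel)
      = (\<integral>\<^sup>+s. ennreal (2 * s) * indicator {0<..} s * indicator {s. s < norm (f x)} s \<partial>lborel)"
    proof (rule nn_integral_cong_AE)
      have "AE s in lborel. s \<noteq> norm (f x)" by (rule AE_lborel_singleton)
      then show "AE s in lborel. ennreal (2 * s) * indicator {0..norm (f x)} s
        = ennreal (2 * s) * indicator {0<..} s * indicator {s. s < norm (f x)} s"
        by eventually_elim (auto split: split_indicator)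
    qed
    ultimately show "ennreal ((norm (f x))\<^sup>2)
      = (\<integral>\<^sup>+s. ennreal (2 * s) * indicator {0<..} s * indicator {s. s < norm (f x)} s \<partial>lborel)" by simp
  qed
  also have "\<dots> = (\<integral>\<^sup>+s. \<integral>\<^sup>+x. ennreal (2 * s) * indicator {0<..} s * indicator {s. s < norm (f x)} s \<partial>lborel \<partial>lborel)"
    by (rule lborel_pair.Fubini'[symmetric]) measurable
  also have "\<dots> = (\<integral>\<^sup>+s. ennreal (2 * s) * indicator {0<..} s * d s \<partial>lborel)"
    unfolding d_eq by (intro nn_integral_cong nn_integral_cmult) measurable
  also have "\<dots> \<le> (\<integral>\<^sup>+s. 2 * I * (\<phi> s * indicator {0<..} s) \<partial>lborel)"
  proof (rule nn_integral_mono)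
    fix s :: real
    show "ennreal (2 * s) * indicator {0<..} s * d s \<le> 2 * I * (\<phi> s * indicator {0<..} s)"
    proof (cases "s > 0")
      case True
      have "ennreal (2 * s) * d s = 2 * (ennreal s * \<phi> s) * \<phi> s"
        using True by (simp add: ennreal_mult \<phi>2[symmetric] mult.assoc)
      also have "\<dots> \<le> 2 * I * \<phi> s"
        by (intro mult_right_mono mult_left_mono s\<phi> True) auto
      finally show ?thesis using True by simp
    qed simp
  qed
  also have "\<dots> = 2 * I * I"
    unfolding I_def by (rule nn_integral_cmult) measurable
  also have "\<dots> \<le> (2 * I) * (2 * I)"
    by (intro mult_left_mono) (auto simp: mult_2)
  also have "\<dots> \<le> lorentz_norm 2 1 f * lorentz_norm 2 1 f"
    by (intro mult_mono I) auto
  finally have "ennpowr (\<integral>\<^sup>+x. ennreal ((norm (f x))\<^sup>2) \<partial>lborel) (1/2)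
    \<le> ennpowr (lorentz_norm 2 1 f * lorentz_norm 2 1 f) (1/2)"
    by (intro ennpowr_mono) auto
  also have "lorentz_norm 2 1 f * lorentz_norm 2 1 f = ennpowr (lorentz_norm 2 1 f) 2"
    by (simp add: ennpowr_numeral power2_eq_square)
  finally show ?thesis by (simp add: Lnorm_def ennpowr_ennpowr powr_numeral)
qed

lemma lorentz_bounded:
  assumes "Lp_bounded \<theta> (1/2, 1/2, 1/2)"
  shows "avg_bounded \<theta> (lorentz_norm 2 1) (lorentz_norm 2 1) (Lnorm (1/2))"
proof -
  obtain C where C: "0 \<le> C" and B: "\<forall>f g. f \<in> borel_measurable borel \<longrightarrow> g \<in> borel_measurable borel \<longrightarrow>
        Lnorm (1/2) f < \<infinity> \<longrightarrow> Lnorm (1/2) g < \<infinity> \<longrightarrow>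
        (AE x in lborel. integrable arc_length (\<lambda>y. f (x - y) * g (x - rotation \<theta> y))) \<and>
        Lnorm (1/2) (bilinear_avg \<theta> f g) \<le> ennreal C * Lnorm (1/2) f * Lnorm (1/2) g"
    using assms unfolding Lp_bounded_def prod.case avg_bounded_def by (elim exE conjE) (rule that)
  show ?thesis unfolding avg_bounded_def
  proof (intro exI[of _ C] conjI allI impI C)
    fix f g :: "real^2 \<Rightarrow> complex"
    assume m: "f \<in> borel_measurable borel" "g \<in> borel_measurable borel"
      and fin: "lorentz_norm 2 1 f < \<infinity>" "lorentz_norm 2 1 g < \<infinity>"
    note le = Lnorm_le_lorentz_norm[OF m(1)] Lnorm_le_lorentz_norm[OF m(2)]
    note b = B[rule_format, OF m le_less_trans[OF le(1) fin(1)] le_less_trans[OF le(2) fin(2)]]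
    show "AE x in lborel. integrable arc_length (\<lambda>y. f (x - y) * g (x - rotation \<theta> y))" using b by blast
    have "ennreal C * Lnorm (1/2) f * Lnorm (1/2) g \<le> ennreal C * lorentz_norm 2 1 f * lorentz_norm 2 1 g"
      by (intro mult_mono le) auto
    then show "Lnorm (1/2) (bilinear_avg \<theta> f g) \<le> ennreal C * lorentz_norm 2 1 f * lorentz_norm 2 1 g"
      using b by (meson order_trans)
  qed
qed

section \<open>Necessary conditions\<close>

lemma measure_arc_length_ge:
  assumes [measurable]: "A \<in> sets borel" and b: "0 \<le> \<beta>" "\<beta> \<le> 2 * pi" and A: "\<And>t. 0 \<le> t \<Longrightarrow> t < \<beta> \<Longrightarrow> circ (t + s) \<in> A"
  shows "\<beta> \<le> measure arc_length A"
proof -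
  have "ennreal \<beta> = (\<integral>\<^sup>+t. indicator {0..<\<beta>} t \<partial>lborel)"
    using b by simp
  also have "\<dots> \<le> (\<integral>\<^sup>+t\<in>{0..<2*pi}. indicator A (circ (t + s)) \<partial>lborel)"
    using A b by (intro nn_integral_mono) (auto split: split_indicator)
  also have "\<dots> = (\<integral>\<^sup>+y. indicator A y \<partial>arc_length)"
    by (rule nn_integral_arc_length_shift) measurable
  also have "\<dots> = ennreal (measure arc_length A)"
    by (simp add: arc.emeasure_eq_measure)
  finally show ?thesis by simp
qed

lemma Lnorm_indicator_le:
  assumes [measurable]: "E \<in> sets borel" and e: "emeasure lborel E \<le> ennreal e" "0 < e" and a: "0 \<le> a"
  shows "Lnorm a (indicator E) \<le> ennreal (e powr a)"
proof (cases "a = 0")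
  case True
  have "esssup lborel (\<lambda>x. ennreal (norm (indicator E x :: complex))) \<le> 1"
    by (rule esssup_I) (auto split: split_indicator)
  then show ?thesis using True e by (simp add: Lnorm_def)
next
  case False
  have "(\<integral>\<^sup>+x. ennreal (norm (indicator E x :: complex) powr (1 / a)) \<partial>lborel) = (\<integral>\<^sup>+x. indicator E x \<partial>lborel)"
    using False by (intro nn_integral_cong) (auto split: split_indicator)
  then have "(\<integral>\<^sup>+x. ennreal (norm (indicator E x :: complex) powr (1 / a)) \<partial>lborel) \<le> ennreal e"
    using e by simp
  then have "ennpowr (\<integral>\<^sup>+x. ennreal (norm (indicator E x :: complex) powr (1 / a)) \<partial>lborel) a \<le> ennpowr (ennreal e) a"
    using a by (intro ennpowr_mono)
  then show ?thesis using False e by (simp add: Lnorm_def)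
qed

lemma Lnorm_ge:
  assumes [measurable]: "k \<in> borel_measurable borel" "H \<in> sets borel"
    and k: "\<And>x. x \<in> H \<Longrightarrow> \<beta> \<le> norm (k x)" and b: "0 \<le> \<beta>"
    and h: "ennreal h \<le> emeasure lborel H" "0 < h" and c: "0 \<le> c"
  shows "ennreal (\<beta> * h powr c) \<le> Lnorm c k"
proof (cases "c = 0")
  case True
  have "ennreal \<beta> \<le> esssup lborel (\<lambda>x. ennreal (norm (k x)))"
  proof (rule ccontr)
    assume nle: "\<not> ennreal \<beta> \<le> esssup lborel (\<lambda>x. ennreal (norm (k x)))"
    have "AE x in lborel. x \<notin> H"
      using esssup_AE[of "\<lambda>x. ennreal (norm (k x))" lborel]
    proof eventually_elim
      case (elim x)
      then have "ennreal (norm (k x)) < ennreal \<beta>" using nle by auto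
      then have "norm (k x) < \<beta>" using b by (simp add: ennreal_less_iff)
      then show ?case using k[of x] by force
    qed
    then have "emeasure lborel H = 0" by (subst (asm) AE_iff_measurable[of H]) auto
    with h show False by simp
  qed
  then show ?thesis using True h by (simp add: Lnorm_def)
next
  case False
  then have c: "0 < c" using c by simp
  have "ennreal (\<beta> powr (1 / c)) * ennreal h \<le> ennreal (\<beta> powr (1 / c)) * emeasure lborel H"
    by (intro mult_left_mono h) auto
  also have "\<dots> = (\<integral>\<^sup>+x. ennreal (\<beta> powr (1 / c)) * indicator H x \<partial>lborel)"
    by (simp add: nn_integral_cmult)
  also have "\<dots> \<le> (\<integral>\<^sup>+x. ennreal (norm (k x) powr (1 / c)) \<partial>lborel)"
    using k b c by (intro nn_integral_mono) (auto split: split_indicator intro!: ennreal_leI powr_mono2)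
  finally have "ennpowr (ennreal (\<beta> powr (1 / c)) * ennreal h) c \<le> Lnorm c k"
    using False c by (simp add: Lnorm_def ennpowr_mono)
  moreover have "ennpowr (ennreal (\<beta> powr (1 / c)) * ennreal h) c = ennreal (\<beta> * h powr c)"
    using b h c by (simp add: ennpowr_mult powr_powr ennreal_mult)
  ultimately show ?thesis by simp
qed

text \<open>Common form of all counterexamples. On indicators of \<open>E\<close> and
  \<open>F\<close> the average at \<open>x\<close> is the length of the set of admissible circle
  points, at least \<beta> when that set contains an arc of this length. The constant is obtained
  before the sets, hence uniform over a family that shrinks or grows with a parameter.\<close>

lemma Lp_bounded_test:
  assumes B: "Lp_bounded \<theta> (a, b, c)" and nn: "0 \<le> a" "0 \<le> b" "0 \<le> c"
  obtains C where "0 \<le> C" and "\<And>E F H \<beta> e g h. \<lbrakk>E \<in> sets borel; F \<in> sets borel; H \<in> sets borel;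
     0 < e; 0 < g; 0 < h; emeasure lborel E \<le> ennreal e; emeasure lborel F \<le> ennreal g; ennreal h \<le> emeasure lborel H;
     0 \<le> \<beta>; \<beta> \<le> 2 * pi;
     \<And>x. x \<in> H \<Longrightarrow> \<exists>s. \<forall>t. 0 \<le> t \<longrightarrow> t < \<beta> \<longrightarrow> x - circ (t + s) \<in> E \<and> x - circ (t + s + \<theta>) \<in> F\<rbrakk>
     \<Longrightarrow> \<beta> * h powr c \<le> C * (e powr a * g powr b)"
proof -
  obtain C where C: "0 \<le> C" and BC: "\<forall>f g. f \<in> borel_measurable borel \<longrightarrow> g \<in> borel_measurable borel \<longrightarrow>
        Lnorm a f < \<infinity> \<longrightarrow> Lnorm b g < \<infinity> \<longrightarrow>
        (AE x in lborel. integrable arc_length (\<lambda>y. f (x - y) * g (x - rotation \<theta> y))) \<and>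
        Lnorm c (bilinear_avg \<theta> f g) \<le> ennreal C * Lnorm a f * Lnorm b g"
    using B unfolding Lp_bounded_def prod.case avg_bounded_def by (elim exE conjE) (rule that)
  show thesis
  proof (rule that[OF C])
    fix E F H :: "(real^2) set" and \<beta> e g h :: real
    assume m [measurable]: "E \<in> sets borel" "F \<in> sets borel" "H \<in> sets borel"
      and pos: "0 < e" "0 < g" "0 < h"
      and em: "emeasure lborel E \<le> ennreal e" "emeasure lborel F \<le> ennreal g" "ennreal h \<le> emeasure lborel H"
      and \<beta>: "0 \<le> \<beta>" "\<beta> \<le> 2 * pi"
      and H: "\<And>x. x \<in> H \<Longrightarrow> \<exists>s. \<forall>t. 0 \<le> t \<longrightarrow> t < \<beta> \<longrightarrow> x - circ (t + s) \<in> E \<and> x - circ (t + s + \<theta>) \<in> F"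
    define f1 f2 :: "real^2 \<Rightarrow> complex" where "f1 = indicator E" "f2 = indicator F"
    have [measurable]: "f1 \<in> borel_measurable borel" "f2 \<in> borel_measurable borel"
      unfolding f1_f2_def by measurable
    have L: "Lnorm a f1 \<le> ennreal (e powr a)" "Lnorm b f2 \<le> ennreal (g powr b)"
      unfolding f1_f2_def by (intro Lnorm_indicator_le m em pos nn)+
    have "norm (bilinear_avg \<theta> f1 f2 x) = measure arc_length {y. x - y \<in> E \<and> x - rotation \<theta> y \<in> F}" for x
    proof -
      have "{y \<in> space borel. x - y \<in> E \<and> x - rotation \<theta> y \<in> F} \<in> sets borel" by measurable
      then have "(\<integral>y. complex_of_real (indicator {y. x - y \<in> E \<and> x - rotation \<theta> y \<in> F} y) \<partial>arc_length)
        = of_real (measure arc_length {y. x - y \<in> E \<and> x - rotation \<theta> y \<in> F})"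
        by simp
      moreover have "bilinear_avg \<theta> f1 f2 x = (\<integral>y. complex_of_real (indicator {y. x - y \<in> E \<and> x - rotation \<theta> y \<in> F} y) \<partial>arc_length)"
        unfolding bilinear_avg_def f1_f2_def by (intro Bochner_Integration.integral_cong) (auto split: split_indicator)
      ultimately show ?thesis by simp
    qed
    moreover have "\<beta> \<le> measure arc_length {y. x - y \<in> E \<and> x - rotation \<theta> y \<in> F}" if x: "x \<in> H" for x
    proof -
      obtain s where s: "\<And>t. 0 \<le> t \<Longrightarrow> t < \<beta> \<Longrightarrow> x - circ (t + s) \<in> E \<and> x - circ (t + s + \<theta>) \<in> F"
        using H[OF x] by blast
      have "{y \<in> space borel. x - y \<in> E \<and> x - rotation \<theta> y \<in> F} \<in> sets borel" by measurable
      then show ?thesis using s \<beta> by (intro measure_arc_length_ge[of _ _ s]) (auto simp: rotation_circ)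
    qed
    ultimately have "ennreal (\<beta> * h powr c) \<le> Lnorm c (bilinear_avg \<theta> f1 f2)"
      by (intro Lnorm_ge[of _ H] \<beta> em pos nn) auto
    also have "\<dots> \<le> ennreal C * Lnorm a f1 * Lnorm b f2"
      using BC[rule_format, of f1 f2] L by (auto simp: le_less_trans[OF _ ennreal_less_top])
    also have "\<dots> \<le> ennreal C * ennreal (e powr a) * ennreal (g powr b)"
      by (intro mult_mono L) auto
    also have "\<dots> = ennreal (C * (e powr a * g powr b))"
      using C by (simp add: ennreal_mult mult.assoc)
    finally show "\<beta> * h powr c \<le> C * (e powr a * g powr b)"
      using C by (simp add: ennreal_le_iff)
  qed
qed

text \<open>Comparing powers as the scale \<open>d\<close> tends to 0 turns a family of test
  estimates into a linear inequality between exponents.\<close>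

lemma powr_exponent_le:
  fixes K L p q :: real
  assumes K: "0 < K" and L: "0 \<le> L" and le: "\<And>d. 0 < d \<Longrightarrow> d < \<delta> \<Longrightarrow> K * d powr p \<le> L * d powr q" and \<delta>: "0 < \<delta>"
  shows "q \<le> p"
proof (rule ccontr)
  assume "\<not> q \<le> p"
  then have pq: "0 < q - p" by simp
  \<comment> \<open>With this choice \<open>L * d powr (q - p)\<close> is at most
    \<open>L * K / (2 * (L + 1))\<close>, less than \<open>K\<close>; adding 1 to \<open>L\<close>
    admits \<open>L = 0\<close>.\<close>
  define d where "d = min (\<delta> / 2) ((K / (2 * (L + 1))) powr (1 / (q - p)))"
  have d: "0 < d" "d < \<delta>" using \<delta> K L by (auto simp: d_def)
  have "d powr (q - p) \<le> ((K / (2 * (L + 1))) powr (1 / (q - p))) powr (q - p)"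
    using d pq by (intro powr_mono2) (auto simp: d_def)
  also have "\<dots> = K / (2 * (L + 1))" using pq K L by (simp add: powr_powr)
  finally have small: "d powr (q - p) \<le> K / (2 * (L + 1))" .
  have "K * d powr p \<le> L * (d powr (q - p) * d powr p)"
    using le[OF d] by (simp add: powr_add[symmetric])
  then have "K * d powr p \<le> (L * d powr (q - p)) * d powr p" by (simp add: mult_ac)
  then have "K \<le> L * d powr (q - p)" using d by (simp add: mult_le_cancel_right)
  also have "\<dots> \<le> L * (K / (2 * (L + 1)))" by (intro mult_left_mono small L)
  also have "\<dots> < K" using K L by (simp add: field_simps add_nonneg_pos)
  finally show False by simp
qed

lemma power_powr_pos:
  fixes d a :: real
  assumes "0 < d"
  shows "(d\<^sup>2) powr a = d powr (2 * a)" "(d ^ 3) powr a = d powr (3 * a)" "((1 / d)\<^sup>2) powr a = d powr (- 2 * a)"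
proof -
  show "(d\<^sup>2) powr a = d powr (2 * a)" "(d ^ 3) powr a = d powr (3 * a)"
    using powr_powr[of d 2 a] powr_powr[of d 3 a] assms by simp_all
  then show "((1 / d)\<^sup>2) powr a = d powr (- 2 * a)"
    using assms by (simp add: power_divide powr_divide powr_minus field_simps)
qed

section \<open>Measures of the test sets, and chords\<close>

lemma emeasure_cball_2: "0 \<le> r \<Longrightarrow> emeasure lborel (cball (0::real^2) r) = ennreal (pi * r\<^sup>2)"
  by (simp add: emeasure_cball unit_ball_vol_2)

lemma closed_annulus: "closed {v::real^2. \<bar>norm v - r\<bar> \<le> d}"
  by (intro closed_Collect_le continuous_intros)

lemma emeasure_annulus:
  assumes "0 < d" "d < r"
  shows "emeasure lborel {v::real^2. \<bar>norm v - r\<bar> \<le> d} = ennreal (4 * pi * r * d)"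
proof -
  have "{v::real^2. \<bar>norm v - r\<bar> \<le> d} = cball 0 (r + d) - ball 0 (r - d)"
    by (auto simp: abs_le_iff)
  then have "emeasure lborel {v::real^2. \<bar>norm v - r\<bar> \<le> d} = emeasure lborel (cball (0::real^2) (r + d)) - emeasure lborel (ball (0::real^2) (r - d))"
    using assms by (simp add: emeasure_Diff emeasure_ball subset_iff)
  also have "\<dots> = ennreal (pi * (r + d)\<^sup>2) - ennreal (pi * (r - d)\<^sup>2)"
    using assms by (simp add: emeasure_cball_2 emeasure_ball unit_ball_vol_2)
  also have "\<dots> = ennreal (pi * (r + d)\<^sup>2 - pi * (r - d)\<^sup>2)"
    by (rule ennreal_minus) simp
  also have "pi * (r + d)\<^sup>2 - pi * (r - d)\<^sup>2 = 4 * pi * r * d"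
    by (simp add: power2_eq_square algebra_simps)
  finally show ?thesis .
qed

lemma norm_circ_diff_le: "norm (circ s - circ t) \<le> \<bar>s - t\<bar>"
proof -
  have "(norm (circ s - circ t))\<^sup>2 = (cos s - cos t)\<^sup>2 + (sin s - sin t)\<^sup>2"
    by (simp add: norm_vec_def L2_set_def UNIV_2)
  also have "\<dots> = 2 - 2 * cos (s - t)"
    using sin_cos_squared_add[of s] sin_cos_squared_add[of t]
    by (simp add: cos_diff power2_eq_square algebra_simps)
  also have "cos (s - t) = 1 - 2 * (sin ((s - t) / 2))\<^sup>2"
    using cos_double_sin[of "(s - t) / 2"] by (simp only: nonzero_mult_div_cancel_left times_divide_eq_right zero_neq_numeral not_False_eq_True)
  also have "2 - 2 * (1 - 2 * (sin ((s - t) / 2))\<^sup>2) = 4 * (sin ((s - t) / 2))\<^sup>2" by simp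
  also have "\<dots> \<le> 4 * ((s - t) / 2)\<^sup>2"
    by (intro mult_left_mono abs_le_square_iff[THEN iffD1, OF abs_sin_x_le_abs_x]) simp
  also have "\<dots> = \<bar>s - t\<bar>\<^sup>2" by (simp add: power_divide)
  finally show ?thesis by (rule power2_le_imp_le) simp
qed

lemma norm_circ_shift:
  assumes "0 < \<theta>" "\<theta> < 2 * pi"
  shows "norm (circ t - circ (t + \<theta>)) = 2 * sin (\<theta> / 2)"
proof -
  have "0 < sin (\<theta> / 2)" using assms by (intro sin_gt_zero) auto
  then show ?thesis by (simp add: circ_diff abs_mult)
qed

text \<open>Discs of radius \<open>2 / d\<close> tested on the disc of radius \<open>1 / d\<close>:
  the whole circle around \<open>x\<close> stays inside. Large radii are parametrised by their
  inverse so that the comparison as \<open>d\<close> tends to 0 applies.\<close>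

lemma necessary_sum:
  assumes "Lp_bounded \<theta> (a, b, c)" "0 \<le> a" "0 \<le> b" "0 \<le> c"
  shows "c \<le> a + b"
proof -
  obtain C where C: "0 \<le> C" and T: "\<And>E F H \<beta> e g h. \<lbrakk>E \<in> sets borel; F \<in> sets borel; H \<in> sets borel;
     0 < e; 0 < g; 0 < h; emeasure lborel E \<le> ennreal e; emeasure lborel F \<le> ennreal g; ennreal h \<le> emeasure lborel H;
     0 \<le> \<beta>; \<beta> \<le> 2 * pi;
     \<And>x. x \<in> H \<Longrightarrow> \<exists>s. \<forall>t. 0 \<le> t \<longrightarrow> t < \<beta> \<longrightarrow> x - circ (t + s) \<in> E \<and> x - circ (t + s + \<theta>) \<in> F\<rbrakk>
     \<Longrightarrow> \<beta> * h powr c \<le> C * (e powr a * g powr b)"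
    using Lp_bounded_test[OF assms] by blast
  have "- 2 * a + - 2 * b \<le> - 2 * c"
  proof (rule powr_exponent_le[where \<delta>=1])
    fix d :: real assume d: "0 < d" "d < 1"
    have 1: "2 * pi * (pi * (1 / d)\<^sup>2) powr c \<le> C * ((pi * (2 / d)\<^sup>2) powr a * (pi * (2 / d)\<^sup>2) powr b)"
    proof (rule T[of "cball 0 (2 / d)" "cball 0 (2 / d)" "cball 0 (1 / d)"])
      fix x :: "real^2" assume "x \<in> cball 0 (1 / d)"
      then have "norm x \<le> 1 / d" by simp
      moreover have "1 \<le> 1 / d" "2 / d = 1 / d + 1 / d" using d by simp_all
      ultimately have "norm (x - circ t) \<le> 2 / d" for t
        using norm_triangle_ineq4[of x "circ t"] unfolding norm_circ by linarith
      then show "\<exists>s. \<forall>t. 0 \<le> t \<longrightarrow> t < 2 * pi \<longrightarrow> x - circ (t + s) \<in> cball 0 (2 / d) \<and> x - circ (t + s + \<theta>) \<in> cball 0 (2 / d)"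
        by (simp add: dist_norm norm_minus_commute)
    qed (use d in \<open>auto simp: emeasure_cball_2\<close>)
    have p: "(2 / d)\<^sup>2 = 4 * (1 / d)\<^sup>2"
      by (simp add: power_divide)
    show "(2 * pi * pi powr c) * d powr (- 2 * c) \<le> (C * ((4 * pi) powr a * (4 * pi) powr b)) * d powr (- 2 * a + - 2 * b)"
      using 1 unfolding p by (simp only: powr_mult power_powr_pos(3)[OF d(1)] powr_add mult_ac)
  qed (use C in auto)
  then show ?thesis by simp
qed

text \<open>For \<open>x\<close> within \<open>d\<close> of the origin the whole circle around
  \<open>x\<close> lies in the annulus of half-width \<open>d\<close> about the unit circle. The
  disc has area of order \<open>d\<^sup>2\<close>, the annulus of order \<open>d\<close>.\<close>

lemma necessary_annuli:
  assumes "Lp_bounded \<theta> (a, b, c)" "0 \<le> a" "0 \<le> b" "0 \<le> c"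
  shows "a + b \<le> 2 * c"
proof -
  obtain C where C: "0 \<le> C" and T: "\<And>E F H \<beta> e g h. \<lbrakk>E \<in> sets borel; F \<in> sets borel; H \<in> sets borel;
     0 < e; 0 < g; 0 < h; emeasure lborel E \<le> ennreal e; emeasure lborel F \<le> ennreal g; ennreal h \<le> emeasure lborel H;
     0 \<le> \<beta>; \<beta> \<le> 2 * pi;
     \<And>x. x \<in> H \<Longrightarrow> \<exists>s. \<forall>t. 0 \<le> t \<longrightarrow> t < \<beta> \<longrightarrow> x - circ (t + s) \<in> E \<and> x - circ (t + s + \<theta>) \<in> F\<rbrakk>
     \<Longrightarrow> \<beta> * h powr c \<le> C * (e powr a * g powr b)"
    using Lp_bounded_test[OF assms] by blast
  show ?thesis
  proof (rule powr_exponent_le[where \<delta>=1])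
    fix d :: real assume d: "0 < d" "d < 1"
    let ?A = "{v::real^2. \<bar>norm v - 1\<bar> \<le> d}"
    have 1: "2 * pi * (pi * d\<^sup>2) powr c \<le> C * ((4 * pi * 1 * d) powr a * (4 * pi * 1 * d) powr b)"
    proof (rule T[of ?A ?A "cball 0 d"])
      fix x :: "real^2" assume "x \<in> cball 0 d"
      then have "\<bar>norm (x - circ t) - 1\<bar> \<le> d" for t
        using norm_triangle_ineq3[of "x - circ t" "- circ t"] by simp
      then show "\<exists>s. \<forall>t. 0 \<le> t \<longrightarrow> t < 2 * pi \<longrightarrow> x - circ (t + s) \<in> ?A \<and> x - circ (t + s + \<theta>) \<in> ?A"
        by simp
    qed (use d in \<open>auto simp: emeasure_cball_2 emeasure_annulus closed_annulus\<close>)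
    show "(2 * pi * pi powr c) * d powr (2 * c) \<le> (C * ((4 * pi) powr a * (4 * pi) powr b)) * d powr (a + b)"
      using 1 by (simp only: powr_mult power_powr_pos(1)[OF d(1)] powr_add powr_one_eq_one mult_1_left mult_1_right mult_ac)
  qed (use C in auto)
qed

lemma annulus_near_circ:
  assumes "x \<in> {v::real^2. \<bar>norm v - 1\<bar> \<le> d / 2}" "d < 1"
  obtains s where "norm (x - circ s) \<le> d / 2"
proof -
  have x: "x \<noteq> 0" using assms by auto
  then have "norm (x /\<^sub>R norm x) = 1" by simp
  then obtain s where s: "x /\<^sub>R norm x = circ s" by (rule norm_1_circ)
  have "x - circ s = (norm x - 1) *\<^sub>R circ s"
    using x unfolding s[symmetric] by (simp add: scaleR_diff_left left_diff_distrib)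
  then have "norm (x - circ s) = \<bar>norm x - 1\<bar>" by simp
  then show ?thesis using assms that[of s] by simp
qed

text \<open>Take a disc of radius \<open>d\<close>, and an annulus about the circle of radius
  \<open>r\<close>, the distance from \<open>y\<close> to its rotation. If \<open>x\<close> is near
  the unit circle, an arc of length \<open>d / 2\<close> brings \<open>x - y\<close> into the disc,
  and then \<open>x - rotation \<theta> y\<close> has norm within \<open>d\<close> of
  \<open>r\<close>. This compares \<open>d powr (1 + c)\<close> with
  \<open>d powr (2 * a + b)\<close>; exchanging the roles gives the second inequality.\<close>

lemma necessary_ball_annulus:
  assumes "Lp_bounded \<theta> (a, b, c)" "0 \<le> a" "0 \<le> b" "0 \<le> c" and \<theta>: "0 < \<theta>" "\<theta> < 2 * pi"
  shows "2 * a + b \<le> 1 + c" "a + 2 * b \<le> 1 + c"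
proof -
  obtain C where C: "0 \<le> C" and T: "\<And>E F H \<beta> e g h. \<lbrakk>E \<in> sets borel; F \<in> sets borel; H \<in> sets borel;
     0 < e; 0 < g; 0 < h; emeasure lborel E \<le> ennreal e; emeasure lborel F \<le> ennreal g; ennreal h \<le> emeasure lborel H;
     0 \<le> \<beta>; \<beta> \<le> 2 * pi;
     \<And>x. x \<in> H \<Longrightarrow> \<exists>s. \<forall>t. 0 \<le> t \<longrightarrow> t < \<beta> \<longrightarrow> x - circ (t + s) \<in> E \<and> x - circ (t + s + \<theta>) \<in> F\<rbrakk>
     \<Longrightarrow> \<beta> * h powr c \<le> C * (e powr a * g powr b)"
    using Lp_bounded_test[OF assms(1-4)] by blast
  define r where "r = 2 * sin (\<theta> / 2)"
  have r: "0 < r" using \<theta> by (simp add: r_def sin_gt_zero)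
  have shift: "norm (circ t - circ (t + \<theta>)) = r" for t
    using norm_circ_shift[OF \<theta>] by (simp add: r_def)
  \<comment> \<open>Below this bound the annuli about the radii \<open>r\<close> and 1 do not reach
    the origin.\<close>
  define d0 where "d0 = min 1 r"
  have d0: "0 < d0" using r by (simp add: d0_def)
  let ?A = "\<lambda>d. {v::real^2. \<bar>norm v - r\<bar> \<le> d}" and ?H = "\<lambda>d. {v::real^2. \<bar>norm v - 1\<bar> \<le> d / 2}"
  have close: "norm (x - circ (t + s)) \<le> d" if "norm (x - circ s) \<le> d / 2" "0 \<le> t" "t < d / 2" for x s t d
    using that norm_triangle_ineq[of "x - circ s" "circ s - circ (t + s)"] norm_circ_diff_le[of s "t + s"] by simp
  have h: "ennreal (2 * pi * d) \<le> emeasure lborel (?H d)" if "0 < d" "d < d0" for d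
    using emeasure_annulus[of "d / 2" 1] that by (simp add: d0_def)
  show "2 * a + b \<le> 1 + c"
  proof (rule powr_exponent_le[OF _ _ _ d0])
    fix d :: real assume d: "0 < d" "d < d0"
    have 1: "d / 2 * (2 * pi * d) powr c \<le> C * ((pi * d\<^sup>2) powr a * (4 * pi * r * d) powr b)"
    proof (rule T[of "cball 0 d" "?A d" "?H d"])
      fix x :: "real^2" assume x: "x \<in> ?H d"
      have "d < 1" using d by (simp add: d0_def)
      with x obtain s where s: "norm (x - circ s) \<le> d / 2" by (rule annulus_near_circ)
      have "x - circ (t + s) \<in> cball 0 d \<and> x - circ (t + s + \<theta>) \<in> ?A d" if t: "0 \<le> t" "t < d / 2" for t
      proof -
        note cl = close[OF s t]
        have "\<bar>norm (x - circ (t + s + \<theta>)) - norm (circ (t + s) - circ (t + s + \<theta>))\<bar> \<le> norm (x - circ (t + s))"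
          using norm_triangle_ineq3[of "x - circ (t + s + \<theta>)" "circ (t + s) - circ (t + s + \<theta>)"] by simp
        then show ?thesis using cl by (simp add: shift)
      qed
      then show "\<exists>s. \<forall>t. 0 \<le> t \<longrightarrow> t < d / 2 \<longrightarrow> x - circ (t + s) \<in> cball 0 d \<and> x - circ (t + s + \<theta>) \<in> ?A d"
        by blast
    qed (use d r h pi_gt3 in \<open>auto simp: emeasure_cball_2 emeasure_annulus closed_annulus d0_def\<close>)
    show "(1/2 * (2 * pi) powr c) * d powr (1 + c) \<le> (C * (pi powr a * (4 * pi * r) powr b)) * d powr (2 * a + b)"
      using 1 d(1) by (simp add: powr_mult power_powr_pos(1)[OF d(1)] powr_add mult_ac)
  qed (use C in auto)
  show "a + 2 * b \<le> 1 + c"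
  proof (rule powr_exponent_le[OF _ _ _ d0])
    fix d :: real assume d: "0 < d" "d < d0"
    have 1: "d / 2 * (2 * pi * d) powr c \<le> C * ((4 * pi * r * d) powr a * (pi * d\<^sup>2) powr b)"
    proof (rule T[of "?A d" "cball 0 d" "?H d"])
      fix x :: "real^2" assume x: "x \<in> ?H d"
      have "d < 1" using d by (simp add: d0_def)
      with x obtain s where s: "norm (x - circ s) \<le> d / 2" by (rule annulus_near_circ)
      \<comment> \<open>The arc starts at \<open>s - \<theta>\<close>, so that now the rotated point
        is close to \<open>x\<close>.\<close>
      have "x - circ (t + (s - \<theta>)) \<in> ?A d \<and> x - circ (t + (s - \<theta>) + \<theta>) \<in> cball 0 d" if t: "0 \<le> t" "t < d / 2" for t
      proof -
        have cl: "norm (x - circ (t + s)) \<le> d" by (rule close[OF s t])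
        have e: "t + (s - \<theta>) + \<theta> = t + s" by simp
        have "norm (circ (t + s) - circ (t + (s - \<theta>))) = r"
          using shift[of "t + (s - \<theta>)"] unfolding e by (simp add: norm_minus_commute)
        moreover have "\<bar>norm (x - circ (t + (s - \<theta>))) - norm (circ (t + s) - circ (t + (s - \<theta>)))\<bar> \<le> norm (x - circ (t + s))"
          using norm_triangle_ineq3[of "x - circ (t + (s - \<theta>))" "circ (t + s) - circ (t + (s - \<theta>))"] by simp
        ultimately show ?thesis using cl unfolding e by simp
      qed
      then show "\<exists>s. \<forall>t. 0 \<le> t \<longrightarrow> t < d / 2 \<longrightarrow> x - circ (t + s) \<in> ?A d \<and> x - circ (t + s + \<theta>) \<in> cball 0 d"
        by blast
    qed (use d r h pi_gt3 in \<open>auto simp: emeasure_cball_2 emeasure_annulus closed_annulus d0_def\<close>)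
    show "(1/2 * (2 * pi) powr c) * d powr (1 + c) \<le> (C * ((4 * pi * r) powr a * pi powr b)) * d powr (a + 2 * b)"
      using 1 d(1) by (simp add: powr_mult power_powr_pos(1)[OF d(1)] powr_add mult_ac)
  qed (use C in auto)
qed

lemma emeasure_lborel_cbox_2:
  assumes "l \<le> l'" "m \<le> m'"
  shows "emeasure lborel (cbox (vector [l, m]) (vector [l', m'] :: real^2)) = ennreal ((l' - l) * (m' - m))"
proof -
  have B: "(Basis :: (real^2) set) = {axis 1 1, axis 2 1}"
    by (auto simp: Basis_vec_def UNIV_2)
  have ne: "(axis 1 1 :: real^2) \<noteq> axis 2 1"
    by (simp add: axis_eq_axis)
  show ?thesis using assms
    by (subst emeasure_lborel_cbox) (auto simp: B ne inner_axis)
qed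

text \<open>Antipodal points have parallel tangents, so one thin box of centres suits both: along an
  arc of length \<open>d\<close> at \<open>(1, 0)\<close> the circle leaves its vertical tangent by
  at most \<open>d\<^sup>2 / 2\<close>, and the antipodal arc behaves likewise. All three boxes have
  area of order \<open>d ^ 3\<close>, and the arc contributes one further \<open>d\<close>.\<close>

lemma necessary_Knapp:
  assumes "Lp_bounded pi (a, b, c)" "0 \<le> a" "0 \<le> b" "0 \<le> c"
  shows "3 * (a + b) \<le> 1 + 3 * c"
proof -
  obtain C where C: "0 \<le> C" and T: "\<And>E F H \<beta> e g h. \<lbrakk>E \<in> sets borel; F \<in> sets borel; H \<in> sets borel;
     0 < e; 0 < g; 0 < h; emeasure lborel E \<le> ennreal e; emeasure lborel F \<le> ennreal g; ennreal h \<le> emeasure lborel H;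
     0 \<le> \<beta>; \<beta> \<le> 2 * pi;
     \<And>x. x \<in> H \<Longrightarrow> \<exists>s. \<forall>t. 0 \<le> t \<longrightarrow> t < \<beta> \<longrightarrow> x - circ (t + s) \<in> E \<and> x - circ (t + s + pi) \<in> F\<rbrakk>
     \<Longrightarrow> \<beta> * h powr c \<le> C * (e powr a * g powr b)"
    using Lp_bounded_test[OF assms] by blast
  show ?thesis
  proof (rule powr_exponent_le[where \<delta>=1])
    fix d :: real assume d: "0 < d" "d < 1"
    let ?E = "cbox (vector [-1 - d\<^sup>2, -2 * d]) (vector [-1 + d\<^sup>2, 2 * d]) :: (real^2) set"
    let ?F = "cbox (vector [1 - d\<^sup>2, -2 * d]) (vector [1 + d\<^sup>2, 2 * d]) :: (real^2) set"
    let ?H = "cbox (vector [- (d\<^sup>2 / 2), - d]) (vector [d\<^sup>2 / 2, d]) :: (real^2) set"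
    have 1: "d * (2 * d ^ 3) powr c \<le> C * ((8 * d ^ 3) powr a * (8 * d ^ 3) powr b)"
    proof (rule T[of ?E ?F ?H])
      fix x :: "real^2" assume x: "x \<in> ?H"
      have "x - circ (t + 0) \<in> ?E \<and> x - circ (t + 0 + pi) \<in> ?F" if t: "0 \<le> t" "t < d" for t
      proof -
        have "\<bar>sin t\<bar> \<le> d" using abs_sin_x_le_abs_x[of t] t by simp
        moreover have "1 - cos t \<le> d\<^sup>2 / 2"
        proof -
          have "1 - cos t = 2 * (sin (t / 2))\<^sup>2" using cos_double_sin[of "t / 2"] by simp
          also have "\<dots> \<le> 2 * (t / 2)\<^sup>2"
            by (intro mult_left_mono abs_le_square_iff[THEN iffD1, OF abs_sin_x_le_abs_x]) simp
          also have "\<dots> = t\<^sup>2 / 2" by (simp add: power_divide)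
          also have "t\<^sup>2 \<le> d\<^sup>2" using t by (intro power_mono) auto
          finally show ?thesis by simp
        qed
        ultimately show ?thesis using x cos_le_one[of t]
          by (auto simp: mem_box_cart forall_2 abs_le_iff) (use zero_le_power2[of d] cos_le_one[of t] in linarith)+
      qed
      then show "\<exists>s. \<forall>t. 0 \<le> t \<longrightarrow> t < d \<longrightarrow> x - circ (t + s) \<in> ?E \<and> x - circ (t + s + pi) \<in> ?F"
        by blast
    qed (use d pi_gt3 in \<open>auto simp: emeasure_lborel_cbox_2 power2_eq_square power3_eq_cube\<close>)
    show "(2 powr c) * d powr (1 + 3 * c) \<le> (C * (8 powr a * 8 powr b)) * d powr (3 * (a + b))"
      using 1 d(1) by (simp add: powr_mult power_powr_pos(2)[OF d(1)] powr_add distrib_left mult_ac)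
  qed (use C in auto)
qed

section \<open>The polyhedra\<close>

lemma convex_combination_7:
  assumes "convex K" "v1 \<in> K" "v2 \<in> K" "v3 \<in> K" "v4 \<in> K" "v5 \<in> K" "v6 \<in> K" "v7 \<in> K"
    and "0 \<le> w1" "0 \<le> w2" "0 \<le> w3" "0 \<le> w4" "0 \<le> w5" "0 \<le> w6" "0 \<le> w7" "w1 + w2 + w3 + w4 + w5 + w6 + w7 = (1::real)"
  shows "w1 *\<^sub>R v1 + w2 *\<^sub>R v2 + w3 *\<^sub>R v3 + w4 *\<^sub>R v4 + w5 *\<^sub>R v5 + w6 *\<^sub>R v6 + w7 *\<^sub>R v7 \<in> K"
proof -
  let ?w = "\<lambda>i. [w1, w2, w3, w4, w5, w6, w7] ! i" and ?v = "\<lambda>i. [v1, v2, v3, v4, v5, v6, v7] ! i"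
  have e: "{..<7} = {0, 1, 2, 3, 4, 5, 6::nat}" by auto
  have "(\<Sum>i\<in>{..<7}. ?w i *\<^sub>R ?v i) \<in> K"
    by (rule convex_sum) (use assms in \<open>auto simp: e\<close>)
  then show ?thesis by (simp add: e add.assoc)
qed

text \<open>An arbitrary convex set containing the vertices is used instead of their hull, so that
  the larger polyhedron can invoke the result as well.\<close>

lemma mem_polyhedron_pi:
  assumes K: "convex K" "{(0, 0, 0), (2/3, 2/3, 1), (0, 2/3, 1/3), (2/3, 0, 1/3), (0, 1, 1), (1, 0, 1)} \<subseteq> K"
    and nn: "0 \<le> a" "0 \<le> b" "c \<le> 1"
    and le: "c \<le> a + b" "2 * a + b \<le> 1 + c" "a + 2 * b \<le> 1 + c" "a + b \<le> 2 * c" "3 * (a + b) \<le> 1 + 3 * c"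
  shows "(a, b, c) \<in> (K :: (real \<times> real \<times> real) set)"
proof -
  have *: "(a, b, c) \<in> K"
    if "0 \<le> e1" "0 \<le> e2" "0 \<le> e3" "0 \<le> m12" "0 \<le> m13" "0 \<le> m23" "e1 + e2 + e3 + m12 + m13 + m23 = 1"
      "a = e1 + 2/3 * (m12 + m13)" "b = e2 + 2/3 * (m12 + m23)" "c = e1 + e2 + m12 + (m13 + m23) / 3"
    for e1 e2 e3 m12 m13 m23
    using convex_combination_7[OF K(1), of "(1, 0, 1)" "(0, 1, 1)" "(0, 0, 0)" "(2/3, 2/3, 1)" "(2/3, 0, 1/3)" "(0, 2/3, 1/3)" "(0, 0, 0)"
        e1 e2 e3 m12 m13 m23 0] K(2) that
    by (simp add: algebra_simps add_divide_distrib)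
  \<comment> \<open>In the coordinates \<open>(a, b, 1 - c)\<close> the polyhedron is an octahedron in which the unit vector \<open>e\<^sub>i\<close> is opposite to
    \<open>m\<^sub>j\<^sub>k = 2/3 (e\<^sub>j + e\<^sub>k)\<close>. The cases are the four tetrahedra around the axis from \<open>e\<^sub>1\<close> to \<open>m\<^sub>2\<^sub>3\<close>.\<close>
  define d where "d = 1 - c"
  \<comment> \<open>In any admissible representation \<open>l\<close> equals
    \<open>m12 + m13 + m23\<close>, so the last hypothesis says that this total weight is at most
    1.\<close>
  define l where "l = 3 * (a + b - c)"
  have eqs: "c = 1 - d" "l = 3 * (a + b + d - 1)" by (auto simp: d_def l_def)
  consider "b \<ge> 2 * l / 3" "d \<ge> 2 * l / 3" | "b \<le> 2 * l / 3" "d \<ge> 2 * l / 3"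
    | "b \<ge> 2 * l / 3" "d \<le> 2 * l / 3" | "b \<le> 2 * l / 3" "d \<le> 2 * l / 3" by linarith
  then show ?thesis
  proof cases
    case 1
    then show ?thesis using nn le unfolding eqs
      by (intro *[of a "b - 2 * l / 3" "d - 2 * l / 3" 0 0 l, unfolded eqs]) (auto simp: field_simps)
  next
    case 2
    then show ?thesis using nn le unfolding eqs
      by (intro *[of "a + b - 2 * l / 3" 0 "d - 2 * l / 3" 0 "l - 3 * b / 2" "3 * b / 2", unfolded eqs]) (auto simp: field_simps)
  next
    case 3
    then show ?thesis using nn le unfolding eqs
      by (intro *[of "a + d - 2 * l / 3" "b - 2 * l / 3" 0 "l - 3 * d / 2" 0 "3 * d / 2", unfolded eqs]) (auto simp: field_simps)
  next
    case 4
    then show ?thesis using nn le unfolding eqs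
      by (intro *[of "1 - l" 0 0 "l - 3 * d / 2" "l - 3 * b / 2" "3 * (b + d) / 2 - l", unfolded eqs]) (auto simp: field_simps)
  qed
qed

text \<open>A point violating the inequality specific to \<open>\<theta> = \<pi>\<close> lies beyond
  the face spanned by \<open>(2/3, 2/3, 1)\<close>, \<open>(2/3, 0, 1/3)\<close> and
  \<open>(0, 2/3, 1/3)\<close>, in the tetrahedron over that face with apex
  \<open>(1/2, 1/2, 1/2)\<close>.\<close>

lemma mem_polyhedron_generic:
  assumes K: "convex K" "{(0, 0, 0), (2/3, 2/3, 1), (0, 2/3, 1/3), (2/3, 0, 1/3), (1, 0, 1), (0, 1, 1), (1/2, 1/2, 1/2)} \<subseteq> K"
    and nn: "0 \<le> a" "0 \<le> b" "c \<le> 1"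
    and le: "c \<le> a + b" "2 * a + b \<le> 1 + c" "a + 2 * b \<le> 1 + c" "a + b \<le> 2 * c"
  shows "(a, b, c) \<in> (K :: (real \<times> real \<times> real) set)"
proof (cases "3 * (a + b) \<le> 1 + 3 * c")
  case True
  show ?thesis
    by (rule mem_polyhedron_pi[OF K(1) _ nn le True]) (use K(2) in simp)
next
  case False
  \<comment> \<open>Barycentric coordinates in that tetrahedron: the weights on the face are
    multiples of the slacks in three of the hypotheses, and \<open>p\<close> measures the
    violation.\<close>
  define m12 m13 m23 p where "m12 = 3/2 * (2 * c - a - b)" "m13 = 3/2 * (1 + c - a - 2 * b)"
    "m23 = 3/2 * (1 + c - 2 * a - b)" "p = 6 * (a + b - c) - 2"
  note defs = this
  have "(1/2, 1/2, 1/2) \<in> K" "(2/3, 2/3, 1) \<in> K" "(2/3, 0, 1/3) \<in> K" "(0, 2/3, 1/3) \<in> K" using K(2) by auto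
  then have "0 *\<^sub>R (1/2, 1/2, 1/2) + 0 *\<^sub>R (1/2, 1/2, 1/2) + 0 *\<^sub>R (1/2, 1/2, 1/2)
     + m12 *\<^sub>R (2/3, 2/3, 1) + m13 *\<^sub>R (2/3, 0, 1/3) + m23 *\<^sub>R (0, 2/3, 1/3) + p *\<^sub>R (1/2, 1/2, 1/2) \<in> K"
    using False le by (intro convex_combination_7[OF K(1)]) (auto simp: defs field_simps)
  moreover have "0 *\<^sub>R (1/2, 1/2, 1/2) + 0 *\<^sub>R (1/2, 1/2, 1/2) + 0 *\<^sub>R (1/2, 1/2, 1/2)
     + m12 *\<^sub>R (2/3, 2/3, 1) + m13 *\<^sub>R (2/3, 0, 1/3) + m23 *\<^sub>R (0, 2/3, 1/3) + p *\<^sub>R (1/2, 1/2, 1/2) = (a, b, c)"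
    by (simp add: defs field_simps)
  ultimately show ?thesis by simp
qed

section \<open>Identification of the type sets\<close>

lemma Lp_bounded_imp_mem_polyhedron:
  assumes "v \<in> unit_cube" "Lp_bounded \<theta> v" "0 < \<theta>" "\<theta> < 2 * pi"
  shows "v \<in> polyhedron_generic" "\<theta> = pi \<Longrightarrow> v \<in> polyhedron_pi"
proof -
  obtain a b c where v: "v = (a, b, c)" by (metis prod_cases3)
  have nn: "0 \<le> a" "0 \<le> b" "0 \<le> c" "c \<le> 1" using assms(1) by (auto simp: v unit_cube_def)
  note B = assms(2)[unfolded v]
  note le = necessary_sum[OF B nn(1-3)] necessary_ball_annulus[OF B nn(1-3) assms(3,4)] necessary_annuli[OF B nn(1-3)]
  show "v \<in> polyhedron_generic"
    unfolding v polyhedron_generic_def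
    by (rule mem_polyhedron_generic[OF convex_convex_hull hull_subset nn(1,2,4) le])
  show "v \<in> polyhedron_pi" if "\<theta> = pi"
    unfolding v polyhedron_pi_def
    by (rule mem_polyhedron_pi[OF convex_convex_hull hull_subset nn(1,2,4) le necessary_Knapp[OF B[unfolded that] nn(1-3)]])
qed

lemma polyhedra_subset_unit_cube: "polyhedron_generic \<subseteq> unit_cube" "polyhedron_pi \<subseteq> unit_cube"
proof -
  have c: "convex unit_cube"
    unfolding unit_cube_def by (intro convex_Times convex_real_interval)
  show "polyhedron_generic \<subseteq> unit_cube" "polyhedron_pi \<subseteq> unit_cube"
    unfolding polyhedron_generic_def polyhedron_pi_def
    by (rule hull_minimal, simp add: unit_cube_def, rule c)+
qed

lemma Lp_bounded_if_mem_polyhedron: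
  assumes \<theta>: "0 < \<theta>" "\<theta> < 2 * pi"
  shows "v \<in> polyhedron_pi \<Longrightarrow> Lp_bounded \<theta> v" "\<theta> \<noteq> pi \<Longrightarrow> v \<in> polyhedron_generic \<Longrightarrow> Lp_bounded \<theta> v"
proof -
  let ?B = "{(a, b, c). 0 \<le> a \<and> 0 \<le> b \<and> 0 \<le> c \<and> pos_bounded \<theta> (a, b, c)}"
  have imp: "Lp_bounded \<theta> v" if "v \<in> ?B" for v
    using that Lp_bounded_if_pos_bounded by auto
  note vertices = pos_bounded_0_0_0 pos_bounded_1_0_1 pos_bounded_0_1_1 pos_bounded_twothirds_0_third
    pos_bounded_0_twothirds_third pos_bounded_twothirds_twothirds_1[OF \<theta>]
  have "polyhedron_pi \<subseteq> ?B"
    unfolding polyhedron_pi_def by (rule hull_minimal) (use vertices convex_pos_bounded in auto)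
  then show "v \<in> polyhedron_pi \<Longrightarrow> Lp_bounded \<theta> v" using imp by blast
  show "Lp_bounded \<theta> v" if "\<theta> \<noteq> pi" "v \<in> polyhedron_generic"
  proof -
    have "sin \<theta> \<noteq> 0"
    proof (cases "\<theta> < pi")
      case True
      then show ?thesis using sin_gt_zero[of \<theta>] \<theta> by simp
    next
      case False
      then show ?thesis using sin_lt_zero[of \<theta>] \<theta> that by simp
    qed
    then have "polyhedron_generic \<subseteq> ?B"
      unfolding polyhedron_generic_def
      by (intro hull_minimal) (use vertices convex_pos_bounded pos_bounded_half_half_half in auto)
    then show ?thesis using imp that by blast
  qed
qed

theorem theorem1p2:
  fixes \<theta> :: real
  assumes "0 < \<theta>" and "\<theta> < 2 * pi"
  shows "(\<theta> \<noteq> pi \<longrightarrow>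
            type_set \<theta> - {(1/2, 1/2, 1/2)} = polyhedron_generic - {(1/2, 1/2, 1/2)} \<and>
            avg_bounded \<theta> (lorentz_norm 2 1) (lorentz_norm 2 1) (Lnorm (1/2)))
       \<and> (\<theta> = pi \<longrightarrow> (\<forall>v\<in>polyhedron_pi. Lp_bounded \<theta> v))
       \<and> (\<theta> \<noteq> pi \<longrightarrow> (\<forall>v\<in>unit_cube. v \<notin> polyhedron_generic \<longrightarrow> \<not> Lp_bounded \<theta> v))
       \<and> (\<theta> = pi \<longrightarrow> (\<forall>v\<in>unit_cube. v \<notin> polyhedron_pi \<longrightarrow> \<not> Lp_bounded \<theta> v))"
proof -
  note nec = Lp_bounded_imp_mem_polyhedron[OF _ _ assms] and suf = Lp_bounded_if_mem_polyhedron[OF assms]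
  \<comment> \<open>Equality holds with the apex included, by the strong type bound there; removing
    the point from both sides gives the stated form.\<close>
  have "type_set \<theta> = polyhedron_generic" if "\<theta> \<noteq> pi"
    using nec(1) suf(2)[OF that] polyhedra_subset_unit_cube(1) by (auto simp: type_set_def)
  moreover have "avg_bounded \<theta> (lorentz_norm 2 1) (lorentz_norm 2 1) (Lnorm (1/2))" if "\<theta> \<noteq> pi"
  proof -
    have "(1/2, 1/2, 1/2) \<in> polyhedron_generic"
      unfolding polyhedron_generic_def by (rule hull_inc) simp
    then show ?thesis using suf(2)[OF that] lorentz_bounded by blast
  qed
  ultimately show ?thesis using nec suf by blast
qed

end
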